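(* Consider pairs of concrete hybrid programs $\mathit{ctrl}_a;\mathit{plant}_a$ and $\mathit{ctrl}_b;\mathit{plant}_b$ with discrete loop-free controllers $\mathit{ctrl}_a,\mathit{ctrl}_b$ and plants $\mathit{plant}_a=\{\bar y'=p(\bar y,\bar u)\,\&\,Q\}$ and $\mathit{plant}_b=\{\bar y'=q(\bar y,\bar u)\,\&\,R\}$, as described in the context, such that $\mathit{ctrl}_b$ is idempotent. If validity of the formula $[\mathit{ctrl}_a][\mathit{plant}_a](p(\bar y,\bar u)=q(\bar y,\bar u)\wedge R)$ is decidable (for the class of such pairs under consideration), then validity of $(\mathit{ctrl}_a;\mathit{plant}_a)^*\le(\mathit{ctrl}_b;\mathit{plant}_b)^*$ is also decidable (for that class).
   Context: Hybrid programs of dRL: $\alpha,\beta ::= ?Q \mid x:=\theta \mid x:=* \mid \{\bar y'=\bar\theta\,\&\,Q\} \mid \alpha\cup\beta \mid \alpha;\beta\mid\alpha^*$ (concrete: no uninterpreted function, predicate or program symbols; terms are polynomials with rational coefficients). For each variable $x$ there is a differential symbol $x'$, itself a variable. A state is a map from variables (including differential symbols) to $\mathbb R$. Transition semantics: $?Q$ keeps states satisfying $Q$; $x:=\theta$ maps $\nu$ to $\nu[x\mapsto\nu(\theta)]$; $x:=*$ maps $\nu$ to every $\nu[x\mapsto r]$; $(\nu,\omega)$ is a transition of $\{\bar y'=\bar\theta\,\&\,Q\}$ iff there are $r\ge0$ and a function $\varphi$ from $[0,r]$ to states with $\varphi(0)$ differing from $\nu$ at most on $\bar y'$, each $\varphi(t)$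 differing from $\nu$ at most on $\bar y,\bar y'$, $\varphi(r)=\omega$, and for all $t\in[0,r]$: $\varphi(t)$ satisfies $\bar y'=\bar\theta\wedge Q$ and $\frac{d}{dt}\varphi(t)(\bar y)$ equals the value of $\bar\theta$ in $\varphi(t)$; $\cup$ union, $;$ composition, $\alpha^*$ reflexive–transitive closure. $[\alpha]\phi$ holds in $\nu$ iff $\phi$ holds in all states reachable from $\nu$ by $\alpha$. $\alpha\le\beta$ holds in $\nu$ iff every state reachable from $\nu$ by $\alpha$ is reachable from $\nu$ by $\beta$. A formula is valid if it holds in every state. $\alpha\equiv\beta$ means $\alpha\le\beta\wedge\beta\le\alpha$. Setting: variables are split into disjoint tuples $\bar u$ (discrete parameters) and $\bar y$ (continuous variables), $\bar y$ containing a global clock $t$. A controller is a concrete, discrete, loop-free program built from $x:=\theta$, $x:=*$, $?Q$ (first-order real arithmetic $Q$), $\cup$ and $;$, assigning only variables of $\bar u$ and not mentioning differential symbols. A plant is $\{\bar y'=p(\bar y,\bar u)\,\&\,Q\}$ with $p$ a tuple of polynomials whose clock component is $1$ and $Q$ a first-order real-arithmetic formula. A controller $\mathit{ctrl}$ is idempotent if $\mathit{ctrl};\mathit{ctrl}\equiv\mathit{ctrl}$ is valid. The equation $p(\bar y,\bar u)=q(\bar y,\bar u)$ is componentwise. *)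

theory Defs
  imports Complex_Main "HOL-Library.Nat_Bijection"
begin

section \<open>Differential refinement logic: syntax\<close>

datatype var = Base nat | Diff var

datatype trm = Var var | Const rat | Plus trm trm | Times trm trm

datatype fml =
    Geq trm trm
  | Neg fml
  | Conj fml fml
  | Forall var fml
  | Box prog fml
  | Refines prog prog
and prog =
    Test fml
  | Assign var trm
  | AssignAny var
  | ODE "(var \<times> trm) list" fml
  | Choice prog prog
  | Seq prog prog
  | Loop prog

definition Truth :: fml where
  "Truth = Geq (Const 0) (Const 0)"

definition Equal :: "trm \<Rightarrow> trm \<Rightarrow> fml" where
  "Equal \<theta> \<eta> = Conj (Geq \<theta> \<eta>) (Geq \<eta> \<theta>)"

definition Equals :: "trm list \<Rightarrow> trm list \<Rightarrow> fml" where
  "Equals \<theta>s \<eta>s = foldr Conj (map2 Equal \<theta>s \<eta>s) Truth"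

definition Equiv :: "prog \<Rightarrow> prog \<Rightarrow> fml" where
  "Equiv \<alpha> \<beta> = Conj (Refines \<alpha> \<beta>) (Refines \<beta> \<alpha>)"


section \<open>Semantics\<close>

type_synonym state = "var \<Rightarrow> real"

primrec tval :: "trm \<Rightarrow> state \<Rightarrow> real" where
  "tval (Var x) \<nu> = \<nu> x"
| "tval (Const c) \<nu> = of_rat c"
| "tval (Plus \<theta> \<eta>) \<nu> = tval \<theta> \<nu> + tval \<eta> \<nu>"
| "tval (Times \<theta> \<eta>) \<nu> = tval \<theta> \<nu> * tval \<eta> \<nu>"

text \<open>
  In the clause for \<open>ODE\<close>, derivatives are taken relative to the interval \<open>{0..r}\<close>: they are
  one-sided at its end points, and for \<open>r = 0\<close> the derivative condition is void. The values of
  \<open>\<phi>\<close> outside the interval are irrelevant.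
\<close>

primrec sat :: "fml \<Rightarrow> state \<Rightarrow> bool" and reach :: "prog \<Rightarrow> (state \<times> state) set" where
  "sat (Geq \<theta> \<eta>) = (\<lambda>\<nu>. tval \<theta> \<nu> \<ge> tval \<eta> \<nu>)"
| "sat (Neg P) = (\<lambda>\<nu>. \<not> sat P \<nu>)"
| "sat (Conj P Q) = (\<lambda>\<nu>. sat P \<nu> \<and> sat Q \<nu>)"
| "sat (Forall x P) = (\<lambda>\<nu>. \<forall>a. sat P (\<nu>(x := a)))"
| "sat (Box \<alpha> P) = (\<lambda>\<nu>. \<forall>\<omega>. (\<nu>, \<omega>) \<in> reach \<alpha> \<longrightarrow> sat P \<omega>)"
| "sat (Refines \<alpha> \<beta>) = (\<lambda>\<nu>. \<forall>\<omega>. (\<nu>, \<omega>) \<in> reach \<alpha> \<longrightarrow> (\<nu>, \<omega>) \<in> reach \<beta>)"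
| "reach (Test P) = {(\<nu>, \<omega>). \<omega> = \<nu> \<and> sat P \<nu>}"
| "reach (Assign x \<theta>) = {(\<nu>, \<omega>). \<omega> = \<nu>(x := tval \<theta> \<nu>)}"
| "reach (AssignAny x) = {(\<nu>, \<omega>). \<exists>a. \<omega> = \<nu>(x := a)}"
| "reach (ODE xs P) = {(\<nu>, \<omega>). \<exists>(r::real) (\<phi> :: real \<Rightarrow> state).
      r \<ge> 0
    \<and> (\<forall>z. z \<notin> Diff ` fst ` set xs \<longrightarrow> \<phi> 0 z = \<nu> z)
    \<and> \<phi> r = \<omega>
    \<and> (\<forall>s\<in>{0..r}.
          (\<forall>z. z \<notin> fst ` set xs \<union> Diff ` fst ` set xs \<longrightarrow> \<phi> s z = \<nu> z)
        \<and> (\<forall>(x, \<theta>)\<in>set xs. \<phi> s (Diff x) = tval \<theta> (\<phi> s))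
        \<and> sat P (\<phi> s)
        \<and> (\<forall>(x, \<theta>)\<in>set xs.
              ((\<lambda>\<tau>. \<phi> \<tau> x) has_real_derivative tval \<theta> (\<phi> s)) (at s within {0..r})))}"
| "reach (Choice \<alpha> \<beta>) = reach \<alpha> \<union> reach \<beta>"
| "reach (Seq \<alpha> \<beta>) = reach \<alpha> O reach \<beta>"
| "reach (Loop \<alpha>) = (reach \<alpha>)\<^sup>*"

definition valid :: "fml \<Rightarrow> bool" where
  "valid P \<longleftrightarrow> (\<forall>\<nu>. sat P \<nu>)"

definition idempotent :: "prog \<Rightarrow> bool" where
  "idempotent \<alpha> \<longleftrightarrow> valid (Equiv (Seq \<alpha> \<alpha>) \<alpha>)"


section \<open>Controllers and plants\<close>

primrec tvars :: "trm \<Rightarrow> var set" where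
  "tvars (Var x) = {x}"
| "tvars (Const c) = {}"
| "tvars (Plus \<theta> \<eta>) = tvars \<theta> \<union> tvars \<eta>"
| "tvars (Times \<theta> \<eta>) = tvars \<theta> \<union> tvars \<eta>"

text \<open>\<open>arith V P\<close>: \<open>P\<close> is a formula of first-order real arithmetic all of whose
  variables, free or bound, are in \<open>V\<close>.\<close>

primrec arith :: "var set \<Rightarrow> fml \<Rightarrow> bool" where
  "arith V (Geq \<theta> \<eta>) \<longleftrightarrow> tvars \<theta> \<union> tvars \<eta> \<subseteq> V"
| "arith V (Neg P) \<longleftrightarrow> arith V P"
| "arith V (Conj P Q) \<longleftrightarrow> arith V P \<and> arith V Q"
| "arith V (Forall x P) \<longleftrightarrow> x \<in> V \<and> arith V P"
| "arith V (Box \<alpha> P) \<longleftrightarrow> False"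
| "arith V (Refines \<alpha> \<beta>) \<longleftrightarrow> False"

text \<open>\<open>controller U Y \<alpha>\<close>: \<open>U\<close> are the discrete parameters and \<open>Y\<close> the continuous
  variables. Differential symbols are excluded because \<open>U\<close> and \<open>Y\<close> will only
  contain base variables.\<close>

primrec controller :: "var set \<Rightarrow> var set \<Rightarrow> prog \<Rightarrow> bool" where
  "controller U Y (Test P) \<longleftrightarrow> arith (U \<union> Y) P"
| "controller U Y (Assign x \<theta>) \<longleftrightarrow> x \<in> U \<and> tvars \<theta> \<subseteq> U \<union> Y"
| "controller U Y (AssignAny x) \<longleftrightarrow> x \<in> U"
| "controller U Y (ODE xs P) \<longleftrightarrow> False"
| "controller U Y (Choice \<alpha> \<beta>) \<longleftrightarrow> controller U Y \<alpha> \<and> controller U Y \<beta>"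
| "controller U Y (Seq \<alpha> \<beta>) \<longleftrightarrow> controller U Y \<alpha> \<and> controller U Y \<beta>"
| "controller U Y (Loop \<alpha>) \<longleftrightarrow> False"

text \<open>A pair of programs, given by its components: the tuple of continuous variables shared by
  both plants and, for each of the two programs, the controller, the right-hand sides of the
  differential equations and the evolution domain.\<close>

record prog_pair =
  cvars :: "var list"
  ctrl_a :: prog
  rhs_a :: "trm list"
  dom_a :: fml
  ctrl_b :: prog
  rhs_b :: "trm list"
  dom_b :: fml

definition plant_a :: "prog_pair \<Rightarrow> prog" where
  "plant_a D = ODE (zip (cvars D) (rhs_a D)) (dom_a D)"

definition plant_b :: "prog_pair \<Rightarrow> prog" where
  "plant_b D = ODE (zip (cvars D) (rhs_b D)) (dom_b D)"

text \<open>The list \<open>us\<close> is the tuple of discrete parameters and \<open>i\<close> the position of the clock.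
  Evolution domains may also mention differential symbols of the variables.\<close>

definition admissible :: "prog_pair \<Rightarrow> bool" where
  "admissible D \<longleftrightarrow>
    (\<exists>us. let ys = cvars D; U = set us; Y = set ys; V = U \<union> Y in
        distinct (us @ ys) \<and> V \<subseteq> range Base
      \<and> controller U Y (ctrl_a D) \<and> controller U Y (ctrl_b D)
      \<and> length (rhs_a D) = length ys \<and> length (rhs_b D) = length ys
      \<and> (\<forall>\<theta>\<in>set (rhs_a D) \<union> set (rhs_b D). tvars \<theta> \<subseteq> V)
      \<and> (\<exists>i<length ys. rhs_a D ! i = Const 1 \<and> rhs_b D ! i = Const 1)
      \<and> arith (V \<union> Diff ` V) (dom_a D) \<and> arith (V \<union> Diff ` V) (dom_b D))
    \<and> idempotent (ctrl_b D)"

definition box_fml :: "prog_pair \<Rightarrow> fml" where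
  "box_fml D = Box (ctrl_a D) (Box (plant_a D) (Conj (Equals (rhs_a D) (rhs_b D)) (dom_b D)))"

definition refinement_fml :: "prog_pair \<Rightarrow> fml" where
  "refinement_fml D =
     Refines (Loop (Seq (ctrl_a D) (plant_a D))) (Loop (Seq (ctrl_b D) (plant_b D)))"


section \<open>Partial recursive functions\<close>

datatype recf = Zero | Succ | Proj nat | Comp recf "recf list" | Prim recf recf | Mu recf

inductive reval :: "recf \<Rightarrow> nat list \<Rightarrow> nat \<Rightarrow> bool" where
  zero: "reval Zero xs 0"
| succ: "reval Succ [x] (Suc x)"
| proj: "i < length xs \<Longrightarrow> reval (Proj i) xs (xs ! i)"
| comp: "list_all2 (\<lambda>g. reval g xs) gs ys \<Longrightarrow> reval f ys z \<Longrightarrow> reval (Comp f gs) xs z"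
| prim_zero: "reval f xs y \<Longrightarrow> reval (Prim f g) (0 # xs) y"
| prim_Suc: "reval (Prim f g) (n # xs) r \<Longrightarrow> reval g (n # r # xs) y \<Longrightarrow>
    reval (Prim f g) (Suc n # xs) y"
| mu: "reval f (n # xs) 0 \<Longrightarrow> (\<forall>i<n. \<exists>y>0. reval f (i # xs) y) \<Longrightarrow> reval (Mu f) xs n"

inductive_cases revalE:
  "reval Zero xs y" "reval Succ xs y" "reval (Proj i) xs y" "reval (Comp f gs) xs y"
  "reval (Prim f g) (0 # xs) y" "reval (Prim f g) (Suc n # xs) y" "reval (Mu f) xs y"

lemma reval_deterministic: "reval f xs y \<Longrightarrow> reval f xs z \<Longrightarrow> y = z"
proof (induction arbitrary: z rule: reval.induct)
  case (zero xs)
  then show ?case by (rule revalE(1)) simp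
next
  case (succ x)
  then show ?case by (rule revalE(2)) simp
next
  case (proj i xs)
  from proj.prems show ?case by (rule revalE(3)) simp
next
  case (comp xs gs ys f w)
  from comp.prems obtain vs where vs: "list_all2 (\<lambda>g. reval g xs) gs vs" and f: "reval f vs z"
    by (rule revalE(4))
  have "ys = vs"
  proof (rule nth_equalityI)
    show "length ys = length vs"
      using comp.IH(1) vs by (simp add: list_all2_conv_all_nth)
    show "ys ! i = vs ! i" if "i < length ys" for i
      using comp.IH(1) vs that by (simp add: list_all2_conv_all_nth)
  qed
  then show ?case using comp.IH(2) f by simp
next
  case (prim_zero f xs y g)
  from prim_zero.prems show ?case by (rule revalE(5)) (rule prim_zero.IH)
next
  case (prim_Suc f g n xs r y)
  from prim_Suc.prems obtain r' where r': "reval (Prim f g) (n # xs) r'"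
    and y: "reval g (n # r' # xs) z"
    by (rule revalE(6))
  then show ?case using prim_Suc.IH(1)[OF r'] prim_Suc.IH(2) by simp
next
  case (mu f n xs)
  from mu.prems have z: "reval f (z # xs) 0" "\<forall>i<z. \<exists>y>0. reval f (i # xs) y"
    by (auto elim: revalE(7))
  have "\<not> z < n"
    using mu.IH(2) z(1) by fastforce
  moreover have "\<not> n < z"
    using mu.IH(1) z(2) by fastforce
  ultimately show ?case by simp
qed


section \<open>Goedel numbering and decidability\<close>

primrec var_code :: "var \<Rightarrow> nat" where
  "var_code (Base n) = prod_encode (0, n)"
| "var_code (Diff x) = prod_encode (1, var_code x)"

definition rat_code :: "rat \<Rightarrow> nat" where
  "rat_code c = prod_encode (map_prod int_encode int_encode (quotient_of c))"

primrec trm_code :: "trm \<Rightarrow> nat" where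
  "trm_code (Var x) = prod_encode (0, var_code x)"
| "trm_code (Const c) = prod_encode (1, rat_code c)"
| "trm_code (Plus \<theta> \<eta>) = prod_encode (2, prod_encode (trm_code \<theta>, trm_code \<eta>))"
| "trm_code (Times \<theta> \<eta>) = prod_encode (3, prod_encode (trm_code \<theta>, trm_code \<eta>))"

definition ode_code :: "(var \<times> trm) list \<Rightarrow> nat" where
  "ode_code xs = list_encode (map (\<lambda>(x, \<theta>). prod_encode (var_code x, trm_code \<theta>)) xs)"

primrec fml_code :: "fml \<Rightarrow> nat" and prog_code :: "prog \<Rightarrow> nat" where
  "fml_code (Geq \<theta> \<eta>) = prod_encode (0, prod_encode (trm_code \<theta>, trm_code \<eta>))"
| "fml_code (Neg P) = prod_encode (1, fml_code P)"
| "fml_code (Conj P Q) = prod_encode (2, prod_encode (fml_code P, fml_code Q))"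
| "fml_code (Forall x P) = prod_encode (3, prod_encode (var_code x, fml_code P))"
| "fml_code (Box \<alpha> P) = prod_encode (4, prod_encode (prog_code \<alpha>, fml_code P))"
| "fml_code (Refines \<alpha> \<beta>) = prod_encode (5, prod_encode (prog_code \<alpha>, prog_code \<beta>))"
| "prog_code (Test P) = prod_encode (0, fml_code P)"
| "prog_code (Assign x \<theta>) = prod_encode (1, prod_encode (var_code x, trm_code \<theta>))"
| "prog_code (AssignAny x) = prod_encode (2, var_code x)"
| "prog_code (ODE xs P) = prod_encode (3, prod_encode (ode_code xs, fml_code P))"
| "prog_code (Choice \<alpha> \<beta>) = prod_encode (4, prod_encode (prog_code \<alpha>, prog_code \<beta>))"
| "prog_code (Seq \<alpha> \<beta>) = prod_encode (5, prod_encode (prog_code \<alpha>, prog_code \<beta>))"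
| "prog_code (Loop \<alpha>) = prod_encode (6, prog_code \<alpha>)"

lemma var_code_inject [simp]: "var_code x = var_code y \<longleftrightarrow> x = y"
proof (induction x arbitrary: y)
  case (Base n) show ?case by (cases y) auto
next
  case (Diff x) then show ?case by (cases y) auto
qed

lemma rat_code_inject [simp]: "rat_code c = rat_code d \<longleftrightarrow> c = d"
  by (auto simp: rat_code_def map_prod_def quotient_of_inject_eq inj_eq[OF inj_int_encode]
      split: prod.splits) (metis quotient_of_inject_eq)

lemma trm_code_inject [simp]: "trm_code \<theta> = trm_code \<eta> \<longleftrightarrow> \<theta> = \<eta>"
proof (induction \<theta> arbitrary: \<eta>)
  case (Var x) show ?case by (cases \<eta>) auto
next
  case (Const c) show ?case by (cases \<eta>) auto
next
  case (Plus \<theta>1 \<theta>2) then show ?case by (cases \<eta>) auto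
next
  case (Times \<theta>1 \<theta>2) then show ?case by (cases \<eta>) auto
qed

lemma ode_code_inject [simp]: "ode_code xs = ode_code ys \<longleftrightarrow> xs = ys"
proof -
  have "inj (\<lambda>(x, \<theta>). prod_encode (var_code x, trm_code \<theta>))"
    by (auto intro!: injI)
  then show ?thesis
    by (simp add: ode_code_def list_encode_eq inj_map_eq_map)
qed

lemma fml_prog_code_inject:
  "(\<forall>Q. fml_code P = fml_code Q \<longleftrightarrow> P = Q)" "(\<forall>\<beta>. prog_code \<alpha> = prog_code \<beta> \<longleftrightarrow> \<alpha> = \<beta>)"
proof (induction P and \<alpha>)
  case (Geq \<theta> \<eta>) show ?case by (rule allI, case_tac Q) auto
next
  case (Neg P) then show ?case by (auto, case_tac Q) auto
next
  case (Conj P P') then show ?case by (auto, case_tac Q) auto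
next
  case (Forall x P) then show ?case by (auto, case_tac Q) auto
next
  case (Box \<alpha> P) then show ?case by (auto, case_tac Q) auto
next
  case (Refines \<alpha> \<alpha>') then show ?case by (auto, case_tac Q) auto
next
  case (Test P) then show ?case by (auto, case_tac \<beta>) auto
next
  case (Assign x \<theta>) then show ?case by (auto, case_tac \<beta>) auto
next
  case (AssignAny x) then show ?case by (auto, case_tac \<beta>) auto
next
  case (ODE xs P) then show ?case by (auto, case_tac \<beta>) auto
next
  case (Choice \<alpha> \<alpha>') then show ?case by (auto, case_tac \<beta>) auto
next
  case (Seq \<alpha> \<alpha>') then show ?case by (auto, case_tac \<beta>) auto
next
  case (Loop \<alpha>) then show ?case by (auto, case_tac \<beta>) auto
qed

definition pair_code :: "prog_pair \<Rightarrow> nat" where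
  "pair_code D = prod_encode
     (prog_code (Seq (ctrl_a D) (plant_a D)), prog_code (Seq (ctrl_b D) (plant_b D)))"

lemma pair_code_inject:
  assumes "admissible D" and "admissible E"
  shows "pair_code D = pair_code E \<longleftrightarrow> D = E"
proof
  have len: "length (rhs_a D) = length (cvars D)" "length (rhs_b D) = length (cvars D)"
    "length (rhs_a E) = length (cvars E)" "length (rhs_b E) = length (cvars E)"
    using assms by (auto simp: admissible_def Let_def)
  assume "pair_code D = pair_code E"
  then have eqs: "ctrl_a D = ctrl_a E" "ctrl_b D = ctrl_b E" "dom_a D = dom_a E" "dom_b D = dom_b E"
    and a: "zip (cvars D) (rhs_a D) = zip (cvars E) (rhs_a E)"
    and b: "zip (cvars D) (rhs_b D) = zip (cvars E) (rhs_b E)"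
    by (simp_all add: pair_code_def plant_a_def plant_b_def fml_prog_code_inject)
  have "cvars D = cvars E" "rhs_a D = rhs_a E"
    using len arg_cong[OF a, of "map fst"] arg_cong[OF a, of "map snd"] by simp_all
  moreover have "rhs_b D = rhs_b E"
    using len arg_cong[OF b, of "map snd"] by simp
  ultimately show "D = E" using eqs by simp
qed simp

text \<open>The decision procedure has to terminate with the correct answer on all members of the class
  \<open>C\<close>; nothing is required of it on other inputs.\<close>

definition decidable_on :: "prog_pair set \<Rightarrow> (prog_pair \<Rightarrow> bool) \<Rightarrow> bool" where
  "decidable_on C P \<longleftrightarrow>
     (\<exists>f. \<forall>D\<in>C. reval f [pair_code D] (if P D then 1 else 0))"

end

theory Submission
  imports Defs "HOL-Computational_Algebra.Polynomial"
begin

text \<open>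
  Because of the clock, the first loop refines the second one iff the box formula is valid and every run
  of the first controller that ends in the first evolution domain is a run of the second controller.
  Indeed a run of the first plant sets the differential symbol of the clock to 1, so from a state where
  that symbol is 0 the second loop has to be unrolled; its last plant run yields the box formula. If no
  time passes, all its plant runs are instantaneous and idempotence collapses the controller runs into
  one. The second condition is a sentence of real arithmetic, so what is needed besides the given
  decision procedure is a recursive decision procedure for real arithmetic. Quantifiers are
  eliminated by Muchnik's method: a finite set of polynomials in \<open>x\<close> is closed under truncation,
  leading coefficients, derivatives and pseudo-remainders, after which the signs of its members of degree
  0 determine the sign diagram of the whole set on the real line. Inserting the polynomials by increasing
  degree, the sign of a new one at a root of an old one is that of their pseudo-remainder, and between
  two neighbouring points the new one is monotone, because its derivative has constant sign there.
\<close>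

section \<open>Computable functions\<close>

text \<open>The plants are never solved: everything about trajectories of positive duration enters
  through the given procedure for the box formula. The rest is a condition on loop-free controllers,
  and \<open>decidable_on\<close> asks for a genuine \<open>recf\<close> that decides it. This is
  what Muchnik's method is good for: it manipulates only lists of coefficient terms and signs and
  never represents an algebraic number, so each of its functions can be realised on codes by
  recursion on numbers. The delicate point of the reduction are the differential symbols. Evolution
  domains may mention them, and validity ranges also over states whose differential symbols
  contradict the differential equations. The condition on controllers is therefore restricted to
  final states in which these symbols already have the values prescribed by the first plant.
  Controllers ignore differential symbols, so their values can be exchanged along controller runs;
  this transfers matching runs from the restricted states to all others.\<close>

definition total_recursive :: "(nat \<Rightarrow> nat) \<Rightarrow> bool" where
  "total_recursive g \<longleftrightarrow> (\<exists>r. \<forall>n. reval r [n] (g n))"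

section \<open>Basic recursive functions and the inverse of the pairing function\<close>

lemma reval_Comp1: "reval g xs y \<Longrightarrow> reval f [y] z \<Longrightarrow> reval (Comp f [g]) xs z"
  by (rule reval.comp[of _ _ "[y]"]) auto

lemma reval_Comp2: "reval g xs y \<Longrightarrow> reval h xs y' \<Longrightarrow> reval f [y, y'] z \<Longrightarrow> reval (Comp f [g, h]) xs z"
  by (rule reval.comp[of _ _ "[y, y']"]) auto

lemma reval_Proj: "i < length xs \<Longrightarrow> xs ! i = y \<Longrightarrow> reval (Proj i) xs y"
  using reval.proj by blast

definition "recf_add = Prim (Proj 0) (Comp Succ [Proj 1])"

lemma reval_add: "reval recf_add [m, n] (m + n)"
  unfolding recf_add_def
proof (induction m)
  case 0 show ?case by (auto intro!: reval.prim_zero reval_Proj)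
next
  case (Suc m)
  have "reval (Comp Succ [Proj 1]) [m, m + n, n] (Suc (m + n))"
    by (rule reval_Comp1[OF _ reval.succ]) (auto intro: reval_Proj)
  then show ?case using reval.prim_Suc[OF Suc] by simp
qed

definition "recf_pred = Prim Zero (Proj 0)"

lemma reval_pred: "reval recf_pred [n] (n - 1)"
  unfolding recf_pred_def
proof (induction n)
  case 0 show ?case by (auto intro!: reval.intros)
next
  case (Suc m) then show ?case
    by (auto intro!: reval.prim_Suc[OF Suc] reval_Proj)
qed

text \<open>The recursion variable is the first argument, so the number to be subtracted comes
  first; \<open>recf_diag\<close>, \<open>recf_fst\<close> and \<open>recf_snd\<close> list their
  arguments in this order.\<close>

definition "recf_sub = Prim (Proj 0) (Comp recf_pred [Proj 1])"

lemma reval_sub: "reval recf_sub [n, m] (m - n)"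
  unfolding recf_sub_def
proof (induction n)
  case 0 show ?case by (auto intro!: reval.prim_zero reval_Proj)
next
  case (Suc n)
  have "reval (Comp recf_pred [Proj 1]) [n, m - n, m] (m - n - 1)"
    by (rule reval_Comp1[OF _ reval_pred]) (auto intro: reval_Proj)
  then show ?case
    using reval.prim_Suc[OF Suc] by simp
qed

definition "recf_mult = Prim Zero (Comp recf_add [Proj 1, Proj 2])"

lemma reval_mult: "reval recf_mult [n, m] (n * m)"
  unfolding recf_mult_def
proof (induction n)
  case 0 show ?case by (auto intro!: reval.prim_zero reval.zero)
next
  case (Suc n)
  have "reval (Comp recf_add [Proj 1, Proj 2]) [n, n * m, m] (n * m + m)"
    by (rule reval_Comp2[OF _ _ reval_add]) (auto intro: reval_Proj)
  then show ?case
    using reval.prim_Suc[OF Suc] by (simp add: add.commute)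
qed

definition "recf_triangle = Prim Zero (Comp recf_add [Comp Succ [Proj 0], Proj 1])"

lemma reval_triangle: "reval recf_triangle [n] (triangle n)"
  unfolding recf_triangle_def
proof (induction n)
  case 0 show ?case by (auto intro!: reval.prim_zero reval.zero)
next
  case (Suc n)
  have "reval (Comp recf_add [Comp Succ [Proj 0], Proj 1]) [n, triangle n] (Suc n + triangle n)"
    by (rule reval_Comp2[OF _ _ reval_add], rule reval_Comp1[OF _ reval.succ])
       (auto intro: reval_Proj)
  then show ?case
    using reval.prim_Suc[OF Suc] by (simp add: add.commute)
qed

definition "recf_pair = Comp recf_add [Comp recf_triangle [recf_add], Proj 0]"

lemma reval_pair: "reval recf_pair [m, n] (prod_encode (m, n))"
  unfolding recf_pair_def prod_encode_def
  by (auto intro!: reval_Comp2[OF _ _ reval_add] reval_Comp1[OF _ reval_triangle] reval_add reval_Proj)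

text \<open>As \<open>m \<le> k\<close>, the number \<open>z\<close> lies on the \<open>k\<close>-th
  diagonal of the Cantor pairing, so \<open>k\<close> is the least number with
  \<open>z < triangle (Suc k)\<close>. A search for that inequality therefore finds it.\<close>

lemma triangle_less_unique:
  assumes "z = triangle k + m" "m \<le> k"
  shows "z < triangle (Suc k)" and "\<And>i. i < k \<Longrightarrow> \<not> z < triangle (Suc i)"
proof -
  show "z < triangle (Suc k)" using assms by simp
  have "mono triangle" by (rule incseq_SucI) simp
  then show "\<not> z < triangle (Suc i)" if "i < k" for i
    using assms monoD[of triangle "Suc i" k] that by (simp del: triangle_Suc)
qed

text \<open>The searched value is \<open>Suc z - triangle (Suc w)\<close> in truncated subtraction,
  which is 0 exactly when \<open>z < triangle (Suc w)\<close>. Both components of a pair are then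
  obtained from its diagonal by subtraction.\<close>

definition "recf_diag = Mu (Comp recf_sub [Comp recf_triangle [Comp Succ [Proj 0]], Comp Succ [Proj 1]])"

lemma reval_diag: "reval recf_diag [prod_encode (m, n)] (m + n)"
proof -
  define z where "z = prod_encode (m, n)"
  have z: "z = triangle (m + n) + m" by (simp add: z_def prod_encode_def)
  have *: "reval (Comp recf_sub [Comp recf_triangle [Comp Succ [Proj 0]], Comp Succ [Proj 1]]) [w, z]
      (Suc z - triangle (Suc w))" for w
    by (rule reval_Comp2[OF _ _ reval_sub], rule reval_Comp1[OF _ reval_triangle])
       (auto intro!: reval_Comp1[OF _ reval.succ] reval_Proj)
  have 1: "Suc z - triangle (Suc (m + n)) = 0"
    using triangle_less_unique(1)[OF z] by simp
  have 2: "Suc z - triangle (Suc i) > 0" if "i < m + n" for i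
    using triangle_less_unique(2)[OF z _ that] by simp
  show ?thesis
    unfolding recf_diag_def z_def[symmetric]
    by (rule reval.mu) (use * 1 2 in metis)+
qed

definition "recf_fst = Comp recf_sub [Comp recf_triangle [recf_diag], Proj 0]"
definition "recf_snd = Comp recf_sub [recf_fst, recf_diag]"

lemma reval_fst: "reval recf_fst [n] (fst (prod_decode n))"
proof -
  obtain a b where n: "n = prod_encode (a, b)" by (metis prod_decode_inverse surj_pair)
  have "reval recf_fst [n] (n - triangle (a + b))"
    unfolding recf_fst_def n
    by (auto intro!: reval_Comp2[OF _ _ reval_sub] reval_Comp1[OF reval_diag reval_triangle] reval_Proj)
  then show ?thesis by (simp add: n) (simp add: prod_encode_def)
qed

lemma reval_snd: "reval recf_snd [n] (snd (prod_decode n))"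
proof -
  obtain a b where n: "n = prod_encode (a, b)" by (metis prod_decode_inverse surj_pair)
  have "reval recf_snd [n] (a + b - a)"
    unfolding recf_snd_def n
    by (rule reval_Comp2[OF _ reval_diag reval_sub]) (use reval_fst[of n] in \<open>simp add: n\<close>)
  then show ?thesis by (simp add: n)
qed

section \<open>Total recursive functions of one argument\<close>

lemma total_recursive_id: "total_recursive (\<lambda>x. x)"
  unfolding total_recursive_def by (rule exI[of _ "Proj 0"]) (auto intro: reval_Proj)

lemma total_recursive_compose:
  "total_recursive f \<Longrightarrow> total_recursive g \<Longrightarrow> total_recursive (\<lambda>x. f (g x))"
  unfolding total_recursive_def by (meson reval_Comp1)

lemma total_recursive_binop:
  assumes "\<And>m n. reval r [m, n] (h m n)" "total_recursive f" "total_recursive g"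
  shows "total_recursive (\<lambda>x. h (f x) (g x))"
  using assms unfolding total_recursive_def by (meson reval_Comp2)

lemma total_recursive_Suc: "total_recursive Suc"
  unfolding total_recursive_def by (rule exI[of _ "Succ"]) (auto intro: reval.succ)

lemma total_recursive_const: "total_recursive (\<lambda>x. c)"
proof (induction c)
  case 0 show ?case unfolding total_recursive_def by (rule exI[of _ Zero]) (auto intro: reval.zero)
next
  case (Suc c) show ?case by (rule total_recursive_compose[OF total_recursive_Suc Suc])
qed

lemmas total_recursive_pair = total_recursive_binop[OF reval_pair]

lemma total_recursive_fst: "total_recursive (\<lambda>x. fst (prod_decode x))"
  and total_recursive_snd: "total_recursive (\<lambda>x. snd (prod_decode x))"
  unfolding total_recursive_def using reval_fst reval_snd by blast+

text \<open>Only unary functions are tracked, so the step receives parameter, counter and previous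
  value as one nested pair; \<open>Prim\<close> supplies them in another order, and they are packed
  first.\<close>

lemma total_recursive_rec_nat:
  assumes a: "total_recursive a" and g: "total_recursive g" and n: "total_recursive n"
  shows "total_recursive (\<lambda>e. rec_nat (a e) (\<lambda>k r. g (prod_encode (e, prod_encode (k, r)))) (n e))"
proof -
  obtain ra rg rn where ra: "\<And>x. reval ra [x] (a x)" and rg: "\<And>x. reval rg [x] (g x)"
    and rn: "\<And>x. reval rn [x] (n x)"
    using assms unfolding total_recursive_def by metis
  define s where "s = Comp rg [Comp recf_pair [Proj 2, Comp recf_pair [Proj 0, Proj 1]]]"
  have s: "reval s [k, r, e] (g (prod_encode (e, prod_encode (k, r))))" for k r e
    unfolding s_def
    by (auto intro!: reval_Comp1[OF _ rg] reval_Comp2[OF _ _ reval_pair] reval_Proj)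
  have p: "reval (Prim ra s) [k, e] (rec_nat (a e) (\<lambda>k r. g (prod_encode (e, prod_encode (k, r)))) k)" for k e
  proof (induction k)
    case 0 show ?case by (auto intro!: reval.prim_zero ra)
  next
    case (Suc k) show ?case by (rule reval.prim_Suc[OF Suc]) (simp add: s)
  qed
  have "reval (Comp (Prim ra s) [rn, Proj 0]) [e] (rec_nat (a e) (\<lambda>k r. g (prod_encode (e, prod_encode (k, r)))) (n e))" for e
    by (rule reval_Comp2[OF rn _ p]) (auto intro: reval_Proj)
  then show ?thesis unfolding total_recursive_def by blast
qed

section \<open>Encoded types and computable functions between them\<close>

class enc =
  fixes enc :: "'a \<Rightarrow> nat"
  assumes enc_inject [simp]: "enc x = enc y \<longleftrightarrow> x = y"

instantiation nat :: enc begin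
definition "enc_nat (n :: nat) = n"
instance by standard (simp add: enc_nat_def)
end

instantiation bool :: enc begin
definition "enc_bool b = (if b then 1 else 0 :: nat)"
instance by standard (simp add: enc_bool_def)
end

instantiation prod :: (enc, enc) enc begin
definition "enc_prod p = prod_encode (enc (fst p), enc (snd p))"
instance by standard (auto simp: enc_prod_def prod_eq_iff)
end

instantiation list :: (enc) enc begin
definition "enc_list xs = list_encode (map enc xs)"
instance by standard (simp add: enc_list_def list_encode_eq inj_map_eq_map inj_def)
end

text \<open>Syntax keeps the Goedel numbers of the statement, so that the code of a pair of programs
  is the very input of the decision procedures.\<close>

instantiation var :: enc begin
definition "enc_var = var_code"
instance by standard (simp add: enc_var_def)
end

instantiation rat :: enc begin
definition "enc_rat = rat_code"
instance by standard (simp add: enc_rat_def)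
end

instantiation trm :: enc begin
definition "enc_trm = trm_code"
instance by standard (simp add: enc_trm_def)
end

instantiation fml :: enc begin
definition "enc_fml = fml_code"
instance by standard (simp add: enc_fml_def fml_prog_code_inject)
end

instantiation prog :: enc begin
definition "enc_prog = prog_code"
instance by standard (simp add: enc_prog_def fml_prog_code_inject)
end

lemma enc_Pair: "enc (a, b) = prod_encode (enc a, enc b)"
  by (simp add: enc_prod_def)

lemma enc_Nil: "enc [] = 0" and enc_Cons: "enc (x # xs) = Suc (prod_encode (enc x, enc xs))"
  by (simp_all add: enc_list_def)

text \<open>The realising function on codes is required to be total, so that it can be applied to
  intermediate values which are not codes, for instance in course-of-values recursions.\<close>

definition computable :: "('a::enc \<Rightarrow> 'b::enc) \<Rightarrow> bool" where
  "computable f \<longleftrightarrow> (\<exists>g. total_recursive g \<and> (\<forall>x. g (enc x) = enc (f x)))"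

text \<open>A syntax-directed calculus: repeated introduction follows the shape of a term down to
  its variables. A function under a binder is packed as a function of one pair of environment and
  arguments, which is why premises speak of \<open>fst p\<close> and \<open>snd p\<close>.\<close>

named_theorems computable_intros

lemma computableI: "total_recursive g \<Longrightarrow> (\<And>x. g (enc x) = enc (f x)) \<Longrightarrow> computable f"
  unfolding computable_def by blast

lemma computable_compose:
  "computable f \<Longrightarrow> computable g \<Longrightarrow> computable (\<lambda>x. f (g x))"
proof -
  assume "computable f" "computable g"
  then obtain f' g' where "total_recursive f'" "\<And>x. f' (enc x) = enc (f x)"
    "total_recursive g'" "\<And>x. g' (enc x) = enc (g x)"
    unfolding computable_def by blast
  then show ?thesis
    by (intro computableI[OF total_recursive_compose[of f' g']]) auto
qed

lemma computable_id [computable_intros]: "computable (\<lambda>x. x)"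
  by (rule computableI[OF total_recursive_id]) simp

lemma computable_const [computable_intros]: "computable (\<lambda>x. c)"
  by (rule computableI[OF total_recursive_const]) simp

lemma computable_Pair [computable_intros]:
  assumes "computable f" "computable g" shows "computable (\<lambda>x. (f x, g x))"
proof -
  obtain f' g' where "total_recursive f'" "\<And>x. f' (enc x) = enc (f x)"
    "total_recursive g'" "\<And>x. g' (enc x) = enc (g x)"
    using assms unfolding computable_def by blast
  then show ?thesis
    by (intro computableI[of "\<lambda>x. prod_encode (f' x, g' x)"] total_recursive_pair) (auto simp: enc_Pair)
qed

lemma computable_fst [computable_intros]: "computable f \<Longrightarrow> computable (\<lambda>x. fst (f x))"
  by (rule computable_compose[OF computableI[OF total_recursive_fst]]) (auto simp: enc_prod_def)

lemma computable_snd [computable_intros]: "computable f \<Longrightarrow> computable (\<lambda>x. snd (f x))"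
  by (rule computable_compose[OF computableI[OF total_recursive_snd]]) (auto simp: enc_prod_def)

lemma computable_case_prod [computable_intros]:
  assumes "computable (\<lambda>x. f x (fst (p x)) (snd (p x)))"
  shows "computable (\<lambda>x. case p x of (a, b) \<Rightarrow> f x a b)"
  using assms by (simp add: case_prod_beta)

text \<open>Applied with a defined constant as \<open>f\<close>, so that its body is analysed once,
  on the projections of a pair, whatever the actual arguments are.\<close>

lemma computable_compose2:
  assumes "computable (\<lambda>p. f (fst p) (snd p))" "computable a" "computable b"
  shows "computable (\<lambda>e. f (a e) (b e))"
  using computable_compose[OF assms(1) computable_Pair[OF assms(2,3)]] by simp

lemma computable_compose3:
  assumes "computable (\<lambda>p. f (fst p) (fst (snd p)) (snd (snd p)))"
    "computable a" "computable b" "computable c"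
  shows "computable (\<lambda>e. f (a e) (b e) (c e))"
  using computable_compose[OF assms(1) computable_Pair[OF assms(2) computable_Pair[OF assms(3,4)]]] by simp

lemma computable_Suc [computable_intros]: "computable f \<Longrightarrow> computable (\<lambda>x. Suc (f x))"
  by (rule computable_compose[OF computableI[OF total_recursive_Suc]]) (auto simp: enc_nat_def)

lemma computable_enc [computable_intros]: "computable f \<Longrightarrow> computable (\<lambda>x. enc (f x))"
  by (rule computable_compose[OF computableI[OF total_recursive_id]]) (auto simp: enc_nat_def)

lemma computable_nat_binop:
  fixes f g :: "'a::enc \<Rightarrow> nat"
  assumes "\<And>m n. reval r [m, n] (h m n)" "computable f" "computable g"
  shows "computable (\<lambda>x. h (f x) (g x))"
proof -
  obtain f' g' where "total_recursive f'" "\<And>x. f' (enc x) = enc (f x)"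
    "total_recursive g'" "\<And>x. g' (enc x) = enc (g x)"
    using assms(2,3) unfolding computable_def by blast
  then show ?thesis
    by (intro computableI[of "\<lambda>x. h (f' x) (g' x)"] total_recursive_binop[OF assms(1)])
       (auto simp: enc_nat_def)
qed

lemmas computable_add [computable_intros] = computable_nat_binop[OF reval_add]
lemmas computable_mult [computable_intros] = computable_nat_binop[OF reval_mult]
lemmas computable_prod_encode [computable_intros] = computable_nat_binop[OF reval_pair]

lemma computable_diff [computable_intros]:
  fixes f g :: "'a::enc \<Rightarrow> nat"
  shows "computable f \<Longrightarrow> computable g \<Longrightarrow> computable (\<lambda>x. f x - g x)"
  using computable_nat_binop[OF reval_sub] by fast

lemma computable_fst_decode [computable_intros]:
  "computable f \<Longrightarrow> computable (\<lambda>x. fst (prod_decode (f x)))"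
  by (rule computable_compose[OF computableI[OF total_recursive_fst]]) (auto simp: enc_nat_def)

lemma computable_snd_decode [computable_intros]:
  "computable f \<Longrightarrow> computable (\<lambda>x. snd (prod_decode (f x)))"
  by (rule computable_compose[OF computableI[OF total_recursive_snd]]) (auto simp: enc_nat_def)

lemma computable_rec_nat [computable_intros]:
  assumes "computable a" "computable n"
    and "computable (\<lambda>p. s (fst p) (fst (snd p)) (snd (snd p)))"
  shows "computable (\<lambda>e. rec_nat (a e) (s e) (n e))"
proof -
  obtain a' n' s' where a': "total_recursive a'" "\<And>x. a' (enc x) = enc (a x)"
    and n': "total_recursive n'" "\<And>x. n' (enc x) = enc (n x)"
    and s': "total_recursive s'" "\<And>p. s' (enc p) = enc (s (fst p) (fst (snd p)) (snd (snd p)))"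
    using assms unfolding computable_def by blast
  have "rec_nat (a' (enc e)) (\<lambda>k r. s' (prod_encode (enc e, prod_encode (k, r)))) k = enc (rec_nat (a e) (s e) k)" for e k
  proof (induction k)
    case 0 show ?case by (simp add: a')
  next
    case (Suc k) then show ?case
      using s'(2)[of "(e, k, rec_nat (a e) (s e) k)"] by (simp add: enc_Pair enc_nat_def)
  qed
  then show ?thesis
    by (intro computableI[OF total_recursive_rec_nat[OF a'(1) s'(1) n'(1)]]) (simp add: n' enc_nat_def)
qed

lemma computable_funpow [computable_intros]:
  fixes s :: "'e::enc \<Rightarrow> 'b::enc \<Rightarrow> 'b"
  assumes "computable n" "computable a" "computable (\<lambda>p. s (fst p) (snd p))"
  shows "computable (\<lambda>e. (s e ^^ n e) (a e))"
proof -
  have "computable (\<lambda>p. s (fst p) (snd (snd p)))" (is "computable ?s")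
    using computable_compose[OF assms(3), of "\<lambda>p. (fst p, snd (snd p))"]
    by (simp add: computable_intros)
  then have "computable (\<lambda>e. rec_nat (a e) (\<lambda>k. s e) (n e))"
    by (intro computable_rec_nat assms)
  moreover have "rec_nat (a e) (\<lambda>k. s e) k = (s e ^^ k) (a e)" for e k
    by (induction k) auto
  ultimately show ?thesis by simp
qed

lemma computable_case_nat [computable_intros]:
  assumes "computable n" "computable a" "computable (\<lambda>p. s (fst p) (snd p))"
  shows "computable (\<lambda>e. case n e of 0 \<Rightarrow> a e | Suc k \<Rightarrow> s e k)"
proof -
  have "computable (\<lambda>p. s (fst p) (fst (snd p)))" (is "computable ?s")
    using computable_compose[OF assms(3), of "\<lambda>p. (fst p, fst (snd p))"]
    by (simp add: computable_intros)
  then have "computable (\<lambda>e. rec_nat (a e) (\<lambda>k r. s e k) (n e))"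
    by (intro computable_rec_nat assms)
  moreover have "rec_nat (a e) (\<lambda>k r. s e k) k = (case k of 0 \<Rightarrow> a e | Suc k \<Rightarrow> s e k)" for e k
    by (cases k) auto
  ultimately show ?thesis by simp
qed

lemma computable_bool_iff: "computable b \<longleftrightarrow> computable (\<lambda>x. if b x then 1 else 0 :: nat)"
  by (simp add: computable_def enc_bool_def enc_nat_def)

lemma computable_If [computable_intros]:
  assumes "computable b" "computable f" "computable g"
  shows "computable (\<lambda>x. if b x then f x else g x)"
proof -
  have "computable (\<lambda>x. case (if b x then 1 else 0 :: nat) of 0 \<Rightarrow> g x | Suc k \<Rightarrow> f x)"
    using assms(1) computable_compose[OF assms(2) computable_fst[OF computable_id]]
    by (intro computable_case_nat assms) (simp_all add: computable_bool_iff)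
  then show ?thesis by (rule back_subst[of computable]) auto
qed

lemma computable_not [computable_intros]: "computable b \<Longrightarrow> computable (\<lambda>x. \<not> b x)"
proof -
  assume "computable b"
  then have "computable (\<lambda>x. if b x then False else True)"
    by (intro computable_intros)
  then show ?thesis by (rule back_subst[of computable]) auto
qed

lemma computable_conj [computable_intros]:
  assumes "computable b" "computable c" shows "computable (\<lambda>x. b x \<and> c x)"
proof -
  have "computable (\<lambda>x. if b x then c x else False)"
    by (intro computable_intros assms)
  then show ?thesis by (rule back_subst[of computable]) auto
qed

lemma computable_le [computable_intros]:
  fixes f g :: "'a::enc \<Rightarrow> nat"
  assumes "computable f" "computable g" shows "computable (\<lambda>x. f x \<le> g x)"
proof -
  have "computable (\<lambda>x. case f x - g x of 0 \<Rightarrow> True | Suc _ \<Rightarrow> False)"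
    by (intro computable_intros assms)
  then show ?thesis by (rule back_subst[of computable]) (auto simp: fun_eq_iff split: nat.split)
qed

lemma computable_less [computable_intros]:
  fixes f g :: "'a::enc \<Rightarrow> nat"
  assumes "computable f" "computable g" shows "computable (\<lambda>x. f x < g x)"
  using computable_le[OF computable_Suc[OF assms(1)] assms(2)] by (simp add: Suc_le_eq)

text \<open>Codes are compared instead of values; injectivity of \<open>enc\<close> makes this the
  same.\<close>

lemma computable_eq [computable_intros]:
  assumes "computable f" "computable g" shows "computable (\<lambda>x. f x = g x)"
proof -
  have "computable (\<lambda>x. enc (f x) \<le> enc (g x) \<and> enc (g x) \<le> enc (f x))"
    by (intro computable_intros assms)
  then show ?thesis by (rule back_subst[of computable]) (auto simp: fun_eq_iff dest: antisym)
qed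


subsection \<open>Lists\<close>

lemma computable_Cons [computable_intros]:
  assumes "computable f" "computable g" shows "computable (\<lambda>x. f x # g x)"
proof -
  obtain f' g' where "total_recursive f'" "\<And>x. f' (enc x) = enc (f x)"
    "total_recursive g'" "\<And>x. g' (enc x) = enc (g x)"
    using assms unfolding computable_def by blast
  then show ?thesis
    by (intro computableI[of "\<lambda>x. Suc (prod_encode (f' x, g' x))"] total_recursive_pair
        total_recursive_compose[OF total_recursive_Suc]) (auto simp: enc_Cons)
qed

text \<open>The empty list has code 0 and every other list a successor, so this is a case
  distinction on numbers. It is carried out with realisers on codes, because the predecessor of a
  code is just the pair of the codes of head and tail.\<close>

lemma computable_case_list [computable_intros]:
  assumes xs: "computable xs" and a: "computable a"
    and f: "computable (\<lambda>p. f (fst p) (fst (snd p)) (snd (snd p)))"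
  shows "computable (\<lambda>e. case xs e of [] \<Rightarrow> a e | y # ys \<Rightarrow> f e y ys)"
proof -
  obtain a' f' where a': "total_recursive a'" "\<And>x. a' (enc x) = enc (a x)"
    and f': "total_recursive f'" "\<And>p. f' (enc p) = enc (f (fst p) (fst (snd p)) (snd (snd p)))"
    using a f unfolding computable_def by blast
  obtain x' where x': "total_recursive x'" "\<And>x. x' (enc x) = enc (xs x)"
    using xs unfolding computable_def by blast
  have comp: "total_recursive g \<Longrightarrow> computable (g :: nat \<Rightarrow> nat)" for g
    by (rule computableI) (simp_all add: enc_nat_def)
  have "computable (\<lambda>n. case x' n of 0 \<Rightarrow> a' n | Suc k \<Rightarrow> f' (prod_encode (n, k)))"
    by (intro computable_intros computable_compose[OF comp[OF a'(1)]]
        computable_compose[OF comp[OF f'(1)]] computable_compose[OF comp[OF x'(1)]])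
  then obtain g where g: "total_recursive g"
    "\<And>n. g n = (case x' n of 0 \<Rightarrow> a' n | Suc k \<Rightarrow> f' (prod_encode (n, k)))"
    by (auto simp: computable_def enc_nat_def)
  show ?thesis
  proof (rule computableI[OF g(1)])
    fix e
    show "g (enc e) = enc (case xs e of [] \<Rightarrow> a e | y # ys \<Rightarrow> f e y ys)"
      using f'(2)[of "(e, _, _)"]
      by (cases "xs e") (auto simp: g(2) a' x' enc_Nil enc_Cons enc_Pair)
  qed
qed

text \<open>Bounds the number of iterations in \<open>computable_fold\<close> by the code itself,
  before the length is known to be computable.\<close>

lemma length_le_enc: "length xs \<le> enc xs"
proof (induction xs)
  case (Cons x xs)
  have "enc xs \<le> prod_encode (enc x, enc xs)" by (rule le_prod_encode_2)
  then show ?case using Cons by (simp add: enc_Cons)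
qed (simp add: enc_Nil)

lemma computable_fold [computable_intros]:
  assumes xs: "computable xs" and a: "computable a"
    and f: "computable (\<lambda>p. f (fst p) (fst (snd p)) (snd (snd p)))"
  shows "computable (\<lambda>e. fold (f e) (xs e) (a e))"
proof -
  \<comment> \<open>One step consumes one list element and idles on an empty remainder, so iterating
    too often does no harm.\<close>
  define st where "st e p = (case fst p of [] \<Rightarrow> ([], snd p) | y # ys \<Rightarrow> (ys, f e y (snd p)))" for e p
  have st: "st e ([], b) = ([], b)" "st e (y # ys, b) = (ys, f e y b)" for e y ys b
    by (simp_all add: st_def)
  have st_Nil: "(st e ^^ n) ([], b) = ([], b)" for e n b
    by (induction n) (auto simp: st)
  have "fold (f e) ys b = snd ((st e ^^ n) (ys, b))" if "length ys \<le> n" for e ys b n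
    using that
  proof (induction n arbitrary: ys b)
    case 0 then show ?case by simp
  next
    case (Suc n)
    then show ?case
      by (cases ys) (auto simp: st st_Nil funpow_Suc_right simp del: funpow.simps)
  qed
  then have eq: "fold (f e) (xs e) (a e) = snd ((st e ^^ enc (xs e)) (xs e, a e))" for e
    using length_le_enc by blast
  have "computable (\<lambda>p. f (fst (fst p)) (fst (snd p)) (snd (snd (fst p))))"
    using computable_compose[OF f, of "\<lambda>p. (fst (fst p), fst (snd p), snd (snd (fst p)))"]
    by (simp add: computable_intros)
  then show ?thesis
    unfolding eq st_def by (intro computable_intros assms)
qed

lemma computable_rev [computable_intros]: "computable xs \<Longrightarrow> computable (\<lambda>e. rev (xs e))"
proof -
  assume "computable xs"
  then have "computable (\<lambda>e. fold Cons (xs e) [])" by (intro computable_intros)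
  then show ?thesis by (simp add: fold_Cons_rev)
qed

lemma computable_foldr [computable_intros]:
  assumes "computable xs" "computable a"
    and "computable (\<lambda>p. f (fst p) (fst (snd p)) (snd (snd p)))"
  shows "computable (\<lambda>e. foldr (f e) (xs e) (a e))"
  unfolding foldr_conv_fold by (intro computable_fold computable_rev assms)

lemma computable_map [computable_intros]:
  assumes "computable xs" "computable (\<lambda>p. f (fst p) (snd p))"
  shows "computable (\<lambda>e. map (f e) (xs e))"
proof -
  have "computable (\<lambda>p. f (fst p) (fst (snd p)))"
    using computable_compose[OF assms(2), of "\<lambda>p. (fst p, fst (snd p))"]
    by (simp add: computable_intros)
  then have "computable (\<lambda>e. foldr (\<lambda>y acc. f e y # acc) (xs e) [])"
    by (intro computable_intros assms)
  moreover have "foldr (\<lambda>y acc. g y # acc) ys [] = map g ys" for g :: "'b \<Rightarrow> 'c" and ys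
    by (induction ys) auto
  ultimately show ?thesis by simp
qed

lemma computable_append [computable_intros]:
  assumes "computable xs" "computable ys" shows "computable (\<lambda>e. xs e @ ys e)"
proof -
  have "computable (\<lambda>e. foldr Cons (xs e) (ys e))" by (intro computable_intros assms)
  moreover have "foldr Cons as bs = as @ bs" for as bs :: "'b list" by (induction as) auto
  ultimately show ?thesis by simp
qed

lemma computable_concat [computable_intros]:
  assumes "computable xs" shows "computable (\<lambda>e. concat (xs e))"
  unfolding concat_conv_foldr by (intro computable_intros assms)

lemma computable_filter [computable_intros]:
  assumes "computable xs" "computable (\<lambda>p. b (fst p) (snd p))"
  shows "computable (\<lambda>e. filter (b e) (xs e))"
proof -
  have "computable (\<lambda>e. concat (map (\<lambda>y. if b e y then [y] else []) (xs e)))"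
    by (intro computable_intros assms)
  moreover have "concat (map (\<lambda>y. if c y then [y] else []) ys) = filter c ys" for c :: "'b \<Rightarrow> bool" and ys
    by (induction ys) auto
  ultimately show ?thesis by simp
qed

lemma computable_length [computable_intros]: "computable xs \<Longrightarrow> computable (\<lambda>e. length (xs e))"
proof -
  assume "computable xs"
  then have "computable (\<lambda>e. foldr (\<lambda>_. Suc) (xs e) 0)" by (intro computable_intros)
  moreover have "foldr (\<lambda>_. Suc) ys 0 = length ys" for ys :: "'b list" by (induction ys) auto
  ultimately show ?thesis by simp
qed

lemma computable_Bex [computable_intros]:
  assumes "computable xs" "computable (\<lambda>p. b (fst p) (snd p))"
  shows "computable (\<lambda>e. \<exists>y\<in>set (xs e). b e y)"
proof -
  have "computable (\<lambda>e. filter (b e) (xs e) \<noteq> [])"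
    by (intro computable_intros assms)
  then show ?thesis by (simp add: filter_empty_conv)
qed

lemma computable_member [computable_intros]:
  assumes "computable f" "computable xs" shows "computable (\<lambda>e. f e \<in> set (xs e))"
proof -
  have "computable (\<lambda>p. f (fst p))" by (rule computable_compose[OF assms(1) computable_fst[OF computable_id]])
  then have "computable (\<lambda>e. \<exists>y\<in>set (xs e). f e = y)" by (intro computable_intros assms)
  then show ?thesis by simp
qed

lemma computable_upt [computable_intros]:
  assumes "computable m" "computable n" shows "computable (\<lambda>e. [m e..<n e])"
proof -
  have "computable (\<lambda>p. m (fst p))" by (rule computable_compose[OF assms(1) computable_fst[OF computable_id]])
  then have "computable (\<lambda>e. rec_nat [] (\<lambda>k l. if m e \<le> k then l @ [k] else l) (n e))"
    by (intro computable_intros assms)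
  moreover have "rec_nat [] (\<lambda>k l. if i \<le> k then l @ [k] else l) k = [i..<k]" for i k
    by (induction k) auto
  ultimately show ?thesis by simp
qed

text \<open>Total indexing; with the default \<open>Const 0\<close> it gives the coefficients of a
  polynomial beyond the end of its list.\<close>

definition nth_or :: "'a \<Rightarrow> 'a list \<Rightarrow> nat \<Rightarrow> 'a" where
  "nth_or d xs i = (if i < length xs then xs ! i else d)"

lemma computable_nth_or [computable_intros]:
  assumes "computable d" "computable xs" "computable i"
  shows "computable (\<lambda>e. nth_or (d e) (xs e) (i e))"
proof -
  have eq: "nth_or d xs i = (case (tl ^^ i) xs of [] \<Rightarrow> d | y # _ \<Rightarrow> y)" for d :: 'b and xs i
  proof (induction i arbitrary: xs)
    case 0 show ?case by (cases xs) (auto simp: nth_or_def)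
  next
    case (Suc i)
    show ?case
      using Suc[of "tl xs"] by (cases xs) (auto simp: nth_or_def funpow_Suc_right simp del: funpow.simps)
  qed
  have tl: "tl = (\<lambda>l :: 'b list. case l of [] \<Rightarrow> [] | _ # l' \<Rightarrow> l')"
    by (auto simp: fun_eq_iff split: list.split)
  show ?thesis
    unfolding eq tl by (intro computable_intros assms)
qed


subsection \<open>Recursion on the codes of trees\<close>

text \<open>Course-of-values recursion; the table holds the earlier values in descending order, and
  subtrees have smaller codes unless the tag is 0.\<close>

lemma computable_code_recursion:
  fixes S :: "'e::enc \<Rightarrow> nat \<Rightarrow> nat \<Rightarrow> nat \<Rightarrow> nat \<Rightarrow> nat \<Rightarrow> nat"
  assumes S: "computable (\<lambda>(e, tag, body, r, r1, r2). S e tag body r r1 r2)"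
  obtains F where "computable (\<lambda>(e, n). F e n)"
    and "\<And>e body. \<exists>r r1 r2. F e (prod_encode (0, body)) = S e 0 body r r1 r2"
    and "\<And>e tag body. tag > 0 \<Longrightarrow> F e (prod_encode (tag, body)) =
       S e tag body (F e body) (F e (fst (prod_decode body))) (F e (snd (prod_decode body)))"
proof -
  define look where "look T n i = (if i < n then nth_or 0 T (n - Suc i) else 0)" for T :: "nat list" and n i
  define step where "step e n T =
    (let body = snd (prod_decode n) in
     S e (fst (prod_decode n)) body (look T n body)
       (look T n (fst (prod_decode body))) (look T n (snd (prod_decode body))))" for e n T
  define T where "T e n = rec_nat [] (\<lambda>n T. step e n T # T) n" for e n
  define F where "F e n = step e n (T e n)" for e n
  have len: "length (T e n) = n" for e n
    by (induction n) (auto simp: T_def)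
  have T_nth: "T e n ! (n - Suc i) = F e i" if "i < n" for e n i
    using that
  proof (induction n)
    case (Suc n)
    have T_Suc: "T e (Suc n) = F e n # T e n" by (simp add: T_def F_def)
    show ?case
    proof (cases "i = n")
      case False
      then have "n - i = Suc (n - Suc i)" using Suc.prems by simp
      then show ?thesis using Suc False by (simp add: T_Suc)
    qed (simp add: T_Suc)
  qed simp
  have look: "look (T e n) n i = (if i < n then F e i else 0)" for e n i
    by (simp add: look_def nth_or_def len T_nth)
  \<comment> \<open>\<open>triangle body\<close> already dominates \<open>body\<close>; the summand
    \<open>tag\<close> makes the inequality strict.\<close>
  have less: "body < prod_encode (tag, body)" if "tag > 0" for tag body
  proof -
    have "body \<le> triangle body" by (induction body) auto
    also have "triangle body \<le> triangle (tag + body)"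
      by (rule monoD[of triangle]) (auto intro: incseq_SucI)
    finally show ?thesis using that by (simp add: prod_encode_def)
  qed
  have le: "fst (prod_decode body) \<le> body" "snd (prod_decode body) \<le> body" for body
    by (metis le_prod_encode_1 le_prod_encode_2 prod.collapse prod_decode_inverse)+
  have S': "computable (\<lambda>x. S (a x) (b x) (c x) (d x) (f x) (g x))"
    if "computable a" "computable b" "computable c" "computable d" "computable f" "computable g"
    for a b c d f and g :: "'x::enc \<Rightarrow> nat"
    using computable_compose[OF S, of "\<lambda>x. (a x, b x, c x, d x, f x, g x)"] that
    by (simp add: computable_intros)
  have cT: "computable (\<lambda>p. T (fst p) (snd p))"
    unfolding T_def step_def look_def Let_def by (intro computable_intros S')
  show thesis
  proof (rule that[of F])
    show "computable (\<lambda>(e, n). F e n)"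
      unfolding F_def step_def look_def Let_def by (intro computable_intros S' cT)
    \<comment> \<open>For tag 0 the body need not be smaller than the code, so the looked-up values
      stay unspecified. \<open>Var\<close>, \<open>Geq\<close> and \<open>Test\<close>, which have
      tag 0, contain no subtree of their own type.\<close>
    show "\<exists>r r1 r2. F e (prod_encode (0, body)) = S e 0 body r r1 r2" for e body
      by (auto simp: F_def step_def)
    show "F e (prod_encode (tag, body)) =
       S e tag body (F e body) (F e (fst (prod_decode body))) (F e (snd (prod_decode body)))"
      if "tag > 0" for e tag body
      using less[OF that, of body] le[of body]
      by (auto simp: F_def step_def look Let_def)
  qed
qed

lemma computable_realizer:
  assumes "computable f"
  obtains g :: "nat \<Rightarrow> nat" where "computable g" and "\<And>x. g (enc x) = enc (f x)"
proof -
  obtain g where g: "total_recursive g" "\<And>x. g (enc x) = enc (f x)"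
    using assms unfolding computable_def by blast
  have "computable g" by (rule computableI[OF g(1)]) (simp add: enc_nat_def)
  then show thesis using that g(2) by blast
qed

lemma computable_of_codes:
  fixes F :: "'e::enc \<Rightarrow> nat \<Rightarrow> nat"
  assumes "computable (\<lambda>(e, n). F e n)" and "\<And>e t. F e (enc (t :: 't::enc)) = enc (f e t)"
  shows "computable (\<lambda>(e, t). f e t)"
proof -
  have "computable (\<lambda>p. (fst p, enc (snd p :: 't)))" by (intro computable_intros)
  from computable_compose[OF assms(1) this] have "computable (\<lambda>p. enc (f (fst p) (snd p :: 't)))"
    by (simp add: assms(2))
  then show ?thesis by (simp add: computable_def enc_nat_def case_prod_beta)
qed


section \<open>Quantifier elimination for real arithmetic\<close>

subsection \<open>Polynomials in one variable with coefficient terms\<close>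

text \<open>Coefficients come lowest first, and the last one may vanish in a state, so
  \<open>length p - 1\<close> only bounds the degree.\<close>

definition pval :: "state \<Rightarrow> trm list \<Rightarrow> real poly" where
  "pval \<nu> p = Poly (map (\<lambda>c. tval c \<nu>) p)"

abbreviation cf :: "trm list \<Rightarrow> nat \<Rightarrow> trm" where
  "cf \<equiv> nth_or (Const 0)"

definition lc :: "trm list \<Rightarrow> trm" where
  "lc p = cf p (length p - 1)"

text \<open>The sum of the lengths stands in for their maximum; the surplus coefficients evaluate to
  0, and vanishing leading coefficients are allowed anyway.\<close>

definition padd :: "trm list \<Rightarrow> trm list \<Rightarrow> trm list" where
  "padd p q = map (\<lambda>i. Plus (cf p i) (cf q i)) [0..<length p + length q]"

definition pmult :: "trm list \<Rightarrow> trm list \<Rightarrow> trm list" where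
  "pmult p q = foldr (\<lambda>c acc. padd (map (Times c) q) (Const 0 # acc)) p []"

primrec topoly :: "var \<Rightarrow> trm \<Rightarrow> trm list" where
  "topoly x (Var y) = (if y = x then [Const 0, Const 1] else [Var y])"
| "topoly x (Const c) = [Const c]"
| "topoly x (Plus \<theta> \<eta>) = padd (topoly x \<theta>) (topoly x \<eta>)"
| "topoly x (Times \<theta> \<eta>) = pmult (topoly x \<theta>) (topoly x \<eta>)"

definition deriv :: "trm list \<Rightarrow> trm list" where
  "deriv p = map (\<lambda>i. Times (Const (of_nat (Suc i))) (cf p (Suc i))) [0..<length p - 1]"

text \<open>The multiplier is the square of the leading coefficient of the divisor, so that pseudo-remainders
  keep signs at the roots of the divisor.\<close>

definition prem_step :: "trm list \<Rightarrow> trm list \<Rightarrow> trm list" where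
  "prem_step p q = map (\<lambda>i. Plus (Times (Times (lc p) (lc p)) (cf q i))
      (Times (Times (Const (- 1)) (Times (lc p) (lc q)))
        (if i < length q - length p then Const 0 else cf p (i - (length q - length p)))))
      [0..<length q - 1]"

definition prem :: "trm list \<Rightarrow> trm list \<Rightarrow> trm list" where
  "prem p q = ((\<lambda>r. if length r < length p then r else prem_step p r) ^^ length q) q"

lemma coeff_pval: "coeff (pval \<nu> p) i = tval (cf p i) \<nu>"
  by (simp add: pval_def nth_default_def nth_or_def)

lemma cf_map_upt: "cf (map f [0..<n]) i = (if i < n then f i else Const 0)"
  by (simp add: nth_or_def)

lemma cf_beyond: "length p \<le> i \<Longrightarrow> cf p i = Const 0"
  by (simp add: nth_or_def)

lemma pval_Nil [simp]: "pval \<nu> [] = 0"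
  and pval_Cons [simp]: "pval \<nu> (c # p) = pCons (tval c \<nu>) (pval \<nu> p)"
  by (simp_all add: pval_def)

lemma pval_padd [simp]: "pval \<nu> (padd p q) = pval \<nu> p + pval \<nu> q"
  by (rule poly_eqI) (simp add: coeff_pval padd_def cf_map_upt cf_beyond)

lemma pval_map_Times: "pval \<nu> (map (Times c) q) = smult (tval c \<nu>) (pval \<nu> q)"
  by (induction q) auto

lemma pval_pmult [simp]: "pval \<nu> (pmult p q) = pval \<nu> p * pval \<nu> q"
  unfolding pmult_def by (induction p) (auto simp: pval_map_Times)

lemma poly_topoly: "poly (pval \<nu> (topoly x \<theta>)) a = tval \<theta> (\<nu>(x := a))"
  by (induction \<theta>) auto

lemma pval_deriv: "pval \<nu> (deriv p) = pderiv (pval \<nu> p)"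
  by (rule poly_eqI) (auto simp: coeff_pval coeff_pderiv deriv_def cf_map_upt cf_beyond of_rat_add)

text \<open>The coefficients at position \<open>length q - 1\<close> cancel formally, whether or not
  they vanish in the state; this is why \<open>prem_step\<close> may drop the last entry.\<close>

lemma pval_prem_step:
  assumes "1 \<le> length p" "length p \<le> length q"
  shows "pval \<nu> (prem_step p q) = smult ((tval (lc p) \<nu>)\<^sup>2) (pval \<nu> q)
    - smult (tval (lc p) \<nu> * tval (lc q) \<nu>) (monom 1 (length q - length p) * pval \<nu> p)"
proof (rule poly_eqI)
  fix i
  consider "i < length q - 1" | "i = length q - 1" | "length q \<le> i" using assms by linarith
  then show "coeff (pval \<nu> (prem_step p q)) i = coeff (smult ((tval (lc p) \<nu>)\<^sup>2) (pval \<nu> q)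
    - smult (tval (lc p) \<nu> * tval (lc q) \<nu>) (monom 1 (length q - length p) * pval \<nu> p)) i"
  proof cases
    case 1 then show ?thesis
      by (auto simp: coeff_pval prem_step_def cf_map_upt coeff_monom_mult power2_eq_square of_rat_minus)
  next
    case 2
    then have "\<not> i < length q - length p" "i - (length q - length p) = length p - 1"
      using assms by linarith+
    with 2 show ?thesis
      by (simp add: coeff_pval prem_step_def cf_map_upt coeff_monom_mult power2_eq_square)
        (simp add: lc_def)
  next
    case 3 then show ?thesis using assms
      by (simp add: coeff_pval prem_step_def cf_map_upt coeff_monom_mult cf_beyond)
  qed
qed

text \<open>Signs are coded by 0 (zero), 1 (positive) and 2 (negative).\<close>

definition sg :: "real \<Rightarrow> nat" where
  "sg a = (if a = 0 then 0 else if a > 0 then 1 else 2)"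

definition opp :: "nat \<Rightarrow> nat \<Rightarrow> bool" where
  "opp s t \<longleftrightarrow> s \<noteq> 0 \<and> t \<noteq> 0 \<and> s \<noteq> t"

definition neg_sign :: "nat \<Rightarrow> nat" where
  "neg_sign s = (if s = 0 then 0 else 3 - s)"

lemma sg_eq_0 [simp]: "sg a = 0 \<longleftrightarrow> a = 0" "0 = sg a \<longleftrightarrow> a = 0" "0 < sg a \<longleftrightarrow> a \<noteq> 0"
  by (auto simp: sg_def)

lemma sg_eq_1: "sg a = 1 \<longleftrightarrow> a > 0" and sg_eq_2: "sg a = 2 \<longleftrightarrow> a < 0"
  by (auto simp: sg_def)

lemma sg_minus: "sg (- a) = neg_sign (sg a)"
  by (auto simp: sg_def neg_sign_def)

lemma sg_square_mult: "a \<noteq> 0 \<Longrightarrow> sg (a\<^sup>2 * b) = sg b"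
  by (auto simp: sg_def zero_less_mult_iff)

lemma length_prem_step: "length (prem_step p q) = length q - 1"
  by (simp add: prem_step_def)

lemma length_prem:
  assumes "1 \<le> length p"
  shows "length (prem p q) < length p"
proof -
  have "length (((\<lambda>r. if length r < length p then r else prem_step p r) ^^ n) q) < length p \<or>
    length (((\<lambda>r. if length r < length p then r else prem_step p r) ^^ n) q) + n \<le> length q" for n
    by (induction n) (use assms in \<open>auto simp: length_prem_step\<close>)
  from this[of "length q"] show ?thesis unfolding prem_def using assms by force
qed

lemma sg_prem:
  assumes "1 \<le> length p" "tval (lc p) \<nu> \<noteq> 0" "poly (pval \<nu> p) a = 0"
  shows "sg (poly (pval \<nu> (prem p q)) a) = sg (poly (pval \<nu> q) a)"
proof -
  have "sg (poly (pval \<nu> (((\<lambda>r. if length r < length p then r else prem_step p r) ^^ n) q)) a)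
    = sg (poly (pval \<nu> q) a)" for n
    by (induction n) (use assms in \<open>auto simp: pval_prem_step sg_square_mult\<close>)
  then show ?thesis by (simp add: prem_def)
qed


subsection \<open>Closing a set of polynomials under the operations of Muchnik's method\<close>

text \<open>Pseudo-remainders are taken between polynomials of equal length too, because a point may
  be the root of a polynomial of the same length that was inserted before.\<close>

definition poly_ops :: "trm list list \<Rightarrow> trm list list" where
  "poly_ops S = S @ concat (map (\<lambda>p. if 2 \<le> length p
     then [butlast p, [lc p], deriv p] @ map (prem p) (filter (\<lambda>q. length p \<le> length q) S)
     else []) S)"

text \<open>The total length of \<open>S\<close> serves as a bound on the lengths of its
  members.\<close>

definition poly_closure :: "trm list list \<Rightarrow> trm list list" where
  "poly_closure S = (poly_ops ^^ Suc (length (concat S))) S"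

definition succs :: "trm list set \<Rightarrow> trm list \<Rightarrow> trm list set" where
  "succs M p = {butlast p, [lc p], deriv p} \<union> prem p ` {q \<in> M. length p \<le> length q}"

lemma set_poly_ops: "set (poly_ops S) = set S \<union> (\<Union>p\<in>{p \<in> set S. 2 \<le> length p}. succs (set S) p)"
  by (auto simp: poly_ops_def succs_def split: if_splits)

lemma length_succs: "r \<in> succs M p \<Longrightarrow> 2 \<le> length p \<Longrightarrow> length r < length p"
  by (auto simp: succs_def deriv_def intro: length_prem)

lemma succs_mono: "r \<in> succs M p \<Longrightarrow> (\<And>q. q \<in> M \<Longrightarrow> length p \<le> length q \<Longrightarrow> q \<in> M') \<Longrightarrow> r \<in> succs M' p"
  by (auto simp: succs_def)

lemma subset_poly_closure: "set S \<subseteq> set (poly_closure S)"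
proof -
  have "set S \<subseteq> set ((poly_ops ^^ n) S)" for n
    by (induction n) (auto simp: set_poly_ops)
  then show ?thesis unfolding poly_closure_def .
qed

text \<open>After \<open>k\<close> rounds the set is closed as far as results longer than \<open>N - k\<close> are concerned,
  because all operations decrease the length.\<close>

lemma poly_closure_closed:
  assumes "p \<in> set (poly_closure S)" "2 \<le> length p"
  shows "succs (set (poly_closure S)) p \<subseteq> set (poly_closure S)"
proof -
  define N where "N = length (concat S)"
  define M where "M k = set ((poly_ops ^^ k) S)" for k
  have M_Suc: "M (Suc k) = M k \<union> (\<Union>p\<in>{p \<in> M k. 2 \<le> length p}. succs (M k) p)" for k
    by (simp add: M_def set_poly_ops)
  have "length q \<le> N" if "q \<in> set S" for q
    using that unfolding N_def by (induction S) auto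
  then have le: "q \<in> M k \<Longrightarrow> length q \<le> N" for q k
  proof (induction k arbitrary: q)
    case (Suc k)
    then show ?case using length_succs unfolding M_Suc by fastforce
  qed (simp add: M_def)
  have *: "r \<in> M k" if "p \<in> M k" "2 \<le> length p" "r \<in> succs (M k) p" "N < length r + k" for p r k
    using that
  proof (induction k arbitrary: p r)
    case 0
    then show ?case using le[OF 0(1)] length_succs[OF 0(3,2)] by simp
  next
    case (Suc k)
    have "length r < length p" using Suc.prems length_succs by blast
    \<comment> \<open>A polynomial at least as long as \<open>p\<close> is longer than
      \<open>r\<close>, so the induction hypothesis applies to it one round earlier and shows that
      it cannot be new.\<close>
    have down: "q \<in> M k" if "q \<in> M (Suc k)" "length p \<le> length q" for q
    proof (rule ccontr)
      assume "q \<notin> M k"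
      with that obtain p' where "p' \<in> M k" "2 \<le> length p'" "q \<in> succs (M k) p'" unfolding M_Suc by auto
      then show False
        using Suc.IH[of p' q] Suc.prems \<open>length r < length p\<close> that \<open>q \<notin> M k\<close> by simp
    qed
    have "r \<in> succs (M k) p" using Suc.prems(3) down by (rule succs_mono)
    then show ?case using down[OF Suc.prems(1)] Suc.prems(2) unfolding M_Suc by auto
  qed
  \<comment> \<open>After \<open>Suc N\<close> rounds the length condition holds for every result,
    even for the empty list.\<close>
  show ?thesis
    using *[of p "Suc N"] assms by (auto simp: M_def poly_closure_def N_def)
qed


subsection \<open>Sign diagrams\<close>

text \<open>A column assigns signs to polynomials. A diagram \<open>(v, [(p\<^sub>1, v\<^sub>1), \<dots>, (p\<^sub>k, v\<^sub>k)])\<close> consists of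
  the columns of the points \<open>p\<^sub>i\<close> and of the open intervals \<open>v, v\<^sub>1, \<dots>, v\<^sub>k\<close> between them.\<close>

type_synonym col = "(trm list \<times> nat) list"
type_synonym diagram = "col \<times> (col \<times> col) list"

text \<open>The default 0 is the right sign for the empty coefficient list, which is not a key of
  the columns constructed here.\<close>

definition look :: "col \<Rightarrow> trm list \<Rightarrow> nat" where
  "look v p = (case filter (\<lambda>e. fst e = p) v of [] \<Rightarrow> 0 | e # _ \<Rightarrow> snd e)"

text \<open>The sign of a new polynomial at a point: its pseudo-remainder by a polynomial that vanishes at
  the point is already in the column.\<close>

definition point_sign :: "trm list \<Rightarrow> col \<Rightarrow> nat" where
  "point_sign p v =
    (case filter (\<lambda>e. snd e = 0 \<and> 2 \<le> length (fst e) \<and> look v [lc (fst e)] \<noteq> 0) v of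
       [] \<Rightarrow> 0 | e # _ \<Rightarrow> look v (prem (fst e) p))"

text \<open>\<open>s\<close> and \<open>t\<close> are the signs of \<open>p\<close> at the left and
  right end of the cell, possibly at infinity. By monotonicity opposite signs give exactly one root
  inside; otherwise \<open>p\<close> has inside the sign of an end where it does not vanish.\<close>

definition split_cell :: "trm list \<Rightarrow> nat \<Rightarrow> nat \<Rightarrow> col \<Rightarrow> diagram" where
  "split_cell p s t v =
    (if opp s t then ((p, s) # v, [((p, 0) # v, (p, t) # v)])
     else ((p, if s = 0 then t else s) # v, []))"

text \<open>The fold runs from the right and hands on, as its first component, the sign at the right
  end of the next cell to be split; it starts with the sign \<open>t\<close> at plus
  infinity.\<close>

definition insert_right :: "trm list \<Rightarrow> nat \<Rightarrow> (col \<times> col) list \<Rightarrow> nat \<times> (col \<times> col) list" where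
  "insert_right p t ps = foldr (\<lambda>c acc. (point_sign p (fst c),
      let D = split_cell p (point_sign p (fst c)) (fst acc) (snd c)
      in ((p, point_sign p (fst c)) # fst c, fst D) # snd D @ snd acc)) ps (t, [])"

text \<open>Constants have the same sign everywhere, so the sign of the leading coefficient can be
  read off the leftmost column. If it is 0, \<open>p\<close> agrees with \<open>butlast p\<close>.
  Otherwise it is the sign at plus infinity, and also at minus infinity if the length is odd, that
  is, the degree even.\<close>

definition add_poly :: "trm list \<Rightarrow> diagram \<Rightarrow> diagram" where
  "add_poly p D =
    (let t = look (fst D) [lc p] in
     if t = 0 then
       ((p, look (fst D) (butlast p)) # fst D,
        map (\<lambda>c. ((p, look (fst c) (butlast p)) # fst c, (p, look (snd c) (butlast p)) # snd c)) (snd D))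
     else
       let R = insert_right p t (snd D);
           E = split_cell p (if odd (length p) then t else neg_sign t) (fst R) (fst D)
       in (fst E, snd E @ snd R))"

definition sign_diagram :: "trm list list \<Rightarrow> col \<Rightarrow> diagram" where
  "sign_diagram M v = fold add_poly
     (concat (map (\<lambda>l. filter (\<lambda>p. length p = l) M) [2..<Suc (Suc (length (concat M)))])) (v, [])"

definition columns :: "diagram \<Rightarrow> col list" where
  "columns D = fst D # concat (map (\<lambda>c. [fst c, snd c]) (snd D))"

definition col_ok :: "state \<Rightarrow> real \<Rightarrow> col \<Rightarrow> bool" where
  "col_ok \<nu> a v \<longleftrightarrow> (\<forall>e\<in>set v. snd e = sg (poly (pval \<nu> (fst e)) a))"

text \<open>Every point carries a witness that it is a root: a vanishing polynomial whose leading
  coefficient does not vanish. \<open>point_sign\<close> divides by such a polynomial.\<close>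

definition point_ok :: "state \<Rightarrow> real \<Rightarrow> col \<Rightarrow> bool" where
  "point_ok \<nu> a v \<longleftrightarrow> col_ok \<nu> a v \<and>
     (\<exists>e\<in>set v. snd e = 0 \<and> 2 \<le> length (fst e) \<and> look v [lc (fst e)] \<noteq> 0)"

text \<open>\<open>A\<close> is the part of the line still to be described: at first the whole line,
  later the open ray to the right of the last point.\<close>

fun diagram_ok :: "state \<Rightarrow> (real \<Rightarrow> bool) \<Rightarrow> col \<Rightarrow> (col \<times> col) list \<Rightarrow> bool" where
  "diagram_ok \<nu> A v [] \<longleftrightarrow> (\<forall>a. A a \<longrightarrow> col_ok \<nu> a v)"
| "diagram_ok \<nu> A v ((p, w) # ps) \<longleftrightarrow>
     (\<exists>x. A x \<and> (\<forall>a<x. A a \<longrightarrow> col_ok \<nu> a v) \<and> point_ok \<nu> x p \<and> diagram_ok \<nu> (\<lambda>a. x < a) w ps)"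

definition right_ray :: "(real \<Rightarrow> bool) \<Rightarrow> bool" where
  "right_ray A \<longleftrightarrow> A = (\<lambda>_. True) \<or> (\<exists>x. A = (\<lambda>a. x < a))"

lemma right_rayD:
  assumes "right_ray A"
  shows "\<exists>a. A a" "A a \<Longrightarrow> a < b \<Longrightarrow> A b" "A a \<Longrightarrow> \<exists>b<a. A b"
  using assms dense by (auto simp: right_ray_def intro: gt_ex lt_ex)

lemma right_ray_greater [simp]: "right_ray (\<lambda>a. x < a)" and right_ray_True [simp]: "right_ray (\<lambda>_. True)"
  by (auto simp: right_ray_def)

lemma look_Cons: "look ((q, s) # v) p = (if q = p then s else look v p)"
  by (simp add: look_def)

lemma look_eq_sg:
  assumes "col_ok \<nu> a v" "p \<in> fst ` set v \<or> p = []"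
  shows "look v p = sg (poly (pval \<nu> p) a)"
proof (cases "filter (\<lambda>e. fst e = p) v")
  case Nil
  then have "p \<notin> fst ` set v" by (auto simp: filter_empty_conv)
  then show ?thesis using assms Nil by (simp add: look_def)
next
  case (Cons e es)
  then have "e \<in> set v" "fst e = p" by (auto simp: filter_eq_Cons_iff)
  then show ?thesis using assms Cons by (auto simp: look_def col_ok_def)
qed

lemma columns_cover:
  "diagram_ok \<nu> A v ps \<Longrightarrow> A a \<Longrightarrow> \<exists>c\<in>set (columns (v, ps)). col_ok \<nu> a c"
proof (induction ps arbitrary: A v)
  case (Cons c ps)
  obtain p w where c: "c = (p, w)" by fastforce
  with Cons.prems(1) obtain x where x: "A x" "\<forall>a<x. A a \<longrightarrow> col_ok \<nu> a v" "point_ok \<nu> x p"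
    "diagram_ok \<nu> (\<lambda>a. x < a) w ps" by auto
  consider "a < x" | "a = x" | "x < a" by linarith
  then show ?case
  proof cases
    case 3 then show ?thesis using Cons.IH[OF x(4)] by (auto simp: columns_def c)
  qed (use x Cons.prems in \<open>auto simp: columns_def c point_ok_def\<close>)
qed (auto simp: columns_def)

text \<open>Every cell contains a point because a right ray has no least element. Together with
  \<open>columns_cover\<close> this replaces a quantifier over the reals by one over finitely many
  columns.\<close>

lemma columns_realized:
  "diagram_ok \<nu> A v ps \<Longrightarrow> right_ray A \<Longrightarrow> c \<in> set (columns (v, ps)) \<Longrightarrow> \<exists>a. col_ok \<nu> a c"
proof (induction ps arbitrary: A v)
  case Nil
  then show ?case using right_rayD(1)[OF Nil(2)] by (auto simp: columns_def)
next
  case (Cons d ps)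
  obtain p w where d: "d = (p, w)" by fastforce
  with Cons.prems(1) obtain x where x: "A x" "\<forall>a<x. A a \<longrightarrow> col_ok \<nu> a v" "point_ok \<nu> x p"
    "diagram_ok \<nu> (\<lambda>a. x < a) w ps" by auto
  consider "c = v" | "c = p" | "c \<in> set (columns (w, ps))"
    using Cons.prems(3) by (auto simp: columns_def d)
  then show ?case
  proof cases
    case 1 then show ?thesis using x right_rayD(3)[OF Cons.prems(2)] by blast
  next
    case 2 then show ?thesis using x by (auto simp: point_ok_def)
  next
    case 3 then show ?thesis using Cons.IH[OF x(4)] by simp
  qed
qed


subsection \<open>Inserting a polynomial into a diagram\<close>

lemma sg_between:
  "x < y \<Longrightarrow> y < z \<Longrightarrow> \<not> opp (sg x) (sg z) \<Longrightarrow> sg y = (if sg x = 0 then sg z else sg x)"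
  by (auto simp: opp_def sg_def split: if_splits)

lemma opp_sg: "x < z \<Longrightarrow> opp (sg x) (sg z) \<Longrightarrow> x < 0 \<and> 0 < z"
  by (auto simp: opp_def sg_def split: if_splits)

text \<open>Treats bounded and unbounded cells alike: \<open>l\<close> is the left end point if
  there is one, and otherwise a point so far to the left that \<open>f\<close> has its sign at minus
  infinity.\<close>

definition left_sign :: "(real \<Rightarrow> bool) \<Rightarrow> real poly \<Rightarrow> nat \<Rightarrow> bool" where
  "left_sign A f s \<longleftrightarrow> (\<forall>a. A a \<longrightarrow> (\<exists>l<a. (\<forall>w>l. A w) \<and> sg (poly f l) = s))"

definition right_sign :: "(real \<Rightarrow> bool) \<Rightarrow> real poly \<Rightarrow> nat \<Rightarrow> bool" where
  "right_sign B f t \<longleftrightarrow> (\<forall>a. B a \<longrightarrow> (\<exists>r>a. (\<forall>w<r. B w) \<and> sg (poly f r) = t))"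

definition sign_change_at :: "(real \<Rightarrow> bool) \<Rightarrow> (real \<Rightarrow> bool) \<Rightarrow> real poly \<Rightarrow> nat \<Rightarrow> nat \<Rightarrow> real \<Rightarrow> bool" where
  "sign_change_at A B f s t c \<longleftrightarrow> A c \<and> B c \<and> poly f c = 0 \<and>
     (\<forall>a<c. A a \<longrightarrow> sg (poly f a) = s) \<and> (\<forall>a>c. B a \<longrightarrow> sg (poly f a) = t)"

text \<open>The points \<open>l\<close> and \<open>r\<close> may be end points outside the cell,
  with the derivative under control only strictly between them; continuity extends strict
  monotonicity to the closed interval. The intermediate value theorem supplies the root,
  monotonicity the signs beside it.\<close>

lemma split_interval_increasing:
  fixes f :: "real poly"
  assumes L: "left_sign A f s" and R: "right_sign B f t"
    and A: "\<forall>a b. A a \<longrightarrow> a < b \<longrightarrow> A b" and B: "\<forall>a b. B b \<longrightarrow> a < b \<longrightarrow> B a"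
    and d: "\<forall>a. A a \<longrightarrow> B a \<longrightarrow> poly (pderiv f) a > 0"
    and ne: "A a0" "B a0"
  shows "opp s t \<Longrightarrow> \<exists>c. sign_change_at A B f s t c"
    and "\<not> opp s t \<Longrightarrow> A a \<Longrightarrow> B a \<Longrightarrow> sg (poly f a) = (if s = 0 then t else s)"
proof -
  have mono: "poly f l < poly f r" if "l < r" "\<And>w. l < w \<Longrightarrow> w < r \<Longrightarrow> A w \<and> B w" for l r
  proof (rule DERIV_pos_imp_increasing_open[OF \<open>l < r\<close>])
    show "\<exists>y. DERIV (poly f) x :> y \<and> y > 0" if "l < x" "x < r" for x
      using d poly_DERIV \<open>\<And>w. l < w \<Longrightarrow> w < r \<Longrightarrow> A w \<and> B w\<close> that by blast
  qed (auto intro: continuous_intros)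
  have lr: "\<exists>l r. l < a \<and> a < r \<and> (\<forall>w>l. A w) \<and> (\<forall>w<r. B w) \<and> sg (poly f l) = s \<and> sg (poly f r) = t
      \<and> poly f l < poly f a \<and> poly f a < poly f r" if a: "A a" "B a" for a
  proof -
    obtain l where l: "l < a" "\<forall>w>l. A w" "sg (poly f l) = s" using L a(1) unfolding left_sign_def by blast
    obtain r where r: "r > a" "\<forall>w<r. B w" "sg (poly f r) = t" using R a(2) unfolding right_sign_def by blast
    have "poly f l < poly f a" "poly f a < poly f r" by (rule mono; use l r in simp)+
    then show ?thesis using l r by (intro exI[of _ l] exI[of _ r]) simp
  qed
  show "sg (poly f a) = (if s = 0 then t else s)" if "\<not> opp s t" "A a" "B a"
    using lr[OF that(2,3)] sg_between that(1) by blast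
  show "\<exists>c. sign_change_at A B f s t c" if "opp s t"
  proof -
    obtain l r where lr: "l < a0" "a0 < r" "\<forall>w>l. A w" "\<forall>w<r. B w" "sg (poly f l) = s" "sg (poly f r) = t"
      "poly f l < poly f a0" "poly f a0 < poly f r" using lr[OF ne] by blast
    then have fl: "poly f l < 0" "poly f r > 0"
      using that opp_sg[of "poly f l" "poly f r"] by auto
    then have st: "s = 2" "t = 1"
      using lr(5,6) sg_eq_1 sg_eq_2 by auto
    from fl obtain c where c: "l < c" "c < r" "poly f c = 0"
      using poly_IVT_pos[of l r f] lr by auto
    have cAB: "A c" "B c" using c lr by auto
    have "poly f a < 0" if "a < c" "A a" for a
      using mono[of a c] that A B cAB c by metis
    moreover have "poly f a > 0" if "a > c" "B a" for a
      using mono[of c a] that A B cAB c by metis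
    ultimately show ?thesis
      using c cAB unfolding st sg_eq_1 sg_eq_2 sign_change_at_def by blast
  qed
qed

text \<open>A decreasing \<open>f\<close> is treated as the increasing polynomial \<open>- f\<close>
  with negated end signs.\<close>

lemma split_interval:
  fixes f :: "real poly"
  assumes L: "left_sign A f s" and R: "right_sign B f t"
    and A: "\<forall>a b. A a \<longrightarrow> a < b \<longrightarrow> A b" and B: "\<forall>a b. B b \<longrightarrow> a < b \<longrightarrow> B a"
    and d: "\<forall>a. A a \<longrightarrow> B a \<longrightarrow> sg (poly (pderiv f) a) = d" "d \<noteq> 0"
    and ne: "A a0" "B a0"
  shows "opp s t \<Longrightarrow> \<exists>c. sign_change_at A B f s t c"
    and "\<not> opp s t \<Longrightarrow> A a \<Longrightarrow> B a \<Longrightarrow> sg (poly f a) = (if s = 0 then t else s)"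
proof -
  have *: "(opp s t \<longrightarrow> (\<exists>c. sign_change_at A B f s t c)) \<and>
    (\<not> opp s t \<longrightarrow> A a \<longrightarrow> B a \<longrightarrow> sg (poly f a) = (if s = 0 then t else s))"
  proof (cases "poly (pderiv f) a0 > 0")
    case True
    then have d1: "d = 1" using d(1) ne sg_eq_1[of "poly (pderiv f) a0"] by auto
    have d': "\<forall>a. A a \<longrightarrow> B a \<longrightarrow> poly (pderiv f) a > 0"
      using d(1) unfolding d1 sg_eq_1 .
    show ?thesis
      using split_interval_increasing[OF L R A B d' ne] by blast
  next
    case False
    then have d2: "d = 2" using d ne unfolding sg_def by (metis (full_types))
    have d': "\<forall>a. A a \<longrightarrow> B a \<longrightarrow> poly (pderiv (- f)) a > 0"
      using d(1) unfolding d2 sg_eq_2 by (simp add: pderiv_minus)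
    have L': "left_sign A (- f) (neg_sign s)" and R': "right_sign B (- f) (neg_sign t)"
      using L R unfolding left_sign_def right_sign_def by (fastforce simp: sg_minus)+
    note S = split_interval_increasing[OF L' R' A B d' ne]
    \<comment> \<open>\<open>neg_sign\<close> is injective on actual signs but not on all numbers,
      so \<open>s\<close> and \<open>t\<close> are first written as signs of reals.\<close>
    obtain a1 a2 where st: "s = sg a1" "t = sg a2"
      using L R ne unfolding left_sign_def right_sign_def by metis
    have inj: "neg_sign (sg x) = neg_sign (sg y) \<longleftrightarrow> sg x = sg y" for x y
      by (auto simp: neg_sign_def sg_def)
    have o: "opp (neg_sign s) (neg_sign t) = opp s t"
      and if_neg: "(if neg_sign s = 0 then neg_sign t else neg_sign s) = neg_sign (sg (if a1 = 0 then a2 else a1))"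
      and if_sg: "(if s = 0 then t else s) = sg (if a1 = 0 then a2 else a1)"
      unfolding st by (auto simp: opp_def neg_sign_def sg_def)
    have "sign_change_at A B (- f) (neg_sign s) (neg_sign t) c = sign_change_at A B f s t c" for c
      unfolding sign_change_at_def st poly_minus sg_minus inj by simp
    then show ?thesis
      using S unfolding o if_neg if_sg poly_minus sg_minus inj by blast
  qed
  then show "opp s t \<Longrightarrow> \<exists>c. sign_change_at A B f s t c"
    "\<not> opp s t \<Longrightarrow> A a \<Longrightarrow> B a \<Longrightarrow> sg (poly f a) = (if s = 0 then t else s)"
    by blast+
qed

lemma sg_at_top:
  fixes f :: "real poly"
  assumes "f \<noteq> 0"
  shows "\<exists>r>a. sg (poly f r) = sg (lead_coeff f)"
proof (cases "lead_coeff f > 0")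
  case True
  then obtain n where n: "\<forall>x\<ge>n. poly f x \<ge> lead_coeff f" using poly_pinfty_gt_lc by blast
  then have "poly f (max n (a + 1)) > 0" using True by (meson max.cobounded1 less_le_trans)
  then show ?thesis using True by (intro exI[of _ "max n (a + 1)"]) (auto simp: sg_def)
next
  case False
  then have neg: "lead_coeff f < 0" using assms by (simp add: less_le)
  then obtain n where n: "\<forall>x\<ge>n. poly (- f) x \<ge> lead_coeff (- f)" using poly_pinfty_gt_lc[of "- f"] by auto
  then have "poly f (max n (a + 1)) \<le> lead_coeff f" by (simp add: max_def)
  then show ?thesis using neg by (intro exI[of _ "max n (a + 1)"]) (auto simp: sg_def)
qed

lemma sg_at_bot:
  fixes f :: "real poly"
  assumes "f \<noteq> 0"
  shows "\<exists>l<a. sg (poly f l) = (if even (degree f) then sg (lead_coeff f) else neg_sign (sg (lead_coeff f)))"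
proof -
  have l: "lead_coeff (f \<circ>\<^sub>p [:0, -1:]) = lead_coeff f * (-1) ^ degree f"
    by (subst lead_coeff_comp) auto
  then have "f \<circ>\<^sub>p [:0, -1:] \<noteq> 0" using assms by force
  from sg_at_top[OF this, of "- a"] obtain r where
    "r > - a" "sg (poly f (- r)) = sg (lead_coeff f * (-1) ^ degree f)"
    by (auto simp: l poly_pcompose)
  then show ?thesis
    by (intro exI[of _ "- r"]) (auto simp: sg_minus uminus_power_if)
qed

lemma degree_pval:
  assumes "1 \<le> length p" "tval (lc p) \<nu> \<noteq> 0"
  shows "degree (pval \<nu> p) = length p - 1" "lead_coeff (pval \<nu> p) = tval (lc p) \<nu>"
proof -
  show d: "degree (pval \<nu> p) = length p - 1"
  proof (rule antisym)
    show "degree (pval \<nu> p) \<le> length p - 1"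
      by (rule degree_le) (auto simp: coeff_pval cf_beyond)
    show "length p - 1 \<le> degree (pval \<nu> p)"
      by (rule le_degree) (use assms in \<open>simp add: coeff_pval lc_def\<close>)
  qed
  show "lead_coeff (pval \<nu> p) = tval (lc p) \<nu>" by (simp add: d) (simp add: coeff_pval lc_def)
qed

lemma poly_zero_on_interval:
  fixes f :: "real poly"
  assumes "a < b" "\<And>x. a < x \<Longrightarrow> x < b \<Longrightarrow> poly f x = 0"
  shows "f = 0"
proof (rule ccontr)
  assume "f \<noteq> 0"
  moreover have "{a<..<b} \<subseteq> {x. poly f x = 0}" using assms(2) by auto
  ultimately show False using poly_roots_finite infinite_Ioo[OF assms(1)] finite_subset by blast
qed

text \<open>The situation in which \<open>p\<close> is inserted into a diagram with keys
  \<open>K\<close>. Insertion by increasing length means that every shorter nonempty member of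
  \<open>M\<close> is a key and no key is longer than \<open>p\<close>; members as long as
  \<open>p\<close> may or may not be present.\<close>

locale diagram_extension =
  fixes \<nu> :: state and M K :: "trm list set" and p :: "trm list"
  assumes closed: "\<And>q. q \<in> M \<Longrightarrow> 2 \<le> length q \<Longrightarrow> succs M q \<subseteq> M"
    and p: "p \<in> M" "2 \<le> length p"
    and K: "\<And>q. q \<in> M \<Longrightarrow> 1 \<le> length q \<Longrightarrow> length q < length p \<Longrightarrow> q \<in> K"
    and KM: "\<And>q. q \<in> K \<Longrightarrow> q \<in> M \<and> length q \<le> length p"
begin

lemma look_shorter:
  assumes "col_ok \<nu> a v" "fst ` set v = K" "q \<in> M" "length q < length p"
  shows "look v q = sg (poly (pval \<nu> q) a)"
  using look_eq_sg[OF assms(1), of q] K[OF assms(3)] assms(2,4) by (cases q) auto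

lemma look_lc:
  assumes "col_ok \<nu> a v" "fst ` set v = K" "q \<in> M" "2 \<le> length q" "length q \<le> length p"
  shows "look v [lc q] = sg (tval (lc q) \<nu>)"
proof -
  have "[lc q] \<in> M" using closed[OF assms(3,4)] by (auto simp: succs_def)
  then show ?thesis using look_shorter[OF assms(1,2), of "[lc q]"] assms(4,5) by simp
qed

text \<open>The divisor is at most as long as \<open>p\<close>, so the pseudo-remainder belongs to
  the closed set \<open>M\<close>; being shorter than the divisor, it can already be looked
  up.\<close>

lemma point_sign_eq:
  assumes "point_ok \<nu> a v" "fst ` set v = K"
  shows "point_sign p v = sg (poly (pval \<nu> p) a)"
proof -
  obtain e es where e: "filter (\<lambda>e. snd e = 0 \<and> 2 \<le> length (fst e) \<and> look v [lc (fst e)] \<noteq> 0) v = e # es"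
    using assms(1) unfolding point_ok_def
    by (cases "filter (\<lambda>e. snd e = 0 \<and> 2 \<le> length (fst e) \<and> look v [lc (fst e)] \<noteq> 0) v")
       (auto simp: filter_empty_conv)
  have col: "col_ok \<nu> a v" using assms(1) by (simp add: point_ok_def)
  from e have *: "e \<in> set v" "snd e = 0" "2 \<le> length (fst e)" "look v [lc (fst e)] \<noteq> 0"
    by (auto simp: filter_eq_Cons_iff)
  then have q: "fst e \<in> M" "length (fst e) \<le> length p" using KM assms(2) by auto
  have "tval (lc (fst e)) \<nu> \<noteq> 0" using look_lc[OF col assms(2) q(1) *(3) q(2)] *(4) by simp
  moreover have "poly (pval \<nu> (fst e)) a = 0" using col *(1,2) by (auto simp: col_ok_def)
  ultimately have "sg (poly (pval \<nu> (prem (fst e) p)) a) = sg (poly (pval \<nu> p) a)"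
    using *(3) by (intro sg_prem) auto
  moreover have "prem (fst e) p \<in> M"
    using closed[OF q(1) *(3)] q(2) p by (auto simp: succs_def)
  then have "look v (prem (fst e) p) = sg (poly (pval \<nu> (prem (fst e) p)) a)"
    using length_prem[of "fst e" p] *(3) q(2) by (intro look_shorter[OF col assms(2)]) auto
  ultimately show ?thesis unfolding point_sign_def e by simp
qed

lemma single_neq: "[c] \<noteq> p"
  using p(2) by auto

lemma point_ok_Cons:
  assumes "point_ok \<nu> a v" "s = sg (poly (pval \<nu> p) a)"
  shows "point_ok \<nu> a ((p, s) # v)"
proof -
  obtain e where "e \<in> set v" "snd e = 0" "2 \<le> length (fst e)" "look v [lc (fst e)] \<noteq> 0"
    using assms(1) by (auto simp: point_ok_def)
  moreover from this have "look ((p, s) # v) [lc (fst e)] \<noteq> 0"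
    using single_neq[of "lc (fst e)"] by (simp add: look_Cons)
  ultimately have "\<exists>e\<in>set ((p, s) # v). snd e = 0 \<and> 2 \<le> length (fst e) \<and> look ((p, s) # v) [lc (fst e)] \<noteq> 0"
    by (intro bexI[of _ e]) simp_all
  then show ?thesis using assms by (simp add: point_ok_def col_ok_def)
qed

lemma split_cell_ok:
  assumes nz: "tval (lc p) \<nu> \<noteq> 0"
    and ray: "right_ray A" and B: "\<forall>a b. B b \<longrightarrow> a < b \<longrightarrow> B a"
    and L: "left_sign A (pval \<nu> p) s" and R: "right_sign B (pval \<nu> p) t"
    and v: "\<forall>a. A a \<longrightarrow> B a \<longrightarrow> col_ok \<nu> a v" "fst ` set v = K"
    and ne: "A a1" "B a1"
  shows "opp s t \<Longrightarrow> \<exists>c. A c \<and> B c \<and> point_ok \<nu> c ((p, 0) # v) \<and> (\<forall>a<c. A a \<longrightarrow> col_ok \<nu> a ((p, s) # v))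
           \<and> (\<forall>a>c. B a \<longrightarrow> col_ok \<nu> a ((p, t) # v))"
    and "\<not> opp s t \<Longrightarrow> A a \<Longrightarrow> B a \<Longrightarrow> col_ok \<nu> a ((p, if s = 0 then t else s) # v)"
proof -
  have A: "\<forall>a b. A a \<longrightarrow> a < b \<longrightarrow> A b" using right_rayD(2)[OF ray] by blast
  define d where "d = look v (deriv p)"
  have "deriv p \<in> M" "length (deriv p) < length p"
    using closed[OF p] p(2) by (auto simp: succs_def deriv_def)
  then have d: "\<forall>a. A a \<longrightarrow> B a \<longrightarrow> sg (poly (pderiv (pval \<nu> p)) a) = d"
    using look_shorter[OF _ v(2)] v(1) unfolding d_def pval_deriv[symmetric] by metis
  \<comment> \<open>A derivative of sign 0 would vanish on a nonempty open interval and make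
    \<open>p\<close> constant, although its leading coefficient is nonzero and its length at least
    2.\<close>
  have d0: "d \<noteq> 0"
  proof
    assume "d = 0"
    obtain a0 where a0: "a0 < a1" "A a0" using right_rayD(3)[OF ray] ne by blast
    have "poly (pderiv (pval \<nu> p)) x = 0" if "a0 < x" "x < a1" for x
      using d A B a0(2) ne(2) that \<open>d = 0\<close> sg_eq_0(1) by metis
    then have "pderiv (pval \<nu> p) = 0" using poly_zero_on_interval[OF a0(1)] by blast
    then have "degree (pval \<nu> p) = 0" by (simp add: pderiv_eq_0_iff)
    then show False using degree_pval(1)[OF _ nz] p(2) by simp
  qed
  note S = split_interval[OF L R A B d d0 ne]
  show "col_ok \<nu> a ((p, if s = 0 then t else s) # v)" if "\<not> opp s t" "A a" "B a"
    using S(2)[OF that] v(1) that(2,3) by (simp add: col_ok_def)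
  assume "opp s t"
  then obtain c where "sign_change_at A B (pval \<nu> p) s t c"
    using S(1) by blast
  then have c: "A c" "B c" "poly (pval \<nu> p) c = 0" "\<forall>a<c. A a \<longrightarrow> sg (poly (pval \<nu> p) a) = s"
    "\<forall>a>c. B a \<longrightarrow> sg (poly (pval \<nu> p) a) = t"
    by (simp_all add: sign_change_at_def)
  have vc: "col_ok \<nu> c v" using v(1) c(1,2) by blast
  \<comment> \<open>At a new root \<open>p\<close> itself is the vanishing polynomial that the point
    has to carry.\<close>
  have "look ((p, 0) # v) [lc p] = sg (tval (lc p) \<nu>)"
    using look_lc[OF vc v(2) p] single_neq[of "lc p"] by (simp add: look_Cons)
  then have "point_ok \<nu> c ((p, 0) # v)"
    using vc c(3) nz p(2) by (simp add: point_ok_def col_ok_def)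
  moreover have "col_ok \<nu> a ((p, s) # v)" if "a < c" "A a" for a
  proof -
    have "B a" using B c(2) that(1) by blast
    then show ?thesis using v(1) c(4) that by (simp add: col_ok_def)
  qed
  moreover have "col_ok \<nu> a ((p, t) # v)" if "a > c" "B a" for a
  proof -
    have "A a" using A c(1) that(1) by blast
    then show ?thesis using v(1) c(5) that by (simp add: col_ok_def)
  qed
  ultimately show "\<exists>c. A c \<and> B c \<and> point_ok \<nu> c ((p, 0) # v) \<and> (\<forall>a<c. A a \<longrightarrow> col_ok \<nu> a ((p, s) # v))
           \<and> (\<forall>a>c. B a \<longrightarrow> col_ok \<nu> a ((p, t) # v))"
    using c(1,2) by (intro exI[of _ c]) simp
qed

lemma insert_right_Cons:
  "insert_right q t (c # ps) = (point_sign q (fst c),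
      let D = split_cell q (point_sign q (fst c)) (fst (insert_right q t ps)) (snd c)
      in ((q, point_sign q (fst c)) # fst c, fst D) # snd D @ snd (insert_right q t ps))"
  and insert_right_Nil: "insert_right q t [] = (t, [])"
  by (simp_all add: insert_right_def)

text \<open>The cell \<open>v\<close> to the left of \<open>ps\<close> is part of the statement, so
  that the induction hypothesis also covers the cell following the first point; the left sign of
  that cell is the sign of \<open>p\<close> at the point.\<close>

lemma insert_right_ok:
  assumes nz: "tval (lc p) \<nu> \<noteq> 0"
    and t: "right_sign (\<lambda>_. True) (pval \<nu> p) t"
    and "diagram_ok \<nu> A v ps" "\<forall>c\<in>set (columns (v, ps)). fst ` set c = K" "right_ray A"
    and "left_sign A (pval \<nu> p) s"
  shows "diagram_ok \<nu> A (fst (split_cell p s (fst (insert_right p t ps)) v))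
    (snd (split_cell p s (fst (insert_right p t ps)) v) @ snd (insert_right p t ps))"
  using assms(3-)
proof (induction ps arbitrary: A v s)
  case Nil
  obtain a1 where a1: "A a1" using right_rayD(1)[OF Nil(3)] by blast
  have v: "\<forall>a. A a \<longrightarrow> True \<longrightarrow> col_ok \<nu> a v" using Nil by simp
  have K: "fst ` set v = K" using Nil by (simp add: columns_def)
  have B: "\<forall>a b :: real. True \<longrightarrow> a < b \<longrightarrow> True" by simp
  note S = split_cell_ok[OF nz Nil(3) B Nil(4) t v K a1 TrueI]
  show ?case
  proof (cases "opp s t")
    case True
    then show ?thesis using S(1) by (auto simp: insert_right_Nil split_cell_def)
  next
    case False
    then show ?thesis using S(2) by (simp add: insert_right_Nil split_cell_def)
  qed
next
  case (Cons c ps)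
  obtain q w where c: "c = (q, w)" by fastforce
  with Cons.prems(1) obtain x where x: "A x" "\<forall>a<x. A a \<longrightarrow> col_ok \<nu> a v" "point_ok \<nu> x q"
    "diagram_ok \<nu> (\<lambda>a. x < a) w ps" by auto
  have keys: "fst ` set v = K" "fst ` set q = K" "\<forall>d\<in>set (columns (w, ps)). fst ` set d = K"
    using Cons.prems(2) by (auto simp: columns_def c)
  define u where "u = point_sign p q"
  have u: "u = sg (poly (pval \<nu> p) x)" unfolding u_def by (rule point_sign_eq[OF x(3) keys(2)])
  define D where "D = split_cell p u (fst (insert_right p t ps)) w"
  have "diagram_ok \<nu> (\<lambda>a. x < a) (fst D) (snd D @ snd (insert_right p t ps))"
    unfolding D_def by (rule Cons.IH[OF x(4) keys(3)]) (auto simp: u left_sign_def)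
  moreover have "point_ok \<nu> x ((p, u) # q)" using x(3) u by (rule point_ok_Cons)
  ultimately have tail: "A' x \<Longrightarrow> (\<forall>a<x. A' a \<longrightarrow> col_ok \<nu> a v') \<Longrightarrow>
      diagram_ok \<nu> A' v' (((p, u) # q, fst D) # snd D @ snd (insert_right p t ps))" for A' v'
    by auto
  have ins: "insert_right p t (c # ps) = (u, ((p, u) # q, fst D) # snd D @ snd (insert_right p t ps))"
    by (simp add: insert_right_Cons c u_def D_def Let_def)
  obtain a1 where a1: "A a1" "a1 < x" using right_rayD(3)[OF Cons.prems(3) x(1)] by blast
  have R: "right_sign (\<lambda>a. a < x) (pval \<nu> p) u" using u by (auto simp: right_sign_def)
  have v: "\<forall>a. A a \<longrightarrow> a < x \<longrightarrow> col_ok \<nu> a v" using x(2) by blast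
  have B: "\<forall>a b. b < x \<longrightarrow> a < b \<longrightarrow> a < x" by auto
  note S = split_cell_ok[OF nz Cons.prems(3) B Cons.prems(4) R v keys(1) a1]
  show ?case
  proof (cases "opp s u")
    case True
    then obtain z where "A z" "z < x" "point_ok \<nu> z ((p, 0) # v)" "\<forall>a<z. A a \<longrightarrow> col_ok \<nu> a ((p, s) # v)"
      "\<forall>a>z. a < x \<longrightarrow> col_ok \<nu> a ((p, u) # v)" using S(1) by auto
    moreover from this have "diagram_ok \<nu> (\<lambda>a. z < a) ((p, u) # v)
        (((p, u) # q, fst D) # snd D @ snd (insert_right p t ps))"
      by (intro tail) auto
    ultimately show ?thesis
      unfolding ins using True by (auto simp: split_cell_def simp del: diagram_ok.simps(2) intro!: diagram_ok.simps(2)[THEN iffD2])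
  next
    case False
    then have "diagram_ok \<nu> A ((p, if s = 0 then u else s) # v)
        (((p, u) # q, fst D) # snd D @ snd (insert_right p t ps))"
      using S(2) x(1) by (intro tail) auto
    then show ?thesis unfolding ins using False by (simp add: split_cell_def)
  qed
qed

lemma keys_split_cell:
  assumes "fst ` set v = K"
  shows "fst ` set (fst (split_cell p s t v)) = insert p K"
    "\<forall>(a, b)\<in>set (snd (split_cell p s t v)). fst ` set a = insert p K \<and> fst ` set b = insert p K"
  using assms by (simp_all add: split_cell_def)

lemma columns_eq: "set (columns (v, ps)) = insert v (\<Union>(a, b)\<in>set ps. {a, b})"
  by (auto simp: columns_def)

lemma ball_columns: "(\<forall>c\<in>set (columns (v, ps)). P c) \<longleftrightarrow> P v \<and> (\<forall>(a, b)\<in>set ps. P a \<and> P b)"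
  by (auto simp: columns_def)

lemma keys_insert_right:
  assumes "\<forall>(a, b)\<in>set ps. fst ` set a = K \<and> fst ` set b = K"
  shows "\<forall>(a, b)\<in>set (snd (insert_right p t ps)). fst ` set a = insert p K \<and> fst ` set b = insert p K"
  using assms
proof (induction ps)
  case (Cons c ps)
  obtain q w where c: "c = (q, w)" by fastforce
  define D where "D = split_cell p (point_sign p q) (fst (insert_right p t ps)) w"
  have "fst ` set w = K" using Cons.prems c by simp
  note D = keys_split_cell[OF this, of "point_sign p q" "fst (insert_right p t ps)", folded D_def]
  have "snd (insert_right p t (c # ps)) =
      ((p, point_sign p q) # q, fst D) # snd D @ snd (insert_right p t ps)"
    by (simp add: insert_right_Cons c Let_def D_def)
  moreover have "fst ` set q = K" "\<forall>(a, b)\<in>set ps. fst ` set a = K \<and> fst ` set b = K"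
    using Cons.prems c by auto
  ultimately show ?case using D Cons.IH by (simp add: ball_Un)
qed (simp add: insert_right_Nil)

lemma add_poly_ok:
  assumes "diagram_ok \<nu> (\<lambda>_. True) v ps" "\<forall>c\<in>set (columns (v, ps)). fst ` set c = K"
  shows "diagram_ok \<nu> (\<lambda>_. True) (fst (add_poly p (v, ps))) (snd (add_poly p (v, ps)))"
    and "\<forall>c\<in>set (columns (add_poly p (v, ps))). fst ` set c = insert p K"
proof -
  \<comment> \<open>One point described by the leftmost column suffices to read off the sign of the
    constant \<open>lc p\<close>.\<close>
  obtain a0 where a0: "col_ok \<nu> a0 v"
    using columns_realized[OF assms(1)] by (auto simp: columns_def)
  have keys: "fst ` set v = K" "\<forall>(a, b)\<in>set ps. fst ` set a = K \<and> fst ` set b = K"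
    using assms(2) unfolding columns_eq by fast+
  have t: "look v [lc p] = sg (tval (lc p) \<nu>)" by (rule look_lc[OF a0 keys(1) p]) simp
  have "diagram_ok \<nu> (\<lambda>_. True) (fst (add_poly p (v, ps))) (snd (add_poly p (v, ps))) \<and>
    (\<forall>c\<in>set (columns (add_poly p (v, ps))). fst ` set c = insert p K)"
  proof (cases "tval (lc p) \<nu> = 0")
    case True
    define ext where "ext c = (p, look c (butlast p)) # c" for c
    have add: "add_poly p (v, ps) = (ext v, map (\<lambda>c. (ext (fst c), ext (snd c))) ps)"
      using t True by (simp add: add_poly_def ext_def)
    have "butlast p \<in> M" using closed[OF p] by (auto simp: succs_def)
    then have lk: "look c (butlast p) = sg (poly (pval \<nu> p) a)" if "col_ok \<nu> a c" "fst ` set c = K" for a c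
    proof -
      have "tval (cf p i) \<nu> = tval (cf (butlast p) i) \<nu>" for i
      proof -
        consider "i < length p - 1" | "i = length p - 1" | "length p \<le> i" using p(2) by linarith
        then show ?thesis
          using True by cases (auto simp: nth_or_def lc_def nth_butlast)
      qed
      then have "pval \<nu> p = pval \<nu> (butlast p)"
        by (intro poly_eqI) (simp add: coeff_pval)
      then show ?thesis using look_shorter[OF that \<open>butlast p \<in> M\<close>] p(2) by simp
    qed
    have ext: "col_ok \<nu> a (ext c)" if "col_ok \<nu> a c" "fst ` set c = K" for a c
      using that lk[OF that] by (simp add: col_ok_def ext_def)
    have pext: "point_ok \<nu> a (ext c)" if "point_ok \<nu> a c" "fst ` set c = K" for a c
      unfolding ext_def using that lk by (intro point_ok_Cons) (auto simp: point_ok_def)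
    have "diagram_ok \<nu> A (ext v) (map (\<lambda>c. (ext (fst c), ext (snd c))) ps)"
      if "diagram_ok \<nu> A v ps" "\<forall>c\<in>set (columns (v, ps)). fst ` set c = K" for A v ps
      using that
    proof (induction ps arbitrary: A v)
      case Nil then show ?case using ext by (auto simp: columns_def)
    next
      case (Cons c ps)
      obtain q w where c: "c = (q, w)" by fastforce
      with Cons.prems(1) obtain x where x: "A x" "\<forall>a<x. A a \<longrightarrow> col_ok \<nu> a v" "point_ok \<nu> x q"
        "diagram_ok \<nu> (\<lambda>a. x < a) w ps" by auto
      have "diagram_ok \<nu> (\<lambda>a. x < a) (ext w) (map (\<lambda>c. (ext (fst c), ext (snd c))) ps)"
        using Cons.prems(2) by (intro Cons.IH x) (auto simp: columns_def c)
      then show ?case using x Cons.prems(2) ext pext by (auto simp: c columns_def)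
    qed
    moreover have "fst ` set c = insert p K"
      if c: "c \<in> set (columns (ext v, map (\<lambda>c. (ext (fst c), ext (snd c))) ps))" for c
    proof -
      from c consider "c = ext v" | e where "e \<in> set ps" "c = ext (fst e) \<or> c = ext (snd e)"
        unfolding columns_eq by auto
      then have "\<exists>d. c = ext d \<and> fst ` set d = K"
      proof cases
        case (2 e)
        then have "fst ` set (fst e) = K \<and> fst ` set (snd e) = K"
          using bspec[OF keys(2)] by (simp add: case_prod_beta)
        then show ?thesis using 2(2) by blast
      qed (use keys(1) in blast)
      then show ?thesis by (auto simp: ext_def)
    qed
    ultimately show ?thesis using assms by (simp add: add)
  next
    case False
    define f where "f = pval \<nu> p"
    have f: "degree f = length p - 1" "lead_coeff f = tval (lc p) \<nu>"
      using degree_pval[OF _ False] p(2) by (auto simp: f_def)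
    then have "f \<noteq> 0" using False by auto
    define t s where "t = sg (lead_coeff f)" and "s = (if odd (length p) then t else neg_sign t)"
    have R: "right_sign (\<lambda>_. True) (pval \<nu> p) t"
      using sg_at_top[OF \<open>f \<noteq> 0\<close>] by (simp add: t_def f_def right_sign_def)
    have "odd (length p) \<longleftrightarrow> even (degree f)" using f(1) p(2) by (cases "length p") auto
    then have L: "left_sign (\<lambda>_. True) (pval \<nu> p) s"
      using sg_at_bot[OF \<open>f \<noteq> 0\<close>] unfolding s_def t_def left_sign_def f_def[symmetric]
      by auto
    define E where "E = split_cell p s (fst (insert_right p t ps)) v"
    have add: "add_poly p (v, ps) = (fst E, snd E @ snd (insert_right p t ps))"
      using False t f(2) by (simp add: add_poly_def E_def s_def t_def Let_def)
    have "diagram_ok \<nu> (\<lambda>_. True) (fst E) (snd E @ snd (insert_right p t ps))"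
      unfolding E_def by (rule insert_right_ok[OF False R assms right_ray_True L])
    moreover note E = keys_split_cell[OF keys(1), of s "fst (insert_right p t ps)", folded E_def]
    have "\<forall>c\<in>set (columns (fst E, snd E @ snd (insert_right p t ps))). fst ` set c = insert p K"
      using keys_insert_right[OF keys(2), of t] E unfolding ball_columns set_append ball_Un
      by (intro conjI)
    ultimately show ?thesis by (simp add: add)
  qed
  then show "diagram_ok \<nu> (\<lambda>_. True) (fst (add_poly p (v, ps))) (snd (add_poly p (v, ps)))"
    and "\<forall>c\<in>set (columns (add_poly p (v, ps))). fst ` set c = insert p K" by blast+
qed

end


section \<open>Building the whole diagram length by length\<close>

definition diagram_complete :: "state \<Rightarrow> trm list set \<Rightarrow> diagram \<Rightarrow> bool" where
  "diagram_complete \<nu> K D \<longleftrightarrow> diagram_ok \<nu> (\<lambda>_. True) (fst D) (snd D) \<and>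
     (\<forall>c\<in>set (columns D). fst ` set c = K)"

lemma diagram_complete_fold_level:
  assumes closed: "\<And>q. q \<in> M \<Longrightarrow> 2 \<le> length q \<Longrightarrow> succs M q \<subseteq> M"
    and "2 \<le> l" "\<forall>p\<in>set ps. p \<in> M \<and> length p = l"
    and "\<forall>q\<in>M. 1 \<le> length q \<and> length q < l \<longrightarrow> q \<in> K"
    and "\<forall>q\<in>K. q \<in> M \<and> length q \<le> l"
    and "diagram_complete \<nu> K D"
  shows "diagram_complete \<nu> (K \<union> set ps) (fold add_poly ps D)"
  using assms(3-)
proof (induction ps arbitrary: K D)
  case (Cons p ps)
  interpret diagram_extension \<nu> M K p
    by standard (use closed Cons.prems \<open>2 \<le> l\<close> in auto)
  have D: "diagram_ok \<nu> (\<lambda>_. True) (fst D) (snd D)"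
    "\<forall>c\<in>set (columns (fst D, snd D)). fst ` set c = K"
    using Cons.prems(4) by (simp_all add: diagram_complete_def)
  have "diagram_complete \<nu> (insert p K) (add_poly p D)"
    using add_poly_ok[OF D] unfolding diagram_complete_def prod.collapse by (rule conjI)
  then have "diagram_complete \<nu> (insert p K \<union> set ps) (fold add_poly ps (add_poly p D))"
    by (rule Cons.IH[rotated 3]) (use Cons.prems(1-3) in auto)
  then show ?case by simp
qed simp

lemma diagram_complete_sign_diagram:
  assumes closed: "\<And>q. q \<in> set M \<Longrightarrow> 2 \<le> length q \<Longrightarrow> succs (set M) q \<subseteq> set M"
    and v: "fst ` set v = {q \<in> set M. length q = 1}" "\<And>a. col_ok \<nu> a v"
  shows "diagram_complete \<nu> {q \<in> set M. 1 \<le> length q} (sign_diagram M v)"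
proof -
  define P where "P n = concat (map (\<lambda>l. filter (\<lambda>p. length p = l) M) [2..<n])" for n
  have *: "diagram_complete \<nu> {q \<in> set M. 1 \<le> length q \<and> length q < n} (fold add_poly (P n) (v, []))"
    if "2 \<le> n" for n
    using that
  proof (induction n rule: dec_induct)
    \<comment> \<open>Before anything of formally positive degree is inserted, the line is a single
      cell on which all constants keep their signs.\<close>
    case base
    have "{q \<in> set M. 1 \<le> length q \<and> length q < 2} = {q \<in> set M. length q = 1}" by auto
    then show ?case using v by (simp add: P_def diagram_complete_def columns_def)
  next
    case (step n)
    have P: "P (Suc n) = P n @ filter (\<lambda>p. length p = n) M" using step(1) by (simp add: P_def)
    have "diagram_complete \<nu> ({q \<in> set M. 1 \<le> length q \<and> length q < n} \<union> set (filter (\<lambda>p. length p = n) M))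
       (fold add_poly (filter (\<lambda>p. length p = n) M) (fold add_poly (P n) (v, [])))"
      by (rule diagram_complete_fold_level[OF closed step(1) _ _ _ step(3)]) auto
    moreover have "{q \<in> set M. 1 \<le> length q \<and> length q < n} \<union> set (filter (\<lambda>p. length p = n) M)
        = {q \<in> set M. 1 \<le> length q \<and> length q < Suc n}" using step(1) by auto
    ultimately show ?case by (simp add: P)
  qed
  have "length q \<le> length (concat M)" if "q \<in> set M" for q
    using that by (induction M) auto
  then have N: "{q \<in> set M. 1 \<le> length q \<and> length q < n} = {q \<in> set M. 1 \<le> length q}"
    if "Suc (length (concat M)) \<le> n" for n using that by force
  show ?thesis
    using *[of "Suc (Suc (length (concat M)))"] N[of "Suc (Suc (length (concat M)))"]
    by (simp add: sign_diagram_def P_def del: upt_Suc)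
qed


subsection \<open>Truth tables over sign conditions\<close>

text \<open>A set of states is represented by a list of terms together with the sign vectors of these
  terms in the states of the set.\<close>

type_synonym table = "trm list \<times> nat list list"

definition signs :: "state \<Rightarrow> trm list \<Rightarrow> nat list" where
  "signs \<nu> L = map (\<lambda>\<theta>. sg (tval \<theta> \<nu>)) L"

definition sign_vectors :: "nat \<Rightarrow> nat list list" where
  "sign_vectors n = ((\<lambda>A. concat (map (\<lambda>v. [0 # v, 1 # v, 2 # v]) A)) ^^ n) [[]]"

definition holds :: "table \<Rightarrow> state \<Rightarrow> bool" where
  "holds T \<nu> \<longleftrightarrow> signs \<nu> (fst T) \<in> set (snd T)"

text \<open>Guarantees that the concatenated sign vectors of \<open>table_conj\<close> can be split
  again at the right place.\<close>

definition proper :: "table \<Rightarrow> bool" where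
  "proper T \<longleftrightarrow> (\<forall>w\<in>set (snd T). length w = length (fst T))"

definition table_neg :: "table \<Rightarrow> table" where
  "table_neg T = (fst T, filter (\<lambda>w. w \<notin> set (snd T)) (sign_vectors (length (fst T))))"

definition table_conj :: "table \<Rightarrow> table \<Rightarrow> table" where
  "table_conj T T' = (fst T @ fst T', concat (map (\<lambda>v. map ((@) v) (snd T')) (snd T)))"

definition const_polys :: "trm list list \<Rightarrow> trm list list" where
  "const_polys M = filter (\<lambda>p. length p = 1) M"

text \<open>The constants of the closure become the terms of the new table, since their signs
  determine the diagram. A sign vector is kept iff its diagram has a column satisfying
  \<open>T\<close>; correctness of the diagram is claimed for the vectors that some state
  realises.\<close>

definition table_ex :: "var \<Rightarrow> table \<Rightarrow> table" where
  "table_ex x T = (let M = poly_closure (map (topoly x) (fst T)); C = const_polys M in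
     (map lc C, filter (\<lambda>w. \<exists>v\<in>set (columns (sign_diagram M (zip C w))).
        map (\<lambda>\<theta>. look v (topoly x \<theta>)) (fst T) \<in> set (snd T)) (sign_vectors (length C))))"

lemma set_sign_vectors: "set (sign_vectors n) = {v. length v = n \<and> set v \<subseteq> {0, 1, 2}}"
proof (induction n)
  case 0 show ?case by (auto simp: sign_vectors_def)
next
  case (Suc n)
  have "set (sign_vectors (Suc n)) = (\<Union>v\<in>set (sign_vectors n). {0 # v, 1 # v, 2 # v})"
    by (simp add: sign_vectors_def)
  then show ?case unfolding Suc by (auto simp: length_Suc_conv)
qed

lemma signs_in_sign_vectors [simp]: "signs \<nu> L \<in> set (sign_vectors n) \<longleftrightarrow> length L = n"
  by (auto simp: set_sign_vectors signs_def sg_def)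

lemma holds_neg: "holds (table_neg T) \<nu> \<longleftrightarrow> \<not> holds T \<nu>"
  by (auto simp: holds_def table_neg_def)

lemma proper_neg: "proper (table_neg T)"
  by (simp add: proper_def table_neg_def set_sign_vectors)

lemma holds_conj: "proper T \<Longrightarrow> holds (table_conj T T') \<nu> \<longleftrightarrow> holds T \<nu> \<and> holds T' \<nu>"
  by (auto simp: holds_def table_conj_def signs_def proper_def)

lemma proper_conj: "proper T \<Longrightarrow> proper T' \<Longrightarrow> proper (table_conj T T')"
  by (auto simp: proper_def table_conj_def)

lemma holds_ex: "holds (table_ex x T) \<nu> \<longleftrightarrow> (\<exists>a. holds T (\<nu>(x := a)))"
proof -
  define M C where "M = poly_closure (map (topoly x) (fst T))" and "C = const_polys M"
  define D where "D = sign_diagram M (zip C (signs \<nu> (map lc C)))"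
  have lC: "length p = 1" "p \<in> set M" if "p \<in> set C" for p using that by (auto simp: C_def const_polys_def)
  have single: "p = [lc p]" if "length p = 1" for p
    using that by (cases p) (auto simp: lc_def nth_or_def)
  have "diagram_complete \<nu> {q \<in> set M. 1 \<le> length q} D"
    unfolding D_def
  proof (rule diagram_complete_sign_diagram)
    show "succs (set M) q \<subseteq> set M" if "q \<in> set M" "2 \<le> length q" for q
      using poly_closure_closed that by (simp add: M_def)
    have "map fst (zip C (signs \<nu> (map lc C))) = C" by (simp add: signs_def)
    then have "fst ` set (zip C (signs \<nu> (map lc C))) = set C" by (metis set_map)
    then show "fst ` set (zip C (signs \<nu> (map lc C))) = {q \<in> set M. length q = 1}"
      by (auto simp: C_def const_polys_def)
    show "col_ok \<nu> a (zip C (signs \<nu> (map lc C)))" for a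
    proof -
      have "sg (tval (lc p) \<nu>) = sg (poly (pval \<nu> p) a)" if "p \<in> set C" for p
        using single[OF lC(1)[OF that]] by (metis pval_Cons pval_Nil poly_pCons mult_zero_right poly_0 add.right_neutral)
      then show ?thesis
        by (auto simp: col_ok_def signs_def zip_map2 zip_same_conv_map)
    qed
  qed
  then have ok: "diagram_ok \<nu> (\<lambda>_. True) (fst D) (snd D)"
    and keys: "\<And>c. c \<in> set (columns D) \<Longrightarrow> fst ` set c = {q \<in> set M. 1 \<le> length q}"
    by (auto simp: diagram_complete_def)
  have look: "map (\<lambda>\<theta>. look c (topoly x \<theta>)) (fst T) = signs (\<nu>(x := a)) (fst T)"
    if "c \<in> set (columns D)" "col_ok \<nu> a c" for a c
  proof -
    have "look c (topoly x \<theta>) = sg (tval \<theta> (\<nu>(x := a)))" if "\<theta> \<in> set (fst T)" for \<theta>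
    proof -
      have "topoly x \<theta> \<in> set M" using subset_poly_closure that unfolding M_def by fastforce
      then have "topoly x \<theta> \<in> fst ` set c \<or> topoly x \<theta> = []"
        using keys[OF \<open>c \<in> set (columns D)\<close>] by (simp add: Suc_le_eq)
      then show ?thesis using look_eq_sg[OF \<open>col_ok \<nu> a c\<close>] by (simp add: poly_topoly)
    qed
    then show ?thesis by (simp add: signs_def)
  qed
  have "holds (table_ex x T) \<nu> \<longleftrightarrow>
    (\<exists>c\<in>set (columns D). map (\<lambda>\<theta>. look c (topoly x \<theta>)) (fst T) \<in> set (snd T))"
    by (simp add: holds_def table_ex_def Let_def M_def[symmetric] C_def[symmetric] D_def[symmetric])
  also have "\<dots> \<longleftrightarrow> (\<exists>a. holds T (\<nu>(x := a)))"
  proof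
    assume "\<exists>c\<in>set (columns D). map (\<lambda>\<theta>. look c (topoly x \<theta>)) (fst T) \<in> set (snd T)"
    then show "\<exists>a. holds T (\<nu>(x := a))"
      using columns_realized[OF ok right_ray_True] look by (metis holds_def prod.collapse)
  next
    assume "\<exists>a. holds T (\<nu>(x := a))"
    then show "\<exists>c\<in>set (columns D). map (\<lambda>\<theta>. look c (topoly x \<theta>)) (fst T) \<in> set (snd T)"
      using columns_cover[OF ok] look by (metis holds_def prod.collapse)
  qed
  finally show ?thesis .
qed


subsection \<open>Deciding validity\<close>

definition pvars :: "trm list \<Rightarrow> var set" where
  "pvars p = (\<Union>c\<in>set p. tvars c)"

primrec var_list :: "trm \<Rightarrow> var list" where
  "var_list (Var x) = [x]"
| "var_list (Const c) = []"
| "var_list (Plus \<theta> \<eta>) = var_list \<theta> @ var_list \<eta>"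
| "var_list (Times \<theta> \<eta>) = var_list \<theta> @ var_list \<eta>"

lemma set_var_list: "set (var_list \<theta>) = tvars \<theta>"
  by (induction \<theta>) auto

lemma tval_cong: "(\<And>x. x \<in> tvars \<theta> \<Longrightarrow> \<nu> x = \<omega> x) \<Longrightarrow> tval \<theta> \<nu> = tval \<theta> \<omega>"
  by (induction \<theta>) auto

lemma holds_cong:
  assumes "\<And>x. x \<in> pvars (fst T) \<Longrightarrow> \<nu> x = \<omega> x" shows "holds T \<nu> \<longleftrightarrow> holds T \<omega>"
proof -
  have "signs \<nu> (fst T) = signs \<omega> (fst T)"
    using assms unfolding signs_def pvars_def by (auto intro!: tval_cong arg_cong[of _ _ sg])
  then show ?thesis by (simp add: holds_def)
qed

text \<open>The value of a closed term as a fraction \<open>(a - b) / d\<close> of natural numbers.\<close>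

primrec fraction :: "trm \<Rightarrow> nat \<times> nat \<times> nat" where
  "fraction (Var x) = (0, 0, 1)"
| "fraction (Const c) = (nat (fst (quotient_of c)), nat (- fst (quotient_of c)), nat (snd (quotient_of c)))"
| "fraction (Plus \<theta> \<eta>) = (case fraction \<theta> of (a, b, d) \<Rightarrow> case fraction \<eta> of (a', b', d') \<Rightarrow>
     (a * d' + a' * d, b * d' + b' * d, d * d'))"
| "fraction (Times \<theta> \<eta>) = (case fraction \<theta> of (a, b, d) \<Rightarrow> case fraction \<eta> of (a', b', d') \<Rightarrow>
     (a * a' + b * b', a * b' + b * a', d * d'))"

definition closed_sign :: "trm \<Rightarrow> nat" where
  "closed_sign \<theta> = (case fraction \<theta> of (a, b, d) \<Rightarrow> if a = b then 0 else if b < a then 1 else 2)"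

lemma fraction_correct:
  "fraction \<theta> = (a, b, d) \<Longrightarrow> tval \<theta> (\<lambda>_. 0) = (real a - real b) / real d \<and> d > 0"
proof (induction \<theta> arbitrary: a b d)
  case (Const c)
  obtain n m where q: "quotient_of c = (n, m)" by fastforce
  have "c = of_int n / of_int m" by (rule quotient_of_div[OF q])
  then have c: "(of_rat c :: real) = of_int n / of_int m" by (simp add: of_rat_divide)
  show ?case using Const quotient_of_denom_pos[OF q] by (auto simp: q c)
next
  case (Plus \<theta> \<eta>)
  obtain a1 b1 d1 a2 b2 d2 where f: "fraction \<theta> = (a1, b1, d1)" "fraction \<eta> = (a2, b2, d2)"
    by (metis prod.exhaust)
  then show ?case using Plus.IH(1)[OF f(1)] Plus.IH(2)[OF f(2)] Plus.prems by (auto simp: field_simps)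
next
  case (Times \<theta> \<eta>)
  obtain a1 b1 d1 a2 b2 d2 where f: "fraction \<theta> = (a1, b1, d1)" "fraction \<eta> = (a2, b2, d2)"
    by (metis prod.exhaust)
  then show ?case using Times.IH(1)[OF f(1)] Times.IH(2)[OF f(2)] Times.prems by (auto simp: field_simps)
qed auto

lemma closed_sign_correct: "closed_sign \<theta> = sg (tval \<theta> (\<lambda>_. 0))"
proof -
  obtain a b d where f: "fraction \<theta> = (a, b, d)" by (metis prod.exhaust)
  then show ?thesis
    using fraction_correct[OF f] by (auto simp: closed_sign_def sg_def field_simps)
qed

primrec qe :: "fml \<Rightarrow> table" where
  "qe (Geq \<theta> \<eta>) = ([Plus \<theta> (Times (Const (- 1)) \<eta>)], [[0], [1]])"
| "qe (Neg P) = table_neg (qe P)"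
| "qe (Conj P Q) = table_conj (qe P) (qe Q)"
| "qe (Forall x P) = table_neg (table_ex x (table_neg (qe P)))"
| "qe (Box \<alpha> P) = ([], [])"
| "qe (Refines \<alpha> \<beta>) = ([], [])"

lemma proper_qe: "proper (qe P)"
proof (induction P rule: fml.induct[where ?P2.0 = "\<lambda>_. True"])
qed (simp_all add: proper_neg proper_conj, simp_all add: proper_def)

lemma holds_qe: "arith V P \<Longrightarrow> holds (qe P) \<nu> \<longleftrightarrow> sat P \<nu>"
proof (induction P arbitrary: \<nu> rule: fml.induct[where ?P2.0 = "\<lambda>_. True"])
  case (Geq \<theta> \<eta>)
  show ?case by (auto simp: holds_def signs_def sg_def of_rat_minus)
qed (auto simp: holds_neg holds_ex holds_conj proper_qe)

text \<open>The final table is evaluated in the state that is 0 everywhere, so nothing has to be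
  shown about the variables of its terms: the existential closure makes its truth independent of the
  listed variables, and the others do not occur in \<open>fst T\<close>.\<close>

definition valid_arith :: "fml \<Rightarrow> bool" where
  "valid_arith P = (let T = qe P;
     T' = fold table_ex (concat (map var_list (fst T))) (table_neg T)
     in map closed_sign (fst T') \<notin> set (snd T'))"

lemma holds_fold_ex:
  "holds (fold table_ex xs T) \<nu> \<longleftrightarrow> (\<exists>\<omega>. (\<forall>y. y \<notin> set xs \<longrightarrow> \<omega> y = \<nu> y) \<and> holds T \<omega>)"
proof (induction xs arbitrary: T)
  case Nil
  have "(\<forall>y. \<omega> y = \<nu> y) \<longleftrightarrow> \<omega> = \<nu>" for \<omega> by auto
  then show ?case by simp
next
  case (Cons x xs)
  have "holds (fold table_ex (x # xs) T) \<nu> \<longleftrightarrow>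
    (\<exists>\<omega> a. (\<forall>y. y \<notin> set xs \<longrightarrow> \<omega> y = \<nu> y) \<and> holds T (\<omega>(x := a)))"
    by (simp add: Cons.IH holds_ex)
  also have "\<dots> \<longleftrightarrow> (\<exists>\<omega>. (\<forall>y. y \<notin> set (x # xs) \<longrightarrow> \<omega> y = \<nu> y) \<and> holds T \<omega>)"
  proof
    assume "\<exists>\<omega> a. (\<forall>y. y \<notin> set xs \<longrightarrow> \<omega> y = \<nu> y) \<and> holds T (\<omega>(x := a))"
    then obtain \<omega> a where "\<forall>y. y \<notin> set xs \<longrightarrow> \<omega> y = \<nu> y" "holds T (\<omega>(x := a))" by blast
    then show "\<exists>\<omega>. (\<forall>y. y \<notin> set (x # xs) \<longrightarrow> \<omega> y = \<nu> y) \<and> holds T \<omega>"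
      by (intro exI[of _ "\<omega>(x := a)"]) simp
  next
    assume "\<exists>\<omega>. (\<forall>y. y \<notin> set (x # xs) \<longrightarrow> \<omega> y = \<nu> y) \<and> holds T \<omega>"
    then obtain \<omega> where \<omega>: "\<forall>y. y \<notin> set (x # xs) \<longrightarrow> \<omega> y = \<nu> y" "holds T \<omega>" by blast
    have "(\<omega>(x := \<nu> x))(x := \<omega> x) = \<omega>" by simp
    then show "\<exists>\<omega> a. (\<forall>y. y \<notin> set xs \<longrightarrow> \<omega> y = \<nu> y) \<and> holds T (\<omega>(x := a))"
      using \<omega> by (intro exI[of _ "\<omega>(x := \<nu> x)"] exI[of _ "\<omega> x"]) auto
  qed
  finally show ?case .
qed

lemma valid_arith_correct:
  assumes "arith V P" shows "valid_arith P \<longleftrightarrow> valid P"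
proof -
  define T where "T = qe P"
  define xs where "xs = concat (map var_list (fst T))"
  define T' where "T' = fold table_ex xs (table_neg T)"
  have xs: "set xs = pvars (fst T)" by (simp add: xs_def pvars_def set_var_list)
  have "closed_sign = (\<lambda>\<theta>. sg (tval \<theta> (\<lambda>_. 0)))" using closed_sign_correct by blast
  then have "valid_arith P \<longleftrightarrow> \<not> holds T' (\<lambda>_. 0)"
    by (simp add: valid_arith_def Let_def T_def[symmetric] xs_def[symmetric] T'_def[symmetric] holds_def
        signs_def)
  also have "\<dots> \<longleftrightarrow> (\<forall>\<nu>. holds T \<nu>)"
  proof
    assume *: "\<not> holds T' (\<lambda>_. 0)"
    show "\<forall>\<nu>. holds T \<nu>"
    proof
      fix \<nu>
      have "holds T (\<lambda>y. if y \<in> set xs then \<nu> y else 0)"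
        using *[unfolded T'_def holds_fold_ex holds_neg] by (metis (mono_tags, lifting))
      then show "holds T \<nu>" using holds_cong[of T \<nu> "\<lambda>y. if y \<in> set xs then \<nu> y else 0"] by (simp add: xs)
    qed
  qed (auto simp: T'_def holds_fold_ex holds_neg)
  finally show ?thesis using holds_qe[OF assms] by (simp add: valid_def T_def)
qed


section \<open>Computability of quantifier elimination\<close>

subsection \<open>Syntax trees\<close>

lemma computable_enc_iff: "computable f \<longleftrightarrow> computable (\<lambda>x. enc (f x))"
  by (simp add: computable_def enc_nat_def)

lemma enc_trm [simp]:
  "enc (Var x) = prod_encode (0, enc x)"
  "enc (Const c) = prod_encode (1, enc c)"
  "enc (Plus \<theta> \<eta>) = prod_encode (2, prod_encode (enc \<theta>, enc \<eta>))"
  "enc (Times \<theta> \<eta>) = prod_encode (3, prod_encode (enc \<theta>, enc \<eta>))"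
  by (simp_all add: enc_trm_def enc_var_def enc_rat_def)

lemma enc_fml [simp]:
  "enc (Geq \<theta> \<eta>) = prod_encode (0, prod_encode (enc \<theta>, enc \<eta>))"
  "enc (Neg P) = prod_encode (1, enc P)"
  "enc (Conj P Q) = prod_encode (2, prod_encode (enc P, enc Q))"
  "enc (Forall x P) = prod_encode (3, prod_encode (enc x, enc P))"
  "enc (Box \<alpha> P) = prod_encode (4, prod_encode (enc \<alpha>, enc P))"
  "enc (Refines \<alpha> \<beta>) = prod_encode (5, prod_encode (enc \<alpha>, enc \<beta>))"
  by (simp_all add: enc_fml_def enc_trm_def enc_var_def enc_prog_def)

lemma enc_prog [simp]:
  "enc (Test P) = prod_encode (0, enc P)"
  "enc (Assign x \<theta>) = prod_encode (1, prod_encode (enc x, enc \<theta>))"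
  "enc (AssignAny x) = prod_encode (2, enc x)"
  "enc (ODE xs P) = prod_encode (3, prod_encode (enc xs, enc P))"
  "enc (Choice \<alpha> \<beta>) = prod_encode (4, prod_encode (enc \<alpha>, enc \<beta>))"
  "enc (Seq \<alpha> \<beta>) = prod_encode (5, prod_encode (enc \<alpha>, enc \<beta>))"
  "enc (Loop \<alpha>) = prod_encode (6, enc \<alpha>)"
proof -
  have "(\<lambda>(x, \<theta>). prod_encode (var_code x, trm_code \<theta>)) = enc"
    by (auto simp: fun_eq_iff enc_prod_def enc_var_def enc_trm_def)
  then show "enc (ODE xs P) = prod_encode (3, prod_encode (enc xs, enc P))"
    by (simp add: enc_fml_def enc_prog_def ode_code_def enc_list_def)
qed (simp_all add: enc_fml_def enc_trm_def enc_var_def enc_prog_def)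

lemma computable_constructors [computable_intros]:
  "computable a \<Longrightarrow> computable (\<lambda>e. Var (a e))"
  "computable c \<Longrightarrow> computable (\<lambda>e. Const (c e))"
  "computable s \<Longrightarrow> computable t \<Longrightarrow> computable (\<lambda>e. Plus (s e) (t e))"
  "computable s \<Longrightarrow> computable t \<Longrightarrow> computable (\<lambda>e. Times (s e) (t e))"
  "computable s \<Longrightarrow> computable t \<Longrightarrow> computable (\<lambda>e. Geq (s e) (t e))"
  "computable P \<Longrightarrow> computable (\<lambda>e. Neg (P e))"
  "computable P \<Longrightarrow> computable Q \<Longrightarrow> computable (\<lambda>e. Conj (P e) (Q e))"
  "computable a \<Longrightarrow> computable P \<Longrightarrow> computable (\<lambda>e. Forall (a e) (P e))"
  "computable P \<Longrightarrow> computable (\<lambda>e. Test (P e))"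
  "computable a \<Longrightarrow> computable s \<Longrightarrow> computable (\<lambda>e. Assign (a e) (s e))"
  "computable a \<Longrightarrow> computable (\<lambda>e. AssignAny (a e))"
  by (subst computable_enc_iff, simp, intro computable_intros; assumption)+

lemma computable_Diff [computable_intros]: "computable a \<Longrightarrow> computable (\<lambda>e. Diff (a e))"
proof -
  assume "computable a"
  then have "computable (\<lambda>e. prod_encode (1, enc (a e)))" by (intro computable_intros)
  then show ?thesis by (subst computable_enc_iff) (simp add: enc_var_def)
qed

lemma computable_trm_recursion:
  fixes F :: "'e::enc \<Rightarrow> trm \<Rightarrow> 'r::enc"
  assumes v: "computable (\<lambda>p. v (fst p) (snd p))" and c: "computable (\<lambda>p. c (fst p) (snd p))"
    and p: "computable (\<lambda>p. pl (fst p) (fst (snd p)) (snd (snd p)))"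
    and t: "computable (\<lambda>p. tm (fst p) (fst (snd p)) (snd (snd p)))"
    and F: "\<And>e x. F e (Var x) = v e x" "\<And>e k. F e (Const k) = c e k"
      "\<And>e \<theta> \<eta>. F e (Plus \<theta> \<eta>) = pl e (F e \<theta>) (F e \<eta>)"
      "\<And>e \<theta> \<eta>. F e (Times \<theta> \<eta>) = tm e (F e \<theta>) (F e \<eta>)"
    and a: "computable a" and b: "computable b"
  shows "computable (\<lambda>x. F (a x) (b x))"
proof -
  obtain gv where gv: "computable gv" "\<And>x. gv (enc x) = enc (v (fst x) (snd x))"
    using computable_realizer[OF v] by blast
  obtain gc where gc: "computable gc" "\<And>x. gc (enc x) = enc (c (fst x) (snd x))"
    using computable_realizer[OF c] by blast
  obtain gp where gp: "computable gp" "\<And>x. gp (enc x) = enc (pl (fst x) (fst (snd x)) (snd (snd x)))"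
    using computable_realizer[OF p] by blast
  obtain gt where gt: "computable gt" "\<And>x. gt (enc x) = enc (tm (fst x) (fst (snd x)) (snd (snd x)))"
    using computable_realizer[OF t] by blast
  define S where "S e tag body r r1 r2 =
    (if tag = 0 then gv (prod_encode (enc e, body))
     else if tag = 1 then gc (prod_encode (enc e, body))
     else if tag = 2 then gp (prod_encode (enc e, prod_encode (r1, r2)))
     else gt (prod_encode (enc e, prod_encode (r1, r2))))" for e :: 'e and tag body r r1 r2 :: nat
  have "computable (\<lambda>(e, tag, body, r, r1, r2). S e tag body r r1 r2)"
    unfolding S_def by (intro computable_intros computable_compose[OF gv(1)] computable_compose[OF gc(1)] computable_compose[OF gp(1)] computable_compose[OF gt(1)])
  then obtain G where G: "computable (\<lambda>(e, n). G e n)"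
    "\<And>e body. \<exists>r r1 r2. G e (prod_encode (0, body)) = S e 0 body r r1 r2"
    "\<And>e tag body. tag > 0 \<Longrightarrow> G e (prod_encode (tag, body)) =
       S e tag body (G e body) (G e (fst (prod_decode body))) (G e (snd (prod_decode body)))"
    using computable_code_recursion by blast
  have "G e (enc \<theta>) = enc (F e \<theta>)" for e \<theta>
  proof (induction \<theta>)
    case (Var x)
    then show ?case using G(2)[of e "enc x"] gv(2)[of "(e, x)"] by (auto simp: S_def F enc_Pair)
  next
    case (Const k)
    then show ?case using gc(2)[of "(e, k)"] by (auto simp: S_def F enc_Pair G(3))
  next
    case (Plus \<theta> \<eta>)
    then show ?case using gp(2)[of "(e, F e \<theta>, F e \<eta>)"] by (auto simp: S_def F enc_Pair G(3))
  next
    case (Times \<theta> \<eta>)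
    then show ?case using gt(2)[of "(e, F e \<theta>, F e \<eta>)"] by (auto simp: S_def F enc_Pair G(3))
  qed
  from computable_of_codes[OF G(1) this] have "computable (\<lambda>(e, t). F e t)" .
  from computable_compose[OF this computable_Pair[OF a b]] show ?thesis by simp
qed

text \<open>\<open>Box\<close> and \<open>Refines\<close>, which arithmetic formulas exclude, share
  the default value \<open>d\<close>.\<close>

lemma computable_fml_recursion:
  fixes F :: "'e::enc \<Rightarrow> fml \<Rightarrow> 'r::enc"
  assumes g: "computable (\<lambda>p. g (fst p) (fst (snd p)) (snd (snd p)))"
    and n: "computable (\<lambda>p. n (fst p) (snd p))"
    and c: "computable (\<lambda>p. c (fst p) (fst (snd p)) (snd (snd p)))"
    and f: "computable (\<lambda>p. f (fst p) (fst (snd p)) (snd (snd p)))"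
    and F: "\<And>e \<theta> \<eta>. F e (Geq \<theta> \<eta>) = g e \<theta> \<eta>" "\<And>e P. F e (Neg P) = n e (F e P)"
      "\<And>e P Q. F e (Conj P Q) = c e (F e P) (F e Q)" "\<And>e x P. F e (Forall x P) = f e x (F e P)"
      "\<And>e \<alpha> P. F e (Box \<alpha> P) = d" "\<And>e \<alpha> \<beta>. F e (Refines \<alpha> \<beta>) = d"
    and a: "computable a" and b: "computable b"
  shows "computable (\<lambda>x. F (a x) (b x))"
proof -
  obtain gg where gg: "computable gg" "\<And>x. gg (enc x) = enc (g (fst x) (fst (snd x)) (snd (snd x)))"
    using computable_realizer[OF g] by blast
  obtain gn where gn: "computable gn" "\<And>x. gn (enc x) = enc (n (fst x) (snd x))"
    using computable_realizer[OF n] by blast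
  obtain gc where gc: "computable gc" "\<And>x. gc (enc x) = enc (c (fst x) (fst (snd x)) (snd (snd x)))"
    using computable_realizer[OF c] by blast
  obtain gf where gf: "computable gf" "\<And>x. gf (enc x) = enc (f (fst x) (fst (snd x)) (snd (snd x)))"
    using computable_realizer[OF f] by blast
  define S where "S e tag body r r1 r2 =
    (if tag = 0 then gg (prod_encode (enc e, body))
     else if tag = 1 then gn (prod_encode (enc e, r))
     else if tag = 2 then gc (prod_encode (enc e, prod_encode (r1, r2)))
     else if tag = 3 then gf (prod_encode (enc e, prod_encode (fst (prod_decode body), r2)))
     else enc d)" for e :: 'e and tag body r r1 r2 :: nat
  have "computable (\<lambda>(e, tag, body, r, r1, r2). S e tag body r r1 r2)"
    unfolding S_def by (intro computable_intros computable_compose[OF gg(1)] computable_compose[OF gn(1)] computable_compose[OF gc(1)] computable_compose[OF gf(1)])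
  then obtain G where G: "computable (\<lambda>(e, n). G e n)"
    "\<And>e body. \<exists>r r1 r2. G e (prod_encode (0, body)) = S e 0 body r r1 r2"
    "\<And>e tag body. tag > 0 \<Longrightarrow> G e (prod_encode (tag, body)) =
       S e tag body (G e body) (G e (fst (prod_decode body))) (G e (snd (prod_decode body)))"
    using computable_code_recursion by blast
  have "G e (enc P) = enc (F e P)" for e P
  proof (induction P rule: fml.induct[where ?P2.0 = "\<lambda>_. True"])
    case (Geq \<theta> \<eta>)
    then show ?case using G(2)[of e "prod_encode (enc \<theta>, enc \<eta>)"] gg(2)[of "(e, \<theta>, \<eta>)"]
      by (auto simp: S_def F enc_Pair)
  next
    case (Neg P)
    then show ?case using gn(2)[of "(e, F e P)"] by (auto simp: S_def F enc_Pair G(3))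
  next
    case (Conj P Q)
    then show ?case using gc(2)[of "(e, F e P, F e Q)"] by (auto simp: S_def F enc_Pair G(3))
  next
    case (Forall x P)
    then show ?case using gf(2)[of "(e, x, F e P)"] by (auto simp: S_def F enc_Pair G(3))
  qed (auto simp: S_def F G(3))
  from computable_of_codes[OF G(1) this] have "computable (\<lambda>(e, t). F e t)" .
  from computable_compose[OF this computable_Pair[OF a b]] show ?thesis by simp
qed

text \<open>The clause for \<open>Seq\<close> also receives the subprograms themselves, because
  \<open>seq_parts\<close> returns them.\<close>

lemma computable_prog_recursion:
  fixes F :: "'e::enc \<Rightarrow> prog \<Rightarrow> 'r::enc"
  assumes t: "computable (\<lambda>p. t (fst p) (snd p))"
    and g: "computable (\<lambda>p. g (fst p) (fst (snd p)) (snd (snd p)))"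
    and n: "computable (\<lambda>p. n (fst p) (snd p))"
    and o: "computable (\<lambda>p. od (fst p) (fst (snd p)) (snd (snd p)))"
    and c: "computable (\<lambda>p. c (fst p) (fst (snd p)) (snd (snd p)))"
    and s: "computable (\<lambda>p. s (fst p) (fst (snd p)) (fst (snd (snd p))) (fst (snd (snd (snd p)))) (snd (snd (snd (snd p)))))"
    and F: "\<And>e P. F e (Test P) = t e P" "\<And>e x \<theta>. F e (Assign x \<theta>) = g e x \<theta>"
      "\<And>e x. F e (AssignAny x) = n e x" "\<And>e xs P. F e (ODE xs P) = od e xs P"
      "\<And>e \<alpha> \<beta>. F e (Choice \<alpha> \<beta>) = c e (F e \<alpha>) (F e \<beta>)"
      "\<And>e \<alpha> \<beta>. F e (Seq \<alpha> \<beta>) = s e \<alpha> \<beta> (F e \<alpha>) (F e \<beta>)"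
      "\<And>e \<alpha>. F e (Loop \<alpha>) = d"
    and a: "computable a" and b: "computable b"
  shows "computable (\<lambda>x. F (a x) (b x))"
proof -
  obtain gt where gt: "computable gt" "\<And>x. gt (enc x) = enc (t (fst x) (snd x))"
    using computable_realizer[OF t] by blast
  obtain gg where gg: "computable gg" "\<And>x. gg (enc x) = enc (g (fst x) (fst (snd x)) (snd (snd x)))"
    using computable_realizer[OF g] by blast
  obtain gn where gn: "computable gn" "\<And>x. gn (enc x) = enc (n (fst x) (snd x))"
    using computable_realizer[OF n] by blast
  obtain go where go: "computable go" "\<And>x. go (enc x) = enc (od (fst x) (fst (snd x)) (snd (snd x)))"
    using computable_realizer[OF o] by blast
  obtain gc where gc: "computable gc" "\<And>x. gc (enc x) = enc (c (fst x) (fst (snd x)) (snd (snd x)))"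
    using computable_realizer[OF c] by blast
  obtain gs where gs: "computable gs" "\<And>x. gs (enc x) = enc (s (fst x) (fst (snd x)) (fst (snd (snd x))) (fst (snd (snd (snd x)))) (snd (snd (snd (snd x)))))"
    using computable_realizer[OF s] by blast
  define S where "S e tag body r r1 r2 =
    (if tag = 0 then gt (prod_encode (enc e, body))
     else if tag = 1 then gg (prod_encode (enc e, body))
     else if tag = 2 then gn (prod_encode (enc e, body))
     else if tag = 3 then go (prod_encode (enc e, body))
     else if tag = 4 then gc (prod_encode (enc e, prod_encode (r1, r2)))
     else if tag = 5 then gs (prod_encode (enc e, prod_encode (fst (prod_decode body),
       prod_encode (snd (prod_decode body), prod_encode (r1, r2)))))
     else enc d)" for e :: 'e and tag body r r1 r2 :: nat
  have "computable (\<lambda>(e, tag, body, r, r1, r2). S e tag body r r1 r2)"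
    unfolding S_def by (intro computable_intros computable_compose[OF gt(1)] computable_compose[OF gg(1)] computable_compose[OF gn(1)] computable_compose[OF go(1)] computable_compose[OF gc(1)] computable_compose[OF gs(1)])
  then obtain G where G: "computable (\<lambda>(e, n). G e n)"
    "\<And>e body. \<exists>r r1 r2. G e (prod_encode (0, body)) = S e 0 body r r1 r2"
    "\<And>e tag body. tag > 0 \<Longrightarrow> G e (prod_encode (tag, body)) =
       S e tag body (G e body) (G e (fst (prod_decode body))) (G e (snd (prod_decode body)))"
    using computable_code_recursion by blast
  have "G e (enc \<alpha>) = enc (F e \<alpha>)" for e \<alpha>
  proof (induction \<alpha> rule: prog.induct[where ?P1.0 = "\<lambda>_. True"])
    case (Test P)
    then show ?case using G(2)[of e "enc P"] gt(2)[of "(e, P)"] by (auto simp: S_def F enc_Pair)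
  next
    case (Assign x \<theta>)
    then show ?case using gg(2)[of "(e, x, \<theta>)"] by (auto simp: S_def F enc_Pair G(3))
  next
    case (AssignAny x)
    then show ?case using gn(2)[of "(e, x)"] by (auto simp: S_def F enc_Pair G(3))
  next
    case (ODE xs P)
    then show ?case using go(2)[of "(e, xs, P)"] by (auto simp: S_def F enc_Pair G(3))
  next
    case (Choice \<alpha> \<beta>)
    then show ?case using gc(2)[of "(e, F e \<alpha>, F e \<beta>)"] by (auto simp: S_def F enc_Pair G(3))
  next
    case (Seq \<alpha> \<beta>)
    then show ?case using gs(2)[of "(e, \<alpha>, \<beta>, F e \<alpha>, F e \<beta>)"] by (auto simp: S_def F enc_Pair G(3))
  qed (auto simp: S_def F G(3))
  from computable_of_codes[OF G(1) this] have "computable (\<lambda>(e, t). F e t)" .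
  from computable_compose[OF this computable_Pair[OF a b]] show ?thesis by simp
qed


subsection \<open>Arithmetic of coefficients\<close>

text \<open>Serves to decode \<open>int_encode\<close>, which sends nonnegative integers to even and
  negative ones to odd numbers.\<close>

lemma computable_parity_half:
  fixes f :: "'e::enc \<Rightarrow> nat"
  assumes "computable f"
  shows "computable (\<lambda>e. odd (f e))" and "computable (\<lambda>e. f e div 2)"
proof -
  have eq: "((\<lambda>p. (\<not> fst p, if fst p then Suc (snd p) else snd p)) ^^ k) (False, 0) = (odd k, k div 2)" for k
    by (induction k) auto
  have "computable (\<lambda>e. ((\<lambda>p. (\<not> fst p, if fst p then Suc (snd p) else snd p)) ^^ f e) (False, 0))"
    by (intro computable_intros assms)
  then have "computable (\<lambda>e. (odd (f e), f e div 2))" by (simp only: eq)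
  from computable_fst[OF this] computable_snd[OF this]
  show "computable (\<lambda>e. odd (f e))" and "computable (\<lambda>e. f e div 2)" by simp_all
qed

declare computable_parity_half [computable_intros]

lemma computable_of_nat_rat [computable_intros]:
  assumes "computable f" shows "computable (\<lambda>e. of_nat (f e) :: rat)"
proof -
  \<comment> \<open>Numerator \<open>n\<close> and denominator 1 have the integer codes
    \<open>2 * n\<close> and 2.\<close>
  have "computable (\<lambda>e. prod_encode (2 * f e, 2))" by (intro computable_intros assms)
  moreover have "quotient_of (of_nat n) = (int n, 1)" for n
    using quotient_of_int[of "int n"] by simp
  then have "enc (of_nat n :: rat) = prod_encode (2 * n, 2)" for n
    by (simp add: enc_rat_def rat_code_def int_encode_def sum_encode_def)
  ultimately show ?thesis by (subst computable_enc_iff) simp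
qed

lemma computable_butlast [computable_intros]:
  assumes "computable xs" shows "computable (\<lambda>e. butlast (xs e))"
proof -
  have "computable (\<lambda>e. rev (case rev (xs e) of [] \<Rightarrow> [] | _ # ys \<Rightarrow> ys))"
    by (intro computable_intros assms)
  moreover have "rev (case rev xs of [] \<Rightarrow> [] | _ # ys \<Rightarrow> ys) = butlast xs" for xs :: "'b list"
    by (cases xs rule: rev_cases) auto
  ultimately show ?thesis by simp
qed

lemma computable_lc [computable_intros]: "computable p \<Longrightarrow> computable (\<lambda>e. lc (p e))"
  unfolding lc_def by (intro computable_intros)

lemma computable_padd [computable_intros]:
  "computable p \<Longrightarrow> computable q \<Longrightarrow> computable (\<lambda>e. padd (p e) (q e))"
  by (rule computable_compose2[of padd], unfold padd_def, intro computable_intros)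

lemma computable_pmult [computable_intros]:
  "computable p \<Longrightarrow> computable q \<Longrightarrow> computable (\<lambda>e. pmult (p e) (q e))"
  by (rule computable_compose2[of pmult], unfold pmult_def, intro computable_intros)

lemma computable_topoly [computable_intros]:
  "computable x \<Longrightarrow> computable \<theta> \<Longrightarrow> computable (\<lambda>e. topoly (x e) (\<theta> e))"
  by (rule computable_trm_recursion[where F = topoly
        and v = "\<lambda>x y. if y = x then [Const 0, Const 1] else [Var y]" and c = "\<lambda>x c. [Const c]"
        and pl = "\<lambda>x. padd" and tm = "\<lambda>x. pmult"]) (simp; fail | intro computable_intros; assumption?)+

lemma computable_deriv [computable_intros]: "computable p \<Longrightarrow> computable (\<lambda>e. deriv (p e))"
  by (rule computable_compose[of deriv], unfold deriv_def, intro computable_intros)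

lemma computable_prem_step [computable_intros]:
  "computable p \<Longrightarrow> computable q \<Longrightarrow> computable (\<lambda>e. prem_step (p e) (q e))"
  by (rule computable_compose2[of prem_step], unfold prem_step_def, intro computable_intros)

lemma computable_prem [computable_intros]:
  "computable p \<Longrightarrow> computable q \<Longrightarrow> computable (\<lambda>e. prem (p e) (q e))"
  by (rule computable_compose2[of prem], unfold prem_def, intro computable_intros)

lemma computable_poly_ops [computable_intros]: "computable S \<Longrightarrow> computable (\<lambda>e. poly_ops (S e))"
  by (rule computable_compose[of poly_ops], unfold poly_ops_def, intro computable_intros)

lemma computable_poly_closure [computable_intros]:
  "computable S \<Longrightarrow> computable (\<lambda>e. poly_closure (S e))"
  by (rule computable_compose[of poly_closure], unfold poly_closure_def, intro computable_intros)


subsection \<open>Diagrams and tables\<close>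

lemma computable_look [computable_intros]:
  "computable v \<Longrightarrow> computable p \<Longrightarrow> computable (\<lambda>e. look (v e) (p e))"
  by (rule computable_compose2[of look], unfold look_def, intro computable_intros)

lemma computable_point_sign [computable_intros]:
  "computable p \<Longrightarrow> computable v \<Longrightarrow> computable (\<lambda>e. point_sign (p e) (v e))"
  by (rule computable_compose2[of point_sign], unfold point_sign_def, intro computable_intros)

lemma computable_split_cell [computable_intros]:
  assumes "computable p" "computable s" "computable t" "computable v"
  shows "computable (\<lambda>e. split_cell (p e) (s e) (t e) (v e))"
  unfolding split_cell_def opp_def by (intro computable_intros assms)

lemma computable_insert_right [computable_intros]:
  "computable p \<Longrightarrow> computable t \<Longrightarrow> computable ps \<Longrightarrow> computable (\<lambda>e. insert_right (p e) (t e) (ps e))"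
  by (rule computable_compose3[of insert_right], unfold insert_right_def Let_def, intro computable_intros)

lemma computable_add_poly [computable_intros]:
  "computable p \<Longrightarrow> computable D \<Longrightarrow> computable (\<lambda>e. add_poly (p e) (D e))"
  by (rule computable_compose2[of add_poly], unfold add_poly_def Let_def neg_sign_def, intro computable_intros)

lemma computable_sign_diagram [computable_intros]:
  "computable M \<Longrightarrow> computable v \<Longrightarrow> computable (\<lambda>e. sign_diagram (M e) (v e))"
  by (rule computable_compose2[of sign_diagram], unfold sign_diagram_def, intro computable_intros)

lemma computable_columns [computable_intros]: "computable D \<Longrightarrow> computable (\<lambda>e. columns (D e))"
  by (rule computable_compose[of columns], unfold columns_def, intro computable_intros)

lemma computable_sign_vectors [computable_intros]: "computable n \<Longrightarrow> computable (\<lambda>e. sign_vectors (n e))"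
  by (rule computable_compose[of sign_vectors], unfold sign_vectors_def, intro computable_intros)

lemma computable_zip [computable_intros]:
  assumes "computable xs" "computable ys" shows "computable (\<lambda>e. zip (xs e) (ys e))"
proof -
  define step where "step x acc = (case snd acc of [] \<Rightarrow> acc | y # ys \<Rightarrow> ((x, y) # fst acc, ys))"
    for x :: 'b and acc :: "('b \<times> 'c) list \<times> 'c list"
  have eq: "fst (fold step xs (zs, ys)) = rev (zip xs ys) @ zs" for xs zs ys
    by (induction xs arbitrary: ys zs) (auto simp: step_def split: list.split)
  have "computable (\<lambda>e. rev (fst (fold step (xs e) ([], ys e))))"
    unfolding step_def by (intro computable_intros assms)
  then show ?thesis by (simp add: eq)
qed

lemma computable_table_neg [computable_intros]: "computable T \<Longrightarrow> computable (\<lambda>e. table_neg (T e))"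
  by (rule computable_compose[of table_neg], unfold table_neg_def, intro computable_intros)

lemma computable_table_conj [computable_intros]:
  "computable T \<Longrightarrow> computable T' \<Longrightarrow> computable (\<lambda>e. table_conj (T e) (T' e))"
  by (rule computable_compose2[of table_conj], unfold table_conj_def, intro computable_intros)

lemma computable_table_ex [computable_intros]:
  "computable x \<Longrightarrow> computable T \<Longrightarrow> computable (\<lambda>e. table_ex (x e) (T e))"
  by (rule computable_compose2[of table_ex], unfold table_ex_def Let_def const_polys_def, intro computable_intros)

lemma computable_var_list [computable_intros]: "computable \<theta> \<Longrightarrow> computable (\<lambda>e. var_list (\<theta> e))"
  by (rule computable_trm_recursion[where F = "\<lambda>_::nat. var_list" and a = "\<lambda>_. 0"
        and v = "\<lambda>_ x. [x]" and c = "\<lambda>_ _. []" and pl = "\<lambda>_. (@)" and tm = "\<lambda>_. (@)"])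
    (simp; fail | intro computable_intros; assumption?)+

lemma computable_rat_parts [computable_intros]:
  assumes "computable c"
  shows "computable (\<lambda>e. nat (fst (quotient_of (c e))))"
    and "computable (\<lambda>e. nat (- fst (quotient_of (c e))))"
    and "computable (\<lambda>e. nat (snd (quotient_of (c e))))"
proof -
  have enc_rat: "enc r = prod_encode (int_encode (fst (quotient_of r)), int_encode (snd (quotient_of r)))" for r :: rat
    by (simp add: enc_rat_def rat_code_def map_prod_def case_prod_beta)
  have pos: "nat i = (if odd (int_encode i) then 0 else int_encode i div 2)" for i
    by (auto simp: int_encode_def sum_encode_def)
  have neg: "nat (- i) = (if odd (int_encode i) then Suc (int_encode i div 2) else 0)" for i
    by (auto simp: int_encode_def sum_encode_def)
  have enc: "int_encode (fst (quotient_of r)) = fst (prod_decode (enc r))"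
    "int_encode (snd (quotient_of r)) = snd (prod_decode (enc r))" for r :: rat
    by (simp_all add: enc_rat)
  have code: "computable (\<lambda>e. fst (prod_decode (enc (c e))))" "computable (\<lambda>e. snd (prod_decode (enc (c e))))"
    by (intro computable_intros assms)+
  show "computable (\<lambda>e. nat (fst (quotient_of (c e))))"
    unfolding pos enc by (intro computable_intros code)
  show "computable (\<lambda>e. nat (- fst (quotient_of (c e))))"
    unfolding neg enc by (intro computable_intros code)
  show "computable (\<lambda>e. nat (snd (quotient_of (c e))))"
    unfolding pos enc by (intro computable_intros code)
qed

lemma computable_fraction [computable_intros]: "computable \<theta> \<Longrightarrow> computable (\<lambda>e. fraction (\<theta> e))"
  by (rule computable_trm_recursion[where F = "\<lambda>_::nat. fraction" and a = "\<lambda>_. 0"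
        and v = "\<lambda>_ _. (0, 0, 1)"
        and c = "\<lambda>_ c. (nat (fst (quotient_of c)), nat (- fst (quotient_of c)), nat (snd (quotient_of c)))"
        and pl = "\<lambda>_ r r'. case r of (a, b, d) \<Rightarrow> case r' of (a', b', d') \<Rightarrow>
           (a * d' + a' * d, b * d' + b' * d, d * d')"
        and tm = "\<lambda>_ r r'. case r of (a, b, d) \<Rightarrow> case r' of (a', b', d') \<Rightarrow>
           (a * a' + b * b', a * b' + b * a', d * d')"])
    (simp; fail | intro computable_intros; assumption?)+

lemma computable_closed_sign [computable_intros]: "computable \<theta> \<Longrightarrow> computable (\<lambda>e. closed_sign (\<theta> e))"
  by (rule computable_compose[of closed_sign], unfold closed_sign_def, intro computable_intros)

lemma computable_qe [computable_intros]: "computable P \<Longrightarrow> computable (\<lambda>e. qe (P e))"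
  by (rule computable_fml_recursion[where F = "\<lambda>_::nat. qe" and a = "\<lambda>_. 0"
        and g = "\<lambda>_ \<theta> \<eta>. ([Plus \<theta> (Times (Const (- 1)) \<eta>)], [[0], [1]])" and n = "\<lambda>_. table_neg"
        and c = "\<lambda>_. table_conj" and f = "\<lambda>_ x T. table_neg (table_ex x (table_neg T))" and d = "([], [])"])
    (simp; fail | intro computable_intros; assumption?)+

lemma computable_valid_arith [computable_intros]: "computable P \<Longrightarrow> computable (\<lambda>e. valid_arith (P e))"
  by (rule computable_compose[of valid_arith], unfold valid_arith_def Let_def, intro computable_intros)


section \<open>Controllers as formulas\<close>

text \<open>A loop-free controller is a finite choice between sequences of atomic programs. The
  empty list is the default for \<open>ODE\<close> and \<open>Loop\<close>, which controllers
  exclude.\<close>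

primrec paths :: "prog \<Rightarrow> prog list list" where
  "paths (Test P) = [[Test P]]"
| "paths (Assign x \<theta>) = [[Assign x \<theta>]]"
| "paths (AssignAny x) = [[AssignAny x]]"
| "paths (ODE xs P) = []"
| "paths (Choice \<alpha> \<beta>) = paths \<alpha> @ paths \<beta>"
| "paths (Seq \<alpha> \<beta>) = concat (map (\<lambda>p. map ((@) p) (paths \<beta>)) (paths \<alpha>))"
| "paths (Loop \<alpha>) = []"

definition run :: "prog list \<Rightarrow> (state \<times> state) set" where
  "run p = foldr (\<lambda>\<alpha> r. reach \<alpha> O r) p Id"

lemma run_simps [simp]: "run [] = Id" "run (\<alpha> # p) = reach \<alpha> O run p"
  by (simp_all add: run_def)

lemma run_append: "run (p @ q) = run p O run q"
  by (induction p) auto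

lemma reach_paths: "controller U Y \<alpha> \<Longrightarrow> reach \<alpha> = (\<Union>p\<in>set (paths \<alpha>). run p)"
proof (induction \<alpha> rule: prog.induct[where ?P1.0 = "\<lambda>_. True"])
  case (Seq \<alpha> \<beta>)
  then show ?case by (auto simp: run_append)
qed auto

primrec atomic :: "prog \<Rightarrow> bool" where
  "atomic (Test P) \<longleftrightarrow> True"
| "atomic (Assign x \<theta>) \<longleftrightarrow> True"
| "atomic (AssignAny x) \<longleftrightarrow> True"
| "atomic (ODE xs P) \<longleftrightarrow> False"
| "atomic (Choice \<alpha> \<beta>) \<longleftrightarrow> False"
| "atomic (Seq \<alpha> \<beta>) \<longleftrightarrow> False"
| "atomic (Loop \<alpha>) \<longleftrightarrow> False"

lemma controller_paths:
  "controller U Y \<alpha> \<Longrightarrow> p \<in> set (paths \<alpha>) \<Longrightarrow> \<beta> \<in> set p \<Longrightarrow>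
     controller U Y \<beta> \<and> atomic \<beta>"
proof (induction \<alpha> arbitrary: p rule: prog.induct[where ?P1.0 = "\<lambda>_. True"])
qed auto

primrec assigned_var :: "prog \<Rightarrow> var list" where
  "assigned_var (Test P) = []"
| "assigned_var (Assign x \<theta>) = [x]"
| "assigned_var (AssignAny x) = [x]"
| "assigned_var (ODE xs P) = []"
| "assigned_var (Choice \<alpha> \<beta>) = []"
| "assigned_var (Seq \<alpha> \<beta>) = []"
| "assigned_var (Loop \<alpha>) = []"

definition assigned :: "prog \<Rightarrow> var list" where
  "assigned \<alpha> = concat (map (\<lambda>p. concat (map assigned_var p)) (paths \<alpha>))"

lemma assigned_subset:
  assumes "controller U Y \<alpha>" shows "set (assigned \<alpha>) \<subseteq> U"
proof
  fix x assume "x \<in> set (assigned \<alpha>)"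
  then obtain p \<beta> where "p \<in> set (paths \<alpha>)" "\<beta> \<in> set p" and x: "x \<in> set (assigned_var \<beta>)"
    by (auto simp: assigned_def)
  then have "controller U Y \<beta>" using controller_paths assms by blast
  then show "x \<in> U" using x by (cases \<beta>) auto
qed

lemma reach_unassigned:
  assumes "controller U Y \<alpha>" "(\<nu>, \<omega>) \<in> reach \<alpha>" "z \<notin> set (assigned \<alpha>)"
  shows "\<omega> z = \<nu> z"
proof -
  obtain p where p: "p \<in> set (paths \<alpha>)" "(\<nu>, \<omega>) \<in> run p" using reach_paths[OF assms(1)] assms(2) by auto
  have "\<forall>\<beta>\<in>set p. z \<notin> set (assigned_var \<beta>) \<and> atomic \<beta>"
  proof
    fix \<beta> assume "\<beta> \<in> set p"
    moreover from this have "atomic \<beta>" using controller_paths[OF assms(1) p(1)] by blast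
    ultimately show "z \<notin> set (assigned_var \<beta>) \<and> atomic \<beta>" using p(1) assms(3) by (auto simp: assigned_def)
  qed
  then show ?thesis using p(2)
  proof (induction p arbitrary: \<nu>)
    case (Cons \<beta> p)
    then obtain \<mu> where \<mu>: "(\<nu>, \<mu>) \<in> reach \<beta>" "(\<mu>, \<omega>) \<in> run p" by auto
    then have "\<omega> z = \<mu> z" using Cons by simp
    moreover have "\<mu> z = \<nu> z" using Cons.prems(1) \<mu>(1) by (cases \<beta>) auto
    ultimately show ?case by simp
  qed simp
qed

lemma arith_cong: "arith V P \<Longrightarrow> (\<And>x. x \<in> V \<Longrightarrow> \<nu> x = \<omega> x) \<Longrightarrow> sat P \<nu> \<longleftrightarrow> sat P \<omega>"
proof (induction P arbitrary: \<nu> \<omega> rule: fml.induct[where ?P2.0 = "\<lambda>_. True"])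
  case (Geq \<theta> \<eta>)
  then have "tval \<theta> \<nu> = tval \<theta> \<omega>" "tval \<eta> \<nu> = tval \<eta> \<omega>" by (auto intro!: tval_cong)
  then show ?case by simp
next
  case (Forall x P)
  have "sat P (\<nu>(x := a)) \<longleftrightarrow> sat P (\<omega>(x := a))" for a
    by (rule Forall.IH) (use Forall.prems in auto)
  then show ?case by simp
next
  case (Neg P)
  have "sat P \<nu> \<longleftrightarrow> sat P \<omega>" by (rule Neg.IH) (use Neg.prems in auto)
  then show ?case by simp
next
  case (Conj P Q)
  have "sat P \<nu> \<longleftrightarrow> sat P \<omega>" "sat Q \<nu> \<longleftrightarrow> sat Q \<omega>"
    by (rule Conj.IH; use Conj.prems in auto)+
  then show ?case by simp
qed simp_all

lemma arith_mono: "arith V P \<Longrightarrow> V \<subseteq> W \<Longrightarrow> arith W P"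
  by (induction P rule: fml.induct[where ?P2.0 = "\<lambda>_. True"]) auto

definition ov :: "var set \<Rightarrow> state \<Rightarrow> state \<Rightarrow> state" where
  "ov S \<delta> \<nu> = (\<lambda>z. if z \<in> S then \<delta> z else \<nu> z)"

text \<open>Controllers neither read nor write variables outside \<open>U \<union> Y\<close>, so
  overwriting these at both ends of a run gives a run. Used with differential symbols, to change
  their values, and with copies, to name a final state.\<close>

lemma controller_ov:
  assumes "controller U Y \<alpha>" "S \<inter> (U \<union> Y) = {}" "(\<nu>, \<omega>) \<in> reach \<alpha>"
  shows "(ov S \<delta> \<nu>, ov S \<delta> \<omega>) \<in> reach \<alpha>"
  using assms(1,3)
proof (induction \<alpha> arbitrary: \<nu> \<omega> rule: prog.induct[where ?P1.0 = "\<lambda>_. True"])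
  case (Test P)
  have "sat P (ov S \<delta> \<nu>) \<longleftrightarrow> sat P \<nu>"
    by (rule arith_cong) (use Test assms(2) in \<open>auto simp: ov_def\<close>)
  then show ?case using Test by auto
next
  case (Assign x \<theta>)
  have "tval \<theta> (ov S \<delta> \<nu>) = tval \<theta> \<nu>"
    by (rule tval_cong) (use Assign assms(2) in \<open>auto simp: ov_def\<close>)
  then show ?case using Assign assms(2) by (auto simp: ov_def fun_eq_iff)
next
  case (AssignAny x)
  then obtain a where "\<omega> = \<nu>(x := a)" by auto
  then have "ov S \<delta> \<omega> = (ov S \<delta> \<nu>)(x := a)" using AssignAny assms(2) by (auto simp: ov_def fun_eq_iff)
  then show ?case by (simp only: reach.simps mem_Collect_eq case_prod_conv) blast
next
  case (Seq \<alpha> \<beta>)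
  then show ?case by simp blast
qed auto

text \<open>Iterated differential symbols are fresh: controllers mention none and evolution domains
  only first-order ones of base variables.\<close>

abbreviation scratch :: var where
  "scratch \<equiv> Diff (Diff (Diff (Base 0)))"

abbreviation copy :: "var \<Rightarrow> var" where
  "copy x \<equiv> Diff (Diff x)"

section \<open>Expressing the runs of a controller by formulas of real arithmetic\<close>

definition Exists :: "var \<Rightarrow> fml \<Rightarrow> fml" where
  "Exists x P = Neg (Forall x (Neg P))"

definition Disj :: "fml \<Rightarrow> fml \<Rightarrow> fml" where
  "Disj P Q = Neg (Conj (Neg P) (Neg Q))"

definition Conjs :: "fml list \<Rightarrow> fml" where
  "Conjs Ps = foldr Conj Ps Truth"

lemma sat_connectives [simp]:
  "sat Truth \<nu>" "sat (Equal \<theta> \<eta>) \<nu> \<longleftrightarrow> tval \<theta> \<nu> = tval \<eta> \<nu>"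
  "sat (Exists x P) \<nu> \<longleftrightarrow> (\<exists>a. sat P (\<nu>(x := a)))" "sat (Disj P Q) \<nu> \<longleftrightarrow> sat P \<nu> \<or> sat Q \<nu>"
  "sat (Conjs Ps) \<nu> \<longleftrightarrow> (\<forall>P\<in>set Ps. sat P \<nu>)"
proof -
  show "sat (Conjs Ps) \<nu> \<longleftrightarrow> (\<forall>P\<in>set Ps. sat P \<nu>)"
    by (induction Ps) (auto simp: Conjs_def Truth_def)
qed (auto simp: Truth_def Equal_def Exists_def Disj_def)

lemma arith_connectives [simp]:
  "arith UNIV Truth" "arith UNIV (Equal \<theta> \<eta>)" "arith UNIV (Exists x P) \<longleftrightarrow> arith UNIV P"
  "arith UNIV (Disj P Q) \<longleftrightarrow> arith UNIV P \<and> arith UNIV Q"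
  "arith UNIV (Conjs Ps) \<longleftrightarrow> (\<forall>P\<in>set Ps. arith UNIV P)"
proof -
  show "arith UNIV (Conjs Ps) \<longleftrightarrow> (\<forall>P\<in>set Ps. arith UNIV P)"
    by (induction Ps) (auto simp: Conjs_def Truth_def)
qed (auto simp: Truth_def Equal_def Exists_def Disj_def)

text \<open>An assignment goes through the scratch variable, since \<open>x\<close> may occur in the assigned term.\<close>

primrec step_fml :: "fml \<Rightarrow> prog \<Rightarrow> fml" where
  "step_fml F (Test P) = Conj P F"
| "step_fml F (Assign x \<theta>) = Exists scratch (Conj (Equal (Var scratch) \<theta>)
     (Exists x (Conj (Equal (Var x) (Var scratch)) F)))"
| "step_fml F (AssignAny x) = Exists x F"
| "step_fml F (ODE xs P) = Truth"
| "step_fml F (Choice \<alpha> \<beta>) = Truth"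
| "step_fml F (Seq \<alpha> \<beta>) = Truth"
| "step_fml F (Loop \<alpha>) = Truth"

definition diamond :: "prog \<Rightarrow> fml \<Rightarrow> fml" where
  "diamond \<alpha> F = foldr (\<lambda>p. Disj (foldr (\<lambda>\<beta> G. step_fml G \<beta>) p F)) (paths \<alpha>) (Neg Truth)"

text \<open>Stated semantically, since a formula built by \<open>step_fml\<close> may contain the
  scratch variable, though only bound.\<close>

definition scratch_free :: "fml \<Rightarrow> bool" where
  "scratch_free F \<longleftrightarrow> (\<forall>\<nu> a. sat F (\<nu>(scratch := a)) \<longleftrightarrow> sat F \<nu>)"

lemma step_fml_correct:
  assumes "controller U Y \<beta>" "atomic \<beta>"
    and scratch: "scratch \<notin> U \<union> Y" and F: "scratch_free F"
  shows "sat (step_fml F \<beta>) \<nu> \<longleftrightarrow> (\<exists>\<omega>. (\<nu>, \<omega>) \<in> reach \<beta> \<and> sat F \<omega>)"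
    and "scratch_free (step_fml F \<beta>)"
    and "arith UNIV F \<Longrightarrow> arith UNIV (step_fml F \<beta>)"
proof -
  have "(\<forall>\<nu>. sat (step_fml F \<beta>) \<nu> \<longleftrightarrow> (\<exists>\<omega>. (\<nu>, \<omega>) \<in> reach \<beta> \<and> sat F \<omega>)) \<and> scratch_free (step_fml F \<beta>) \<and>
    (arith UNIV F \<longrightarrow> arith UNIV (step_fml F \<beta>))"
  proof (cases \<beta>)
    case (Test P)
    have "sat P (\<nu>(scratch := a)) \<longleftrightarrow> sat P \<nu>" for \<nu> a
      by (rule arith_cong[of "U \<union> Y"]) (use Test assms in auto)
    then show ?thesis using Test F assms(1) arith_mono[of _ P UNIV] by (auto simp: scratch_free_def)
  next
    case (Assign x \<theta>)
    have "x \<noteq> scratch" using Assign assms by auto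
    have "tval \<theta> (\<nu>(scratch := a)) = tval \<theta> \<nu>" for \<nu> a
      by (rule tval_cong) (use Assign assms in auto)
    moreover have "sat F (\<nu>(scratch := a, x := b)) \<longleftrightarrow> sat F (\<nu>(x := b))" for \<nu> a b
      using F \<open>x \<noteq> scratch\<close> unfolding scratch_free_def by (metis fun_upd_twist)
    ultimately show ?thesis using Assign \<open>x \<noteq> scratch\<close> by (auto simp: scratch_free_def)
  next
    case (AssignAny x)
    have "x \<noteq> scratch" using AssignAny assms by auto
    then have "sat F (\<nu>(scratch := a, x := b)) \<longleftrightarrow> sat F (\<nu>(x := b))" for \<nu> a b
      using F unfolding scratch_free_def by (metis fun_upd_twist)
    then show ?thesis using AssignAny by (auto simp: scratch_free_def)
  qed (use assms in auto)
  then show "sat (step_fml F \<beta>) \<nu> \<longleftrightarrow> (\<exists>\<omega>. (\<nu>, \<omega>) \<in> reach \<beta> \<and> sat F \<omega>)"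
    and "scratch_free (step_fml F \<beta>)" and "arith UNIV F \<Longrightarrow> arith UNIV (step_fml F \<beta>)" by blast+
qed

lemma run_fml_correct:
  assumes "\<forall>\<beta>\<in>set p. controller U Y \<beta> \<and> atomic \<beta>"
    and "scratch \<notin> U \<union> Y" and "scratch_free F" "arith UNIV F"
  shows "(\<forall>\<nu>. sat (foldr (\<lambda>\<beta> G. step_fml G \<beta>) p F) \<nu> \<longleftrightarrow> (\<exists>\<omega>. (\<nu>, \<omega>) \<in> run p \<and> sat F \<omega>)) \<and>
    scratch_free (foldr (\<lambda>\<beta> G. step_fml G \<beta>) p F) \<and> arith UNIV (foldr (\<lambda>\<beta> G. step_fml G \<beta>) p F)"
  using assms(1)
proof (induction p)
  case Nil
  then show ?case using assms by simp
next
  case (Cons \<beta> p)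
  define G where "G = foldr (\<lambda>\<beta> G. step_fml G \<beta>) p F"
  have G: "\<forall>\<nu>. sat G \<nu> \<longleftrightarrow> (\<exists>\<omega>. (\<nu>, \<omega>) \<in> run p \<and> sat F \<omega>)" "scratch_free G" "arith UNIV G"
    using Cons by (simp_all add: G_def)
  have \<beta>: "controller U Y \<beta>" "atomic \<beta>"
    using Cons.prems by simp_all
  note step = step_fml_correct[OF \<beta> assms(2) G(2)]
  have "sat (step_fml G \<beta>) \<nu> \<longleftrightarrow> (\<exists>\<omega>. (\<nu>, \<omega>) \<in> run (\<beta> # p) \<and> sat F \<omega>)" for \<nu>
    unfolding step(1) using G(1) by auto
  then show ?case using step(2,3) G(3) by (simp flip: G_def)
qed

lemma diamond_correct:
  assumes "controller U Y \<alpha>" "scratch \<notin> U \<union> Y" "scratch_free F" "arith UNIV F"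
  shows "sat (diamond \<alpha> F) \<nu> \<longleftrightarrow> (\<exists>\<omega>. (\<nu>, \<omega>) \<in> reach \<alpha> \<and> sat F \<omega>)"
    and "arith UNIV (diamond \<alpha> F)"
proof -
  have p: "(\<forall>\<nu>. sat (foldr (\<lambda>\<beta> G. step_fml G \<beta>) p F) \<nu> \<longleftrightarrow> (\<exists>\<omega>. (\<nu>, \<omega>) \<in> run p \<and> sat F \<omega>)) \<and>
    arith UNIV (foldr (\<lambda>\<beta> G. step_fml G \<beta>) p F)" if "p \<in> set (paths \<alpha>)" for p
    using run_fml_correct[of p U Y F] controller_paths[OF assms(1) that] assms by blast
  have "sat (foldr (\<lambda>p. Disj (f p)) ps (Neg Truth)) \<nu> \<longleftrightarrow> (\<exists>p\<in>set ps. sat (f p) \<nu>)" for f :: "prog list \<Rightarrow> fml" and ps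
    by (induction ps) auto
  then have "sat (diamond \<alpha> F) \<nu> \<longleftrightarrow> (\<exists>p\<in>set (paths \<alpha>). \<exists>\<omega>. (\<nu>, \<omega>) \<in> run p \<and> sat F \<omega>)"
    using p by (simp add: diamond_def)
  then show "sat (diamond \<alpha> F) \<nu> \<longleftrightarrow> (\<exists>\<omega>. (\<nu>, \<omega>) \<in> reach \<alpha> \<and> sat F \<omega>)"
    unfolding reach_paths[OF assms(1)] by blast
  have "\<forall>p\<in>set ps. arith UNIV (f p) \<Longrightarrow> arith UNIV (foldr (\<lambda>p. Disj (f p)) ps (Neg Truth))"
    for f :: "prog list \<Rightarrow> fml" and ps by (induction ps) auto
  then show "arith UNIV (diamond \<alpha> F)" using p by (simp add: diamond_def)
qed


section \<open>Reducing loop refinement to arithmetic\<close>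

text \<open>Instantaneous runs of the first program are runs of the second controller; the copies of the
  assigned variables name the final state.\<close>

definition equations :: "(var \<times> trm) list \<Rightarrow> fml" where
  "equations xs = Conjs (map (\<lambda>e. Equal (Var (Diff (fst e))) (snd e)) xs)"

definition copies :: "var list \<Rightarrow> fml" where
  "copies us = Conjs (map (\<lambda>x. Equal (Var x) (Var (copy x))) us)"

text \<open>An implication. The copies are free, so validity quantifies over them, and they force
  both diamonds to end with the same values. Variables assigned by only one controller are listed
  too, because the other one keeps their old values.\<close>

definition ctrl_fml :: "prog \<Rightarrow> (var \<times> trm) list \<Rightarrow> fml \<Rightarrow> prog \<Rightarrow> fml" where
  "ctrl_fml \<alpha> xs Q \<beta> = Disj
     (Neg (diamond \<alpha> (Conj (Conj (equations xs) Q) (copies (assigned \<alpha> @ assigned \<beta>)))))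
     (diamond \<beta> (copies (assigned \<alpha> @ assigned \<beta>)))"

lemma sat_equations [simp]: "sat (equations xs) \<nu> \<longleftrightarrow> (\<forall>(x, \<theta>)\<in>set xs. \<nu> (Diff x) = tval \<theta> \<nu>)"
  by (auto simp: equations_def)

lemma sat_copies [simp]: "sat (copies us) \<nu> \<longleftrightarrow> (\<forall>x\<in>set us. \<nu> x = \<nu> (copy x))"
  by (auto simp: copies_def)

section \<open>Runs of differential equations\<close>

lemma ODE_run:
  assumes "(\<nu>, \<omega>) \<in> reach (ODE xs P)"
  obtains r \<phi> where "r \<ge> 0" "\<phi> r = \<omega>"
    and "\<And>s z. 0 \<le> s \<Longrightarrow> s \<le> r \<Longrightarrow> z \<notin> fst ` set xs \<union> Diff ` fst ` set xs \<Longrightarrow> \<phi> s z = \<nu> z"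
    and "\<And>z. z \<notin> Diff ` fst ` set xs \<Longrightarrow> \<phi> 0 z = \<nu> z"
    and "\<And>s x \<theta>. 0 \<le> s \<Longrightarrow> s \<le> r \<Longrightarrow> (x, \<theta>) \<in> set xs \<Longrightarrow> \<phi> s (Diff x) = tval \<theta> (\<phi> s)"
    and "\<And>s. 0 \<le> s \<Longrightarrow> s \<le> r \<Longrightarrow> sat P (\<phi> s)"
    and "\<And>s x \<theta>. 0 \<le> s \<Longrightarrow> s \<le> r \<Longrightarrow> (x, \<theta>) \<in> set xs \<Longrightarrow>
      ((\<lambda>\<tau>. \<phi> \<tau> x) has_real_derivative tval \<theta> (\<phi> s)) (at s within {0..r})"
proof -
  obtain r \<phi> where *: "r \<ge> 0" "\<forall>z. z \<notin> Diff ` fst ` set xs \<longrightarrow> \<phi> 0 z = \<nu> z" "\<phi> r = \<omega>"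
    "\<forall>s\<in>{0..r}.
          (\<forall>z. z \<notin> fst ` set xs \<union> Diff ` fst ` set xs \<longrightarrow> \<phi> s z = \<nu> z)
        \<and> (\<forall>(x, \<theta>)\<in>set xs. \<phi> s (Diff x) = tval \<theta> (\<phi> s))
        \<and> sat P (\<phi> s)
        \<and> (\<forall>(x, \<theta>)\<in>set xs.
              ((\<lambda>\<tau>. \<phi> \<tau> x) has_real_derivative tval \<theta> (\<phi> s)) (at s within {0..r}))"
    using assms unfolding reach.simps by blast
  have at: "(\<forall>z. z \<notin> fst ` set xs \<union> Diff ` fst ` set xs \<longrightarrow> \<phi> s z = \<nu> z) \<and>
      (\<forall>(x, \<theta>)\<in>set xs. \<phi> s (Diff x) = tval \<theta> (\<phi> s)) \<and> sat P (\<phi> s) \<and>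
      (\<forall>(x, \<theta>)\<in>set xs. ((\<lambda>\<tau>. \<phi> \<tau> x) has_real_derivative tval \<theta> (\<phi> s)) (at s within {0..r}))"
    if "0 \<le> s" "s \<le> r" for s
    using bspec[OF *(4), of s] that by simp
  show thesis
  proof (rule that[of r \<phi>])
    show "0 \<le> r" "\<phi> r = \<omega>" by fact+
    show "\<phi> s z = \<nu> z" if "0 \<le> s" "s \<le> r" "z \<notin> fst ` set xs \<union> Diff ` fst ` set xs" for s z
      using at[OF that(1,2)] that(3) by blast
    show "\<phi> 0 z = \<nu> z" if "z \<notin> Diff ` fst ` set xs" for z using *(2) that by blast
    show "\<phi> s (Diff x) = tval \<theta> (\<phi> s)" if "0 \<le> s" "s \<le> r" "(x, \<theta>) \<in> set xs" for s x \<theta>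
      using at[OF that(1,2)] that(3) by blast
    show "sat P (\<phi> s)" if "0 \<le> s" "s \<le> r" for s using at[OF that] by blast
    show "((\<lambda>\<tau>. \<phi> \<tau> x) has_real_derivative tval \<theta> (\<phi> s)) (at s within {0..r})"
      if "0 \<le> s" "s \<le> r" "(x, \<theta>) \<in> set xs" for s x \<theta>
      using at[OF that(1,2)] that(3) by blast
  qed
qed

lemma ODE_intro:
  assumes "r \<ge> 0"
    and "\<And>s z. 0 \<le> s \<Longrightarrow> s \<le> r \<Longrightarrow> z \<notin> fst ` set xs \<union> Diff ` fst ` set xs \<Longrightarrow> \<phi> s z = \<nu> z"
    and "\<And>z. z \<notin> Diff ` fst ` set xs \<Longrightarrow> \<phi> 0 z = \<nu> z"
    and "\<And>s x \<theta>. 0 \<le> s \<Longrightarrow> s \<le> r \<Longrightarrow> (x, \<theta>) \<in> set xs \<Longrightarrow> \<phi> s (Diff x) = tval \<theta> (\<phi> s)"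
    and "\<And>s. 0 \<le> s \<Longrightarrow> s \<le> r \<Longrightarrow> sat P (\<phi> s)"
    and "\<And>s x \<theta>. 0 \<le> s \<Longrightarrow> s \<le> r \<Longrightarrow> (x, \<theta>) \<in> set xs \<Longrightarrow>
      ((\<lambda>\<tau>. \<phi> \<tau> x) has_real_derivative tval \<theta> (\<phi> s)) (at s within {0..r})"
  shows "(\<nu>, \<phi> r) \<in> reach (ODE xs P)"
  unfolding reach.simps mem_Collect_eq case_prod_conv
  by (intro exI[of _ r] exI[of _ \<phi>] conjI ballI allI impI) (use assms in auto)

lemma ODE_instantaneous:
  assumes "\<forall>(x, \<theta>)\<in>set xs. \<mu> (Diff x) = tval \<theta> \<mu>" "sat P \<mu>"
    and "\<And>z. z \<notin> Diff ` fst ` set xs \<Longrightarrow> \<mu> z = \<nu> z"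
  shows "(\<nu>, \<mu>) \<in> reach (ODE xs P)"
proof (rule ODE_intro[of 0 xs "\<lambda>_. \<mu>"])
  \<comment> \<open>The filter at a point within a one-point interval is trivial, so every
    derivative claim holds.\<close>
  show "((\<lambda>\<tau>. \<mu> x) has_real_derivative tval \<theta> \<mu>) (at s within {0..0})" if "0 \<le> s" "s \<le> 0" for s x \<theta>
    using that by (simp add: has_field_derivative_def has_derivative_bot bounded_linear_mult_right at_within_def)
qed (use assms in auto)

text \<open>The clock advances by exactly the duration of the run. If it stands still, the run is
  instantaneous and can change only differential symbols.\<close>

lemma ODE_clock:
  assumes "(\<nu>, \<omega>) \<in> reach (ODE xs P)" "(x, Const 1) \<in> set xs" "x \<notin> Diff ` fst ` set xs"
  shows "\<nu> x \<le> \<omega> x" and "\<omega> x = \<nu> x \<Longrightarrow> z \<notin> Diff ` fst ` set xs \<Longrightarrow> \<omega> z = \<nu> z"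
proof -
  obtain r \<phi> where r: "r \<ge> 0" "\<phi> r = \<omega>" "\<And>z. z \<notin> Diff ` fst ` set xs \<Longrightarrow> \<phi> 0 z = \<nu> z"
    and d: "\<And>s. 0 \<le> s \<Longrightarrow> s \<le> r \<Longrightarrow> ((\<lambda>\<tau>. \<phi> \<tau> x) has_real_derivative 1) (at s within {0..r})"
    using assms(1)
  proof (rule ODE_run)
    fix r :: real and \<phi> assume *: "0 \<le> r" "\<phi> r = \<omega>" "\<And>z. z \<notin> Diff ` fst ` set xs \<Longrightarrow> \<phi> 0 z = \<nu> z"
      "\<And>s x \<theta>. 0 \<le> s \<Longrightarrow> s \<le> r \<Longrightarrow> (x, \<theta>) \<in> set xs \<Longrightarrow>
        ((\<lambda>\<tau>. \<phi> \<tau> x) has_real_derivative tval \<theta> (\<phi> s)) (at s within {0..r})"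
    show thesis using that[OF *(1-3)] *(4)[OF _ _ assms(2)] by simp
  qed
  have clock: "\<phi> r x = \<phi> 0 x + r"
  proof (cases "r = 0")
    case False
    then have "0 < r" using r(1) by simp
    have d': "((\<lambda>\<tau>. \<phi> \<tau> x - \<tau>) has_real_derivative 0) (at s within {0..r})" if "0 \<le> s" "s \<le> r" for s
      using DERIV_diff[OF d[OF that] DERIV_ident] by simp
    have "\<phi> r x - r = \<phi> 0 x - 0"
    proof (rule DERIV_isconst2[OF \<open>0 < r\<close>, of "\<lambda>\<tau>. \<phi> \<tau> x - \<tau>"])
      show "continuous_on {0..r} (\<lambda>\<tau>. \<phi> \<tau> x - \<tau>)"
        by (rule DERIV_continuous_on[OF d']) auto
      show "((\<lambda>\<tau>. \<phi> \<tau> x - \<tau>) has_real_derivative 0) (at s)" if "0 < s" "s < r" for s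
        using d'[of s] that by (simp add: at_within_Icc_at)
    qed (use r(1) in auto)
    then show ?thesis by simp
  qed simp
  then show "\<nu> x \<le> \<omega> x" using r assms(3) by simp
  show "\<omega> z = \<nu> z" if "\<omega> x = \<nu> x" "z \<notin> Diff ` fst ` set xs"
  proof -
    have "r = 0" using clock r assms(3) that(1) by simp
    then show ?thesis using r that(2) by simp
  qed
qed


lemma sat_Equals:
  "length \<theta>s = length \<eta>s \<Longrightarrow> sat (Equals \<theta>s \<eta>s) \<nu> \<longleftrightarrow> (\<forall>i<length \<theta>s. tval (\<theta>s ! i) \<nu> = tval (\<eta>s ! i) \<nu>)"
proof (induction \<theta>s \<eta>s rule: list_induct2)
  case (Cons \<theta> \<theta>s \<eta> \<eta>s)
  then show ?case by (simp add: Equals_def All_less_Suc2)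
qed (simp add: Equals_def)

section \<open>Loop refinement for a fixed admissible pair\<close>

locale program_pair =
  fixes U :: "var set" and ys :: "var list" and \<alpha> \<beta> :: prog and p q :: "trm list" and Q R :: fml
    and i :: nat
  assumes base: "U \<union> set ys \<subseteq> range Base" and disjoint: "U \<inter> set ys = {}"
    and ctrl: "controller U (set ys) \<alpha>" "controller U (set ys) \<beta>"
    and len: "length p = length ys" "length q = length ys"
    and rhs: "\<And>\<theta>. \<theta> \<in> set p \<union> set q \<Longrightarrow> tvars \<theta> \<subseteq> U \<union> set ys"
    and clock: "i < length ys" "p ! i = Const 1" "q ! i = Const 1"
    and doms: "arith (U \<union> set ys \<union> Diff ` (U \<union> set ys)) Q" "arith (U \<union> set ys \<union> Diff ` (U \<union> set ys)) R"
    and idem: "idempotent \<beta>"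
begin

abbreviation "Y \<equiv> set ys"
abbreviation "xs \<equiv> zip ys p"
abbreviation "zs \<equiv> zip ys q"
abbreviation "A \<equiv> reach \<alpha>"
abbreviation "B \<equiv> reach \<beta>"
abbreviation "PA \<equiv> reach (ODE xs Q)"
abbreviation "PB \<equiv> reach (ODE zs R)"
abbreviation "clk \<equiv> ys ! i"

lemma fst_zips: "fst ` set xs = Y" "fst ` set zs = Y"
  using len by (metis map_fst_zip set_map)+

lemma zip_index: "(\<forall>(x, \<theta>)\<in>set xs. P x \<theta>) \<longleftrightarrow> (\<forall>j<length ys. P (ys ! j) (p ! j))"
  "(\<forall>(x, \<theta>)\<in>set zs. P x \<theta>) \<longleftrightarrow> (\<forall>j<length ys. P (ys ! j) (q ! j))"
  using len by (auto simp: set_zip)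

lemma clock_equation: "(clk, Const 1) \<in> set xs" "(clk, Const 1) \<in> set zs"
  using clock len by (auto simp: set_zip)

lemma base_not_Diff: "x \<in> U \<union> Y \<Longrightarrow> x \<noteq> Diff z"
  using base by auto

lemma disjoint_Diff: "Diff ` S \<inter> (U \<union> Y) = {}"
  using base_not_Diff by auto

lemma clk: "clk \<in> Y" "clk \<notin> U" "clk \<notin> Diff ` S"
proof -
  show "clk \<in> Y" using clock(1) by simp
  then show "clk \<notin> U" "clk \<notin> Diff ` S" using disjoint disjoint_Diff by auto
qed

lemma plant_end:
  assumes "(\<nu>, \<omega>) \<in> reach (ODE es P)"
  shows "sat P \<omega>" and "\<forall>(x, \<theta>)\<in>set es. \<omega> (Diff x) = tval \<theta> \<omega>"
proof -
  have "sat P \<omega> \<and> (\<forall>(x, \<theta>)\<in>set es. \<omega> (Diff x) = tval \<theta> \<omega>)"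
    using assms
  proof (rule ODE_run)
    fix r :: real and \<phi> assume *: "0 \<le> r" "\<phi> r = \<omega>" "\<And>s. 0 \<le> s \<Longrightarrow> s \<le> r \<Longrightarrow> sat P (\<phi> s)"
      "\<And>s x \<theta>. 0 \<le> s \<Longrightarrow> s \<le> r \<Longrightarrow> (x, \<theta>) \<in> set es \<Longrightarrow> \<phi> s (Diff x) = tval \<theta> (\<phi> s)"
    have "\<omega> (Diff x) = tval \<theta> \<omega>" if "(x, \<theta>) \<in> set es" for x \<theta>
      using *(4)[OF *(1) order_refl that] by (simp add: *(2))
    moreover have "sat P \<omega>" using *(3)[OF *(1) order_refl] by (simp add: *(2))
    ultimately show ?thesis by blast
  qed
  then show "sat P \<omega>" and "\<forall>(x, \<theta>)\<in>set es. \<omega> (Diff x) = tval \<theta> \<omega>" by blast+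
qed

text \<open>A trajectory need not start with the given values of the differential symbols of its
  variables, so these can be altered beforehand.\<close>

lemma plant_initial:
  assumes "(\<nu>, \<omega>) \<in> reach (ODE es P)" "\<And>z. z \<notin> Diff ` fst ` set es \<Longrightarrow> \<nu>' z = \<nu> z"
  shows "(\<nu>', \<omega>) \<in> reach (ODE es P)"
  using assms(1)
proof (rule ODE_run)
  fix r :: real and \<phi> assume *: "0 \<le> r" "\<phi> r = \<omega>"
    "\<And>s z. 0 \<le> s \<Longrightarrow> s \<le> r \<Longrightarrow> z \<notin> fst ` set es \<union> Diff ` fst ` set es \<Longrightarrow> \<phi> s z = \<nu> z"
    "\<And>z. z \<notin> Diff ` fst ` set es \<Longrightarrow> \<phi> 0 z = \<nu> z"
    "\<And>s x \<theta>. 0 \<le> s \<Longrightarrow> s \<le> r \<Longrightarrow> (x, \<theta>) \<in> set es \<Longrightarrow> \<phi> s (Diff x) = tval \<theta> (\<phi> s)"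
    "\<And>s. 0 \<le> s \<Longrightarrow> s \<le> r \<Longrightarrow> sat P (\<phi> s)"
    "\<And>s x \<theta>. 0 \<le> s \<Longrightarrow> s \<le> r \<Longrightarrow> (x, \<theta>) \<in> set es \<Longrightarrow>
      ((\<lambda>\<tau>. \<phi> \<tau> x) has_real_derivative tval \<theta> (\<phi> s)) (at s within {0..r})"
  have "(\<nu>', \<phi> r) \<in> reach (ODE es P)"
    by (rule ODE_intro[of r es \<phi> \<nu>' P]) (use * assms(2) in auto)
  then show "(\<nu>', \<omega>) \<in> reach (ODE es P)" by (simp add: *(2))
qed

text \<open>The hypotheses on \<open>\<mu>\<close> say that the first plant can stay in
  \<open>\<mu>\<close> for zero time. Final states with other differential symbols are reduced to
  such ones by \<open>controller_ov\<close>.\<close>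

definition ctrl_refines :: bool where
  "ctrl_refines \<longleftrightarrow> (\<forall>\<nu> \<mu>. (\<nu>, \<mu>) \<in> A \<longrightarrow> (\<forall>(x, \<theta>)\<in>set xs. \<mu> (Diff x) = tval \<theta> \<mu>) \<longrightarrow> sat Q \<mu>
     \<longrightarrow> (\<nu>, \<mu>) \<in> B)"

definition plant_refines :: bool where
  "plant_refines \<longleftrightarrow> (\<forall>\<nu> \<mu> \<omega>. (\<nu>, \<mu>) \<in> A \<longrightarrow> (\<mu>, \<omega>) \<in> PA \<longrightarrow>
     (\<forall>j<length ys. tval (p ! j) \<omega> = tval (q ! j) \<omega>) \<and> sat R \<omega>)"

text \<open>Every prefix of a plant run is a plant run, so the hypothesis about end points holds at
  all intermediate times. Hence the same trajectory solves the second system inside its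
  domain.\<close>

lemma plant_run_refines:
  assumes PA: "(\<mu>, \<omega>) \<in> PA"
    and all: "\<And>\<omega>. (\<mu>, \<omega>) \<in> PA \<Longrightarrow> (\<forall>j<length ys. tval (p ! j) \<omega> = tval (q ! j) \<omega>) \<and> sat R \<omega>"
  shows "(\<mu>, \<omega>) \<in> PB"
  using PA
proof (rule ODE_run)
  fix r :: real and \<phi> assume *: "0 \<le> r" "\<phi> r = \<omega>"
    "\<And>s z. 0 \<le> s \<Longrightarrow> s \<le> r \<Longrightarrow> z \<notin> fst ` set xs \<union> Diff ` fst ` set xs \<Longrightarrow> \<phi> s z = \<mu> z"
    "\<And>z. z \<notin> Diff ` fst ` set xs \<Longrightarrow> \<phi> 0 z = \<mu> z"
    "\<And>s x \<theta>. 0 \<le> s \<Longrightarrow> s \<le> r \<Longrightarrow> (x, \<theta>) \<in> set xs \<Longrightarrow> \<phi> s (Diff x) = tval \<theta> (\<phi> s)"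
    "\<And>s. 0 \<le> s \<Longrightarrow> s \<le> r \<Longrightarrow> sat Q (\<phi> s)"
    "\<And>s x \<theta>. 0 \<le> s \<Longrightarrow> s \<le> r \<Longrightarrow> (x, \<theta>) \<in> set xs \<Longrightarrow>
      ((\<lambda>\<tau>. \<phi> \<tau> x) has_real_derivative tval \<theta> (\<phi> s)) (at s within {0..r})"
  have prefix: "(\<mu>, \<phi> s) \<in> PA" if "0 \<le> s" "s \<le> r" for s
  proof (rule ODE_intro[of s xs \<phi> \<mu> Q])
    show "((\<lambda>\<tau>. \<phi> \<tau> x) has_real_derivative tval \<theta> (\<phi> u)) (at u within {0..s})"
      if "0 \<le> u" "u \<le> s" "(x, \<theta>) \<in> set xs" for u x \<theta>
      using *(7)[of u x \<theta>] that \<open>s \<le> r\<close> by (auto intro: DERIV_subset)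
  qed (use * that in auto)
  have eq: "\<exists>\<eta>. (x, \<eta>) \<in> set xs \<and> tval \<eta> (\<phi> s) = tval \<theta> (\<phi> s)" if s: "0 \<le> s" "s \<le> r" and x: "(x, \<theta>) \<in> set zs" for s x \<theta>
  proof -
    obtain j where j: "j < length ys" "x = ys ! j" "\<theta> = q ! j"
      using x len by (auto simp: set_zip)
    then have "(x, p ! j) \<in> set xs" using len by (auto simp: set_zip)
    then show ?thesis using all[OF prefix[OF s]] j by metis
  qed
  have "(\<mu>, \<phi> r) \<in> PB"
  proof (rule ODE_intro[of r zs \<phi> \<mu> R])
    show "\<phi> s z = \<mu> z" if "0 \<le> s" "s \<le> r" "z \<notin> fst ` set zs \<union> Diff ` fst ` set zs" for s z
      using *(3)[OF that(1,2)] that(3) unfolding fst_zips by blast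
    show "\<phi> 0 z = \<mu> z" if "z \<notin> Diff ` fst ` set zs" for z
      using *(4) that unfolding fst_zips by blast
    show "sat R (\<phi> s)" if "0 \<le> s" "s \<le> r" for s
      using all[OF prefix[OF that]] by blast
    show "\<phi> s (Diff x) = tval \<theta> (\<phi> s)" if "0 \<le> s" "s \<le> r" "(x, \<theta>) \<in> set zs" for s x \<theta>
      using eq[OF that] *(5)[OF that(1,2)] by metis
    show "((\<lambda>\<tau>. \<phi> \<tau> x) has_real_derivative tval \<theta> (\<phi> s)) (at s within {0..r})"
      if "0 \<le> s" "s \<le> r" "(x, \<theta>) \<in> set zs" for s x \<theta>
      using eq[OF that] *(7)[OF that(1,2)] by metis
  qed (rule *(1))
  then show ?thesis by (simp add: *(2))
qed

lemma initial_state: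
  assumes "(\<mu>, \<omega>) \<in> PA"
  shows "\<exists>\<mu>'. (\<forall>z. z \<notin> Diff ` Y \<longrightarrow> \<mu>' z = \<mu> z) \<and> (\<forall>(x, \<theta>)\<in>set xs. \<mu>' (Diff x) = tval \<theta> \<mu>') \<and> sat Q \<mu>'"
  using assms
proof (rule ODE_run)
  fix r :: real and \<phi> assume *: "0 \<le> r" "\<And>z. z \<notin> Diff ` fst ` set xs \<Longrightarrow> \<phi> 0 z = \<mu> z"
    "\<And>s x \<theta>. 0 \<le> s \<Longrightarrow> s \<le> r \<Longrightarrow> (x, \<theta>) \<in> set xs \<Longrightarrow> \<phi> s (Diff x) = tval \<theta> (\<phi> s)"
    "\<And>s. 0 \<le> s \<Longrightarrow> s \<le> r \<Longrightarrow> sat Q (\<phi> s)"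
  have "\<forall>(x, \<theta>)\<in>set xs. \<phi> 0 (Diff x) = tval \<theta> (\<phi> 0)" using *(3)[OF order_refl *(1)] by blast
  moreover have "sat Q (\<phi> 0)" using *(4)[OF order_refl *(1)] .
  moreover have "\<forall>z. z \<notin> Diff ` Y \<longrightarrow> \<phi> 0 z = \<mu> z" using *(2) unfolding fst_zips by blast
  ultimately show ?thesis by blast
qed

lemma reach_frame:
  "(\<nu>, \<omega>) \<in> A \<Longrightarrow> z \<notin> U \<Longrightarrow> \<omega> z = \<nu> z" "(\<nu>, \<omega>) \<in> B \<Longrightarrow> z \<notin> U \<Longrightarrow> \<omega> z = \<nu> z"
  using reach_unassigned assigned_subset ctrl by blast+

lemma Diff_notin_U: "Diff z \<notin> U"
  using base by auto

text \<open>The controller run is moved to the differential symbols with which the trajectory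
  starts, where \<open>ctrl_refines\<close> applies, and the matching run is moved back.\<close>

lemma refines_if:
  assumes "ctrl_refines" "plant_refines"
  shows "A O PA \<subseteq> B O PB"
proof clarify
  fix \<nu> \<mu> \<omega> assume A: "(\<nu>, \<mu>) \<in> A" and PA: "(\<mu>, \<omega>) \<in> PA"
  obtain \<mu>' where \<mu>': "\<forall>z. z \<notin> Diff ` Y \<longrightarrow> \<mu>' z = \<mu> z"
    "\<forall>(x, \<theta>)\<in>set xs. \<mu>' (Diff x) = tval \<theta> \<mu>'" "sat Q \<mu>'"
    using initial_state[OF PA] by blast
  have "ov (Diff ` Y) \<mu>' \<mu> = \<mu>'" using \<mu>'(1) by (auto simp: ov_def fun_eq_iff)
  then have "(ov (Diff ` Y) \<mu>' \<nu>, \<mu>') \<in> A"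
    using controller_ov[OF ctrl(1) disjoint_Diff A, of Y \<mu>'] by simp
  then have "(ov (Diff ` Y) \<mu>' \<nu>, \<mu>') \<in> B"
    using assms(1) \<mu>' unfolding ctrl_refines_def by blast
  from controller_ov[OF ctrl(2) disjoint_Diff this, of Y \<nu>]
  have "(ov (Diff ` Y) \<nu> (ov (Diff ` Y) \<mu>' \<nu>), ov (Diff ` Y) \<nu> \<mu>') \<in> B" .
  moreover have "ov (Diff ` Y) \<nu> (ov (Diff ` Y) \<mu>' \<nu>) = \<nu>" by (auto simp: ov_def fun_eq_iff)
  moreover have "ov (Diff ` Y) \<nu> \<mu>' = \<mu>"
    using \<mu>'(1) reach_frame(1)[OF A] Diff_notin_U by (auto simp: ov_def fun_eq_iff)
  ultimately have "(\<nu>, \<mu>) \<in> B" by simp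
  moreover have "(\<mu>, \<omega>) \<in> PB"
    using assms(2) A unfolding plant_refines_def by (intro plant_run_refines[OF PA]) blast
  ultimately show "(\<nu>, \<omega>) \<in> B O PB" by blast
qed

section \<open>Necessity of the two conditions\<close>

text \<open>A plant run sets the differential symbol of the clock to 1. Starting from a state where it is 0
  therefore forces the second loop to be unrolled at least once.\<close>

lemma restart:
  assumes "(\<nu>, \<mu>) \<in> A" "(\<mu>, \<omega>) \<in> PA"
  shows "(\<nu>(Diff clk := 0), \<omega>) \<in> A O PA" and "\<omega> \<noteq> \<nu>(Diff clk := 0)"
proof -
  have upd: "\<kappa>(Diff clk := 0) = ov (Diff ` {clk}) (\<lambda>_. 0) \<kappa>" for \<kappa> :: state
    by (auto simp: ov_def)
  have "(\<nu>(Diff clk := 0), \<mu>(Diff clk := 0)) \<in> A"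
    unfolding upd by (rule controller_ov[OF ctrl(1) disjoint_Diff assms(1)])
  moreover have "(\<mu>(Diff clk := 0), \<omega>) \<in> PA"
    by (rule plant_initial[OF assms(2)]) (use clk(1) in \<open>auto simp: fst_zips\<close>)
  ultimately show "(\<nu>(Diff clk := 0), \<omega>) \<in> A O PA" by blast
  have "\<omega> (Diff clk) = 1" using plant_end(2)[OF assms(2)] clock_equation(1) by fastforce
  then show "\<omega> \<noteq> \<nu>(Diff clk := 0)" by auto
qed

text \<open>In \<omega> the last runs of both plants end, so the differential symbols have the
  values of both right-hand sides there, and these must agree.\<close>

lemma plant_refines_only_if:
  assumes "(A O PA)\<^sup>* \<subseteq> (B O PB)\<^sup>*" shows plant_refines
  unfolding plant_refines_def
proof (intro allI impI)
  fix \<nu> \<mu> \<omega> assume *: "(\<nu>, \<mu>) \<in> A" "(\<mu>, \<omega>) \<in> PA"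
  have "(\<nu>(Diff clk := 0), \<omega>) \<in> (B O PB)\<^sup>*" using restart(1)[OF *] assms by blast
  then obtain \<kappa> where \<kappa>: "(\<kappa>, \<omega>) \<in> PB"
    by (rule rtranclE) (use restart(2)[OF *] in blast)+
  have "\<forall>j<length ys. \<omega> (Diff (ys ! j)) = tval (p ! j) \<omega>" "\<forall>j<length ys. \<omega> (Diff (ys ! j)) = tval (q ! j) \<omega>"
    using plant_end(2)[OF *(2)] plant_end(2)[OF \<kappa>] unfolding zip_index by blast+
  then show "(\<forall>j<length ys. tval (p ! j) \<omega> = tval (q ! j) \<omega>) \<and> sat R \<omega>"
    using plant_end(1)[OF \<kappa>] by metis
qed

lemma B_idem: "(\<nu>, \<mu>) \<in> B \<Longrightarrow> (\<mu>, \<omega>) \<in> B \<Longrightarrow> (\<nu>, \<omega>) \<in> B"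
proof -
  have "\<forall>\<nu> \<omega>. (\<nu>, \<omega>) \<in> B O B \<longrightarrow> (\<nu>, \<omega>) \<in> B"
    using idem unfolding idempotent_def valid_def Equiv_def sat.simps reach.simps by blast
  then show "(\<nu>, \<mu>) \<in> B \<Longrightarrow> (\<mu>, \<omega>) \<in> B \<Longrightarrow> (\<nu>, \<omega>) \<in> B" by blast
qed

text \<open>Iterations during which the clock does not advance consist of controller runs only, and these
  collapse to a single one by idempotence.\<close>

lemma instantaneous_iterations:
  assumes "(\<nu>, \<omega>) \<in> (B O PB)\<^sup>*"
  shows "\<nu> clk \<le> \<omega> clk" and "\<omega> clk = \<nu> clk \<Longrightarrow> \<omega> = \<nu> \<or> (\<exists>\<kappa>. (\<nu>, \<kappa>) \<in> B \<and> (\<forall>z. z \<notin> Diff ` Y \<longrightarrow> \<omega> z = \<kappa> z))"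
proof -
  have "\<nu> clk \<le> \<omega> clk \<and> (\<omega> clk = \<nu> clk \<longrightarrow> \<omega> = \<nu> \<or> (\<exists>\<kappa>. (\<nu>, \<kappa>) \<in> B \<and> (\<forall>z. z \<notin> Diff ` Y \<longrightarrow> \<omega> z = \<kappa> z)))"
    using assms
  proof (induction rule: rtrancl_induct)
    case (step \<omega> \<omega>')
    then obtain \<rho> where \<rho>: "(\<omega>, \<rho>) \<in> B" "(\<rho>, \<omega>') \<in> PB" by blast
    have \<rho>_clk: "\<rho> clk = \<omega> clk" using reach_frame(2)[OF \<rho>(1)] clk(2) by blast
    have le: "\<rho> clk \<le> \<omega>' clk" by (rule ODE_clock(1)[OF \<rho>(2) clock_equation(2) clk(3)])
    show ?case
    proof (intro conjI impI)
      show "\<nu> clk \<le> \<omega>' clk" using le \<rho>_clk step.IH by simp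
      assume eq: "\<omega>' clk = \<nu> clk"
      then have stop: "\<omega>' clk = \<rho> clk" "\<omega> clk = \<nu> clk" using le \<rho>_clk step.IH by auto
      have fin: "\<omega>' z = \<rho> z" if "z \<notin> Diff ` Y" for z
        using ODE_clock(2)[OF \<rho>(2) clock_equation(2) clk(3) stop(1)] that by (simp add: fst_zips)
      consider "\<omega> = \<nu>" | \<kappa> where "(\<nu>, \<kappa>) \<in> B" "\<forall>z. z \<notin> Diff ` Y \<longrightarrow> \<omega> z = \<kappa> z"
        using step.IH stop(2) by blast
      then show "\<omega>' = \<nu> \<or> (\<exists>\<kappa>. (\<nu>, \<kappa>) \<in> B \<and> (\<forall>z. z \<notin> Diff ` Y \<longrightarrow> \<omega>' z = \<kappa> z))"
      proof cases
        case 1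
        then show ?thesis using \<rho>(1) fin by blast
      next
        case (2 \<kappa>)
        \<comment> \<open>The next controller run starts in \<omega>, which agrees with \<kappa> up
          to differential symbols; exchanging these lets it continue the run to \<kappa>.\<close>
        have "ov (Diff ` Y) \<kappa> \<omega> = \<kappa>" using 2(2) by (auto simp: ov_def fun_eq_iff)
        then have "(\<kappa>, ov (Diff ` Y) \<kappa> \<rho>) \<in> B"
          using controller_ov[OF ctrl(2) disjoint_Diff \<rho>(1), of Y \<kappa>] by simp
        then have "(\<nu>, ov (Diff ` Y) \<kappa> \<rho>) \<in> B" using 2(1) B_idem by blast
        then show ?thesis using fin by (auto simp: ov_def)
      qed
    qed
  qed simp
  then show "\<nu> clk \<le> \<omega> clk" and "\<omega> clk = \<nu> clk \<Longrightarrow> \<omega> = \<nu> \<or> (\<exists>\<kappa>. (\<nu>, \<kappa>) \<in> B \<and> (\<forall>z. z \<notin> Diff ` Y \<longrightarrow> \<omega> z = \<kappa> z))"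
    by blast+
qed

text \<open>An instantaneous plant run from \<mu> to itself makes the controller run an iteration of
  the first loop. As no time passes, the second loop answers with one controller run up to
  differential symbols of \<open>Y\<close>, and these are restored by
  \<open>controller_ov\<close>.\<close>

lemma ctrl_refines_only_if:
  assumes "(A O PA)\<^sup>* \<subseteq> (B O PB)\<^sup>*" shows ctrl_refines
  unfolding ctrl_refines_def
proof (intro allI impI)
  fix \<nu> \<mu> assume A: "(\<nu>, \<mu>) \<in> A" and init: "\<forall>(x, \<theta>)\<in>set xs. \<mu> (Diff x) = tval \<theta> \<mu>" "sat Q \<mu>"
  have PA: "(\<mu>, \<mu>) \<in> PA" by (rule ODE_instantaneous[OF init]) simp
  define \<nu>' where "\<nu>' = \<nu>(Diff clk := 0)"
  have steps: "(\<nu>', \<mu>) \<in> (B O PB)\<^sup>*" using restart(1)[OF A PA] assms unfolding \<nu>'_def by blast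
  have "clk \<noteq> Diff clk" using clk(1) base_not_Diff by blast
  then have "\<mu> clk = \<nu>' clk" using reach_frame(1)[OF A] clk(2) by (simp add: \<nu>'_def)
  then obtain \<kappa> where \<kappa>: "(\<nu>', \<kappa>) \<in> B" "\<forall>z. z \<notin> Diff ` Y \<longrightarrow> \<mu> z = \<kappa> z"
    using instantaneous_iterations(2)[OF steps] restart(2)[OF A PA] unfolding \<nu>'_def by blast
  have "ov (Diff ` Y) \<nu> \<nu>' = \<nu>" using clk(1) by (auto simp: ov_def fun_eq_iff \<nu>'_def)
  moreover have "ov (Diff ` Y) \<nu> \<kappa> = \<mu>"
    using \<kappa>(2) reach_frame(1)[OF A] Diff_notin_U by (auto simp: ov_def fun_eq_iff)
  ultimately show "(\<nu>, \<mu>) \<in> B"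
    using controller_ov[OF ctrl(2) disjoint_Diff \<kappa>(1), of Y \<nu>] by simp
qed

lemma refinement_iff: "(A O PA)\<^sup>* \<subseteq> (B O PB)\<^sup>* \<longleftrightarrow> ctrl_refines \<and> plant_refines"
  using refines_if rtrancl_mono ctrl_refines_only_if plant_refines_only_if by blast

section \<open>The condition on controllers as a formula of real arithmetic\<close>

abbreviation "us \<equiv> assigned \<alpha> @ assigned \<beta>"

lemma us: "set us \<subseteq> U"
  using assigned_subset ctrl by auto

lemma not_copy: "x \<in> U \<union> Y \<union> Diff ` (U \<union> Y) \<Longrightarrow> x \<noteq> copy z" "x \<in> U \<union> Y \<union> Diff ` (U \<union> Y) \<Longrightarrow> x \<noteq> scratch"
  using base by auto

lemma valid_ctrl_fml: "valid (ctrl_fml \<alpha> xs Q \<beta>) \<longleftrightarrow> ctrl_refines"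
  and arith_ctrl_fml: "arith UNIV (ctrl_fml \<alpha> xs Q \<beta>)"
proof -
  define F where "F = Conj (Conj (equations xs) Q) (copies us)"
  have scratch: "scratch \<notin> U \<union> Y" using base by auto
  have xs_vars: "x \<in> Y \<and> tvars \<theta> \<subseteq> U \<union> Y" if "(x, \<theta>) \<in> set xs" for x \<theta>
    using that rhs by (meson Un_iff set_zip_leftD set_zip_rightD)
  have Q_cong: "sat Q \<nu> \<longleftrightarrow> sat Q \<omega>" if "\<And>x. x \<in> U \<union> Y \<union> Diff ` (U \<union> Y) \<Longrightarrow> \<nu> x = \<omega> x" for \<nu> \<omega>
    using doms(1) that by (rule arith_cong)
  have eq_cong: "sat (equations xs) \<nu> \<longleftrightarrow> sat (equations xs) \<omega>"
    if *: "\<And>x. x \<in> U \<union> Y \<union> Diff ` (U \<union> Y) \<Longrightarrow> \<nu> x = \<omega> x" for \<nu> \<omega>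
  proof -
    have "\<nu> (Diff x) = \<omega> (Diff x) \<and> tval \<theta> \<nu> = tval \<theta> \<omega>" if "(x, \<theta>) \<in> set xs" for x \<theta>
      using xs_vars[OF that] * by (auto intro!: tval_cong)
    then show ?thesis by (simp add: case_prod_beta) (metis prod.collapse)
  qed
  have sf_copies: "scratch_free (copies us)"
  proof -
    have "x \<noteq> scratch \<and> copy x \<noteq> scratch" if "x \<in> set us" for x
      using us base that by auto
    then show ?thesis unfolding scratch_free_def sat_copies fun_upd_def by simp
  qed
  have "sat (equations xs) (\<nu>(scratch := a)) \<longleftrightarrow> sat (equations xs) \<nu>" "sat Q (\<nu>(scratch := a)) \<longleftrightarrow> sat Q \<nu>" for \<nu> a
    using not_copy(2) by (intro eq_cong Q_cong; simp)+
  then have sf: "scratch_free F"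
    using sf_copies by (simp add: scratch_free_def F_def)
  have ar_copies: "arith UNIV (copies us)" by (auto simp: copies_def)
  have ar: "arith UNIV F"
    using arith_mono[OF doms(1)] ar_copies by (auto simp: F_def equations_def)
  note dia = diamond_correct[OF ctrl(1) scratch sf ar] diamond_correct[OF ctrl(2) scratch sf_copies ar_copies]
  have fml: "ctrl_fml \<alpha> xs Q \<beta> = Disj (Neg (diamond \<alpha> F)) (diamond \<beta> (copies us))"
    by (simp add: ctrl_fml_def F_def)
  show "arith UNIV (ctrl_fml \<alpha> xs Q \<beta>)" using dia by (simp add: fml)
  have "valid (ctrl_fml \<alpha> xs Q \<beta>) \<longleftrightarrow> (\<forall>\<nu> \<mu>. (\<nu>, \<mu>) \<in> A \<longrightarrow> sat F \<mu> \<longrightarrow> (\<exists>\<kappa>. (\<nu>, \<kappa>) \<in> B \<and> sat (copies us) \<kappa>))"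
    by (simp add: valid_def fml dia(1,3)) blast
  also have "\<dots> \<longleftrightarrow> ctrl_refines"
  proof
    assume "ctrl_refines"
    then show "\<forall>\<nu> \<mu>. (\<nu>, \<mu>) \<in> A \<longrightarrow> sat F \<mu> \<longrightarrow> (\<exists>\<kappa>. (\<nu>, \<kappa>) \<in> B \<and> sat (copies us) \<kappa>)"
      unfolding ctrl_refines_def F_def by (simp only: sat.simps sat_equations) blast
  next
    assume *: "\<forall>\<nu> \<mu>. (\<nu>, \<mu>) \<in> A \<longrightarrow> sat F \<mu> \<longrightarrow> (\<exists>\<kappa>. (\<nu>, \<kappa>) \<in> B \<and> sat (copies us) \<kappa>)"
    show ctrl_refines
      unfolding ctrl_refines_def
    proof (intro allI impI)
      fix \<nu> \<mu> assume A: "(\<nu>, \<mu>) \<in> A" and init: "\<forall>(x, \<theta>)\<in>set xs. \<mu> (Diff x) = tval \<theta> \<mu>" "sat Q \<mu>"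
      define S where "S = copy ` set us"
      \<comment> \<open>The copies receive the values of the originals in \<mu>, so that a final
        state of the second controller satisfying \<open>copies\<close> agrees with \<mu> on the
        assigned variables.\<close>
      define \<delta> where "\<delta> z = (case z of Diff (Diff x) \<Rightarrow> \<mu> x | _ \<Rightarrow> 0)" for z
      have S: "S \<inter> (U \<union> Y) = {}" "S \<inter> (U \<union> Y \<union> Diff ` (U \<union> Y)) = {}"
        using not_copy(1) by (auto simp: S_def)
      have "(ov S \<delta> \<nu>, ov S \<delta> \<mu>) \<in> A" by (rule controller_ov[OF ctrl(1) S(1) A])
      moreover have S': "ov S \<delta> \<mu> x = \<mu> x" if "x \<in> U \<union> Y \<union> Diff ` (U \<union> Y)" for x
        using S(2) that by (auto simp: ov_def)
      have "sat (equations xs) (ov S \<delta> \<mu>) \<longleftrightarrow> sat (equations xs) \<mu>" "sat Q (ov S \<delta> \<mu>) \<longleftrightarrow> sat Q \<mu>"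
        by (rule eq_cong, rule S', assumption) (rule Q_cong, rule S', assumption)
      then have "sat (equations xs) (ov S \<delta> \<mu>)" "sat Q (ov S \<delta> \<mu>)"
        using init by simp_all
      moreover have us_S: "x \<notin> S" if "x \<in> set us" for x using S(1) us that by auto
      have copies_val: "ov S \<delta> \<kappa> (copy x) = \<mu> x" if "x \<in> set us" for \<kappa> x
        using that by (auto simp: ov_def S_def \<delta>_def)
      have "sat (copies us) (ov S \<delta> \<mu>)"
        unfolding sat_copies using us_S copies_val by (simp add: ov_def)
      ultimately have "\<exists>\<kappa>. (ov S \<delta> \<nu>, \<kappa>) \<in> B \<and> sat (copies us) \<kappa>"
        using * by (simp only: F_def sat.simps)
      then obtain \<kappa> where \<kappa>: "(ov S \<delta> \<nu>, \<kappa>) \<in> B" "\<forall>x\<in>set us. \<kappa> x = \<kappa> (copy x)" by auto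
      have S_us: "z \<notin> set us" if "z \<in> S" for z using us_S that by blast
      have \<kappa>_frame: "\<kappa> z = ov S \<delta> \<nu> z" if "z \<notin> set us" for z
        using reach_unassigned[OF ctrl(2) \<kappa>(1)] that by simp
      have \<mu>_frame: "\<mu> z = \<nu> z" if "z \<notin> set us" for z
        using reach_unassigned[OF ctrl(1) A] that by simp
      \<comment> \<open>Assigned variables agree through the copies, which the second controller
        leaves alone. All others are unchanged by both controllers, and on the copies themselves
        \<nu> and \<mu> coincide.\<close>
      have "ov S \<nu> \<kappa> = \<mu>"
      proof
        fix z
        consider "z \<in> S" | "z \<in> set us" "z \<notin> S" | "z \<notin> set us" "z \<notin> S" by blast
        then show "ov S \<nu> \<kappa> z = \<mu> z"
        proof cases
          case 1 then show ?thesis using \<mu>_frame S_us by (simp add: ov_def)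
        next
          case 2
          then have "\<kappa> z = \<kappa> (copy z)" using \<kappa>(2) by blast
          also have "\<dots> = ov S \<delta> \<nu> (copy z)" using 2 by (intro \<kappa>_frame S_us) (auto simp: S_def)
          also have "\<dots> = \<mu> z" using 2 copies_val by simp
          finally show ?thesis using 2 by (simp add: ov_def)
        next
          case 3 then show ?thesis using \<kappa>_frame \<mu>_frame by (simp add: ov_def)
        qed
      qed
      moreover have "ov S \<nu> (ov S \<delta> \<nu>) = \<nu>" by (auto simp: ov_def fun_eq_iff)
      ultimately show "(\<nu>, \<mu>) \<in> B"
        using controller_ov[OF ctrl(2) S(1) \<kappa>(1), of \<nu>] by simp
    qed
  qed
  finally show "valid (ctrl_fml \<alpha> xs Q \<beta>) \<longleftrightarrow> ctrl_refines" .
qed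

end

lemma refinement_reduction:
  assumes "admissible D"
  shows "valid (refinement_fml D) \<longleftrightarrow> valid (box_fml D) \<and>
    valid_arith (ctrl_fml (ctrl_a D) (zip (cvars D) (rhs_a D)) (dom_a D) (ctrl_b D))"
proof -
  obtain us i where *: "distinct (us @ cvars D)" "set us \<union> set (cvars D) \<subseteq> range Base"
    "controller (set us) (set (cvars D)) (ctrl_a D)" "controller (set us) (set (cvars D)) (ctrl_b D)"
    "length (rhs_a D) = length (cvars D)" "length (rhs_b D) = length (cvars D)"
    "\<forall>\<theta>\<in>set (rhs_a D) \<union> set (rhs_b D). tvars \<theta> \<subseteq> set us \<union> set (cvars D)"
    "i < length (cvars D)" "rhs_a D ! i = Const 1" "rhs_b D ! i = Const 1"
    "arith (set us \<union> set (cvars D) \<union> Diff ` (set us \<union> set (cvars D))) (dom_a D)"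
    "arith (set us \<union> set (cvars D) \<union> Diff ` (set us \<union> set (cvars D))) (dom_b D)"
    "idempotent (ctrl_b D)"
    using assms unfolding admissible_def Let_def by blast
  interpret program_pair "set us" "cvars D" "ctrl_a D" "ctrl_b D" "rhs_a D" "rhs_b D" "dom_a D" "dom_b D" i
    by standard (use * in auto)
  have "valid (refinement_fml D) \<longleftrightarrow>
    (reach (ctrl_a D) O reach (plant_a D))\<^sup>* \<subseteq> (reach (ctrl_b D) O reach (plant_b D))\<^sup>*"
    by (auto simp: valid_def refinement_fml_def)
  also have "\<dots> \<longleftrightarrow> ctrl_refines \<and> plant_refines"
    unfolding plant_a_def plant_b_def by (rule refinement_iff)
  also have "plant_refines \<longleftrightarrow> valid (box_fml D)"
    using *(5,6) by (auto simp: plant_refines_def valid_def box_fml_def plant_a_def sat_Equals simp del: reach.simps)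
  also have "ctrl_refines \<longleftrightarrow> valid_arith (ctrl_fml (ctrl_a D) (zip (cvars D) (rhs_a D)) (dom_a D) (ctrl_b D))"
    unfolding valid_arith_correct[OF arith_ctrl_fml] valid_ctrl_fml ..
  finally show ?thesis by blast
qed


section \<open>Computing the reduction\<close>

text \<open>Together with \<open>ode_parts\<close> this recovers controllers and plants from the two
  coded programs; other program shapes get defaults.\<close>

primrec seq_parts :: "prog \<Rightarrow> prog \<times> prog" where
  "seq_parts (Test P) = (Test P, Test P)"
| "seq_parts (Assign x \<theta>) = (Assign x \<theta>, Assign x \<theta>)"
| "seq_parts (AssignAny x) = (AssignAny x, AssignAny x)"
| "seq_parts (ODE xs P) = (Test P, Test P)"
| "seq_parts (Choice \<alpha> \<beta>) = (Test Truth, Test Truth)"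
| "seq_parts (Seq \<alpha> \<beta>) = (\<alpha>, \<beta>)"
| "seq_parts (Loop \<alpha>) = (Test Truth, Test Truth)"

primrec ode_parts :: "prog \<Rightarrow> (var \<times> trm) list \<times> fml" where
  "ode_parts (Test P) = ([], P)"
| "ode_parts (Assign x \<theta>) = ([], Truth)"
| "ode_parts (AssignAny x) = ([], Truth)"
| "ode_parts (ODE xs P) = (xs, P)"
| "ode_parts (Choice \<alpha> \<beta>) = ([], Truth)"
| "ode_parts (Seq \<alpha> \<beta>) = ([], Truth)"
| "ode_parts (Loop \<alpha>) = ([], Truth)"

lemma computable_seq_parts [computable_intros]: "computable \<alpha> \<Longrightarrow> computable (\<lambda>e. seq_parts (\<alpha> e))"
  by (rule computable_prog_recursion[where F = "\<lambda>_::nat. seq_parts" and a = "\<lambda>_. 0"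
        and t = "\<lambda>_ P. (Test P, Test P)" and g = "\<lambda>_ x \<theta>. (Assign x \<theta>, Assign x \<theta>)"
        and n = "\<lambda>_ x. (AssignAny x, AssignAny x)" and od = "\<lambda>_ xs P. (Test P, Test P)"
        and c = "\<lambda>_ _ _. (Test Truth, Test Truth)" and s = "\<lambda>_ \<alpha> \<beta> _ _. (\<alpha>, \<beta>)" and d = "(Test Truth, Test Truth)"])
    (simp; fail | intro computable_intros; assumption?)+

lemma computable_ode_parts [computable_intros]: "computable \<alpha> \<Longrightarrow> computable (\<lambda>e. ode_parts (\<alpha> e))"
  by (rule computable_prog_recursion[where F = "\<lambda>_::nat. ode_parts" and a = "\<lambda>_. 0"
        and t = "\<lambda>_ P. ([], P)" and g = "\<lambda>_ _ _. ([], Truth)"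
        and n = "\<lambda>_ _. ([], Truth)" and od = "\<lambda>_ xs P. (xs, P)"
        and c = "\<lambda>_ _ _. ([], Truth)" and s = "\<lambda>_ _ _ _ _. ([], Truth)" and d = "([], Truth)"])
    (simp; fail | intro computable_intros; assumption?)+

lemma computable_paths [computable_intros]: "computable \<alpha> \<Longrightarrow> computable (\<lambda>e. paths (\<alpha> e))"
  by (rule computable_prog_recursion[where F = "\<lambda>_::nat. paths" and a = "\<lambda>_. 0"
        and t = "\<lambda>_ P. [[Test P]]" and g = "\<lambda>_ x \<theta>. [[Assign x \<theta>]]"
        and n = "\<lambda>_ x. [[AssignAny x]]" and od = "\<lambda>_ _ _. []"
        and c = "\<lambda>_. (@)" and s = "\<lambda>_ _ _ ps qs. concat (map (\<lambda>p. map ((@) p) qs) ps)" and d = "[]"])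
    (simp; fail | intro computable_intros; assumption?)+

lemma computable_assigned_var [computable_intros]: "computable \<alpha> \<Longrightarrow> computable (\<lambda>e. assigned_var (\<alpha> e))"
  by (rule computable_prog_recursion[where F = "\<lambda>_::nat. assigned_var" and a = "\<lambda>_. 0"
        and t = "\<lambda>_ _. []" and g = "\<lambda>_ x _. [x]" and n = "\<lambda>_ x. [x]" and od = "\<lambda>_ _ _. []"
        and c = "\<lambda>_ _ _. []" and s = "\<lambda>_ _ _ _ _. []" and d = "[]"])
    (simp; fail | intro computable_intros; assumption?)+

lemma computable_assigned [computable_intros]: "computable \<alpha> \<Longrightarrow> computable (\<lambda>e. assigned (\<alpha> e))"
  by (rule computable_compose[of assigned], unfold assigned_def, intro computable_intros)

lemma computable_derived_constructors [computable_intros]: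
  "computable s \<Longrightarrow> computable t \<Longrightarrow> computable (\<lambda>e. Equal (s e) (t e))"
  "computable P \<Longrightarrow> computable Q \<Longrightarrow> computable (\<lambda>e. Disj (P e) (Q e))"
  "computable x \<Longrightarrow> computable P \<Longrightarrow> computable (\<lambda>e. Exists (x e) (P e))"
  unfolding Equal_def Disj_def Exists_def by (intro computable_intros; assumption)+

lemma computable_step_fml [computable_intros]:
  "computable F \<Longrightarrow> computable \<alpha> \<Longrightarrow> computable (\<lambda>e. step_fml (F e) (\<alpha> e))"
  by (rule computable_prog_recursion[where F = step_fml
        and t = "\<lambda>F P. Conj P F" and g = "\<lambda>F x \<theta>. Exists scratch (Conj (Equal (Var scratch) \<theta>)
            (Exists x (Conj (Equal (Var x) (Var scratch)) F)))"
        and n = "\<lambda>F x. Exists x F" and od = "\<lambda>_ _ _. Truth"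
        and c = "\<lambda>_ _ _. Truth" and s = "\<lambda>_ _ _ _ _. Truth" and d = "Truth"])
    (simp; fail | intro computable_intros; assumption?)+

lemma computable_diamond [computable_intros]:
  "computable \<alpha> \<Longrightarrow> computable F \<Longrightarrow> computable (\<lambda>e. diamond (\<alpha> e) (F e))"
  by (rule computable_compose2[of diamond], unfold diamond_def, intro computable_intros)

lemma computable_ctrl_fml:
  assumes "computable \<alpha>" "computable xs" "computable Q" "computable \<beta>"
  shows "computable (\<lambda>e. ctrl_fml (\<alpha> e) (xs e) (Q e) (\<beta> e))"
  unfolding ctrl_fml_def equations_def copies_def Conjs_def
  by (intro computable_intros assms)

theorem theorem4:
  fixes C :: "prog_pair set"
  assumes "\<And>D. D \<in> C \<Longrightarrow> admissible D"
    and "decidable_on C (\<lambda>D. valid (box_fml D))"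
  shows "decidable_on C (\<lambda>D. valid (refinement_fml D))"
proof -
  define arith_part where "arith_part c = (let \<alpha> = seq_parts (fst c); plant = ode_parts (snd \<alpha>) in
      valid_arith (ctrl_fml (fst \<alpha>) (fst plant) (snd plant) (fst (seq_parts (snd c)))))" for c
  have "computable arith_part"
    unfolding arith_part_def Let_def by (intro computable_intros computable_ctrl_fml)
  then obtain r where r: "reval r [enc c] (enc (arith_part c))" for c
    unfolding computable_def total_recursive_def by metis
  obtain f where f: "\<And>D. D \<in> C \<Longrightarrow> reval f [pair_code D] (if valid (box_fml D) then 1 else 0)"
    using assms(2) unfolding decidable_on_def by blast
  \<comment> \<open>The product of the two 0/1 answers is their conjunction. It is defined on every
    pair in \<open>C\<close>: \<open>f\<close> terminates there and \<open>r\<close>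
    everywhere.\<close>
  have "reval (Comp recf_mult [f, r]) [pair_code D] (if valid (refinement_fml D) then 1 else 0)" if "D \<in> C" for D
  proof -
    define c where "c = (Seq (ctrl_a D) (plant_a D), Seq (ctrl_b D) (plant_b D))"
    have "enc c = pair_code D"
      by (simp only: c_def enc_Pair pair_code_def) (simp only: enc_prog_def)
    moreover have "valid (refinement_fml D) \<longleftrightarrow> valid (box_fml D) \<and> arith_part c"
      using refinement_reduction[OF assms(1)[OF that]] by (simp add: arith_part_def c_def plant_a_def)
    ultimately show ?thesis
      using reval_Comp2[OF f[OF that] _ reval_mult, of r "enc (arith_part c)"] r[of c]
      by (simp add: enc_bool_def split: if_splits)
  qed
  then show ?thesis unfolding decidable_on_def by blast
qed

end
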